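(* Let $d\ge 1$ and let $P$ be a tiling space of $\mathbb{R}^d$ satisfying the following hypotheses: (1) the tiles are (triangulated) polyhedra that meet full-face to full-face; (2) there are only finitely many tile types up to translation (tiles that are rotations of one another count as different types); (3) $P$ is a closed, nonempty and translation-invariant subset of the space of all tilings of $\mathbb{R}^d$ that can be formed from these tiles. Then there exists a tiling space $S$ whose tiles are marked unit $d$-cubes (equivalently, the $d$-fold suspension of a $\mathbb{Z}^d$ subshift) such that $P$ is homeomorphic to $S$, and such that $S$ is defined by local matching rules if and only if $P$ is.
   Context: Tiles and tilings. A prototile is a compact $d$-dimensional polyhedron in $\mathbb{R}^d$ (a polygon if $d=2$), homeomorphic to a closed ball, not necessarily convex, equipped with a fixed finite triangulation, and possibly carrying a mark (label); prototiles with different marks are considered different even if they have the same shape. Faces, edges and vertices of a tile refer to this triangulation. A finite set of prototiles is fixed; a tile is a translate of a prototile (with its triangulation and mark). A tiling is a collection of tiles whose union is $\mathbb{R}^d$, with pairwise disjoint interiors, meeting full-face to full-face: the intersection of any two tiles of the tiling is a (possibly empty) union of simplices that belong to the triangulations of both tiles, and the two triangulations agree there. Topology. $\mathbb{R}^d$ acts on tilings by translation. The space of all tilings by the given prototiles has the usual tiling topology: two tilings $T,T'$ are within $\varepsilon$ of each other if there are vectors $u,u'$ of norm at most $\varepsilon$ such that $T+u$ and $T'+u'$ agree (including marks) on the ball of radius $1/\varepsilon$ about the origin. A tiling space is a closed, nonempty, translation-invariant subset of the space of all tilings by a given finite set of prototiles, with the subspace topology. Marked-cube tiling spaces and suspensions.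 A tiling space whose tiles are marked unit $d$-cubes is one in which every prototile is the cube $[0,1]^d$ (sides parallel to the coordinate axes) carrying a mark from a finite set $A$, and in which the cubes of each tiling meet full cube-face to full cube-face, so that each tiling is a translate of the unit lattice cubing with marks. A $\mathbb{Z}^d$ subshift is a nonempty, closed, shift-invariant subset $X\subset A^{\mathbb{Z}^d}$, $A$ finite; writing $(\sigma^n x)_m=x_{m+n}$, its $d$-fold suspension is the quotient of $X\times\mathbb{R}^d$ by the relation $(\sigma^n x,v)\sim(x,v+n)$, $n\in\mathbb{Z}^d$. Local matching rules. A tiling space (with given finite prototile set) is defined by local matching rules (is of finite type) if there are $\rho>0$ and a finite set $\mathcal{F}$ of finite patches of tiles such that a tiling $T$ by the prototiles belongs to the space if and only if, for every $x\in\mathbb{R}^d$, the patch consisting of all tiles of $T$ that meet the closed ball of radius $\rho$ about $x$ is a translate of an element of $\mathcal{F}$. *)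

theory Defs
  imports "HOL-Analysis.Analysis"
begin

text \<open>
  A tile is a finite family of closed cells together with a mark; the underlying polyhedron is
  the union of the cells.  For a triangulated polyhedron the cells are the simplices of the
  triangulation; for a cube they are the faces of the cube.
\<close>

type_synonym ('a, 'm) tile = "'a set set \<times> 'm"

abbreviation cells :: "('a, 'm) tile \<Rightarrow> 'a set set" where
  "cells \<equiv> fst"

definition support :: "('a, 'm) tile \<Rightarrow> 'a set" where
  "support t = \<Union>(cells t)"

definition translate_tile :: "'a::ab_group_add \<Rightarrow> ('a, 'm) tile \<Rightarrow> ('a, 'm) tile" where
  "translate_tile v t = ((\<lambda>C. (+) v ` C) ` fst t, snd t)"

definition translate :: "'a::ab_group_add \<Rightarrow> ('a, 'm) tile set \<Rightarrow> ('a, 'm) tile set" where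
  "translate v T = translate_tile v ` T"

text \<open>Being homeomorphic to the closed unit ball of the ambient space forces full dimension.\<close>

definition polyhedral_tile :: "('a::euclidean_space, 'm) tile \<Rightarrow> bool" where
  "polyhedral_tile t \<longleftrightarrow>
     simplicial_complex (cells t) \<and> support t homeomorphic cball (0::'a) 1"

definition cube_tile :: "'m \<Rightarrow> ('a::euclidean_space, 'm) tile" where
  "cube_tile a = ({F. F face_of cbox 0 One}, a)"

definition tiles_of :: "('a::ab_group_add, 'm) tile set \<Rightarrow> ('a, 'm) tile set" where
  "tiles_of Pr = {translate_tile v p | v p. p \<in> Pr}"

definition meet_face_to_face :: "('a, 'm) tile \<Rightarrow> ('a, 'm) tile \<Rightarrow> bool" where
  "meet_face_to_face t t' \<longleftrightarrow>
     (\<exists>\<C> \<subseteq> cells t \<inter> cells t'. support t \<inter> support t' = \<Union>\<C>) \<and>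
     {C \<in> cells t. C \<subseteq> support t \<inter> support t'} = {C \<in> cells t'. C \<subseteq> support t \<inter> support t'}"

definition face_to_face_tiles :: "('a::euclidean_space, 'm) tile set \<Rightarrow> ('a, 'm) tile set \<Rightarrow> bool" where
  "face_to_face_tiles Pr T \<longleftrightarrow>
     T \<subseteq> tiles_of Pr \<and>
     (\<forall>t\<in>T. \<forall>t'\<in>T. t \<noteq> t' \<longrightarrow>
        interior (support t) \<inter> interior (support t') = {} \<and> meet_face_to_face t t')"

definition tilings :: "('a::euclidean_space, 'm) tile set \<Rightarrow> ('a, 'm) tile set set" where
  "tilings Pr = {T. face_to_face_tiles Pr T \<and> (\<Union>t\<in>T. support t) = UNIV}"

definition tiles_meeting :: "('a, 'm) tile set \<Rightarrow> 'a set \<Rightarrow> ('a, 'm) tile set" where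
  "tiles_meeting T B = {t \<in> T. support t \<inter> B \<noteq> {}}"

definition tilings_within :: "real \<Rightarrow> ('a::euclidean_space, 'm) tile set \<Rightarrow> ('a, 'm) tile set \<Rightarrow> bool" where
  "tilings_within \<epsilon> T T' \<longleftrightarrow>
     (\<exists>u u'. norm u \<le> \<epsilon> \<and> norm u' \<le> \<epsilon> \<and>
        tiles_meeting (translate u T) (cball 0 (1/\<epsilon>)) =
        tiles_meeting (translate u' T') (cball 0 (1/\<epsilon>)))"

text \<open>The relations \<^const>\<open>tilings_within\<close> generate a uniformity on tilings; this is its topology.\<close>

definition tiling_open :: "('a::euclidean_space, 'm) tile set \<Rightarrow> ('a, 'm) tile set set \<Rightarrow> bool" where
  "tiling_open Pr U \<longleftrightarrow>
     U \<subseteq> tilings Pr \<and> (\<forall>T\<in>U. \<exists>\<epsilon>>0. \<forall>T'\<in>tilings Pr. tilings_within \<epsilon> T T' \<longrightarrow> T' \<in> U)"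

definition tiling_topology :: "('a::euclidean_space, 'm) tile set \<Rightarrow> ('a, 'm) tile set topology" where
  "tiling_topology Pr = topology (tiling_open Pr)"

lemma tilings_within_mono:
  assumes "tilings_within \<delta> T T'" "0 < \<delta>" "\<delta> \<le> \<epsilon>"
  shows "tilings_within \<epsilon> T T'"
proof -
  obtain u u' where u: "norm u \<le> \<delta>" "norm u' \<le> \<delta>"
    and eq: "tiles_meeting (translate u T) (cball 0 (1/\<delta>)) =
             tiles_meeting (translate u' T') (cball 0 (1/\<delta>))"
    using assms(1) unfolding tilings_within_def by blast
  have sub: "cball (0::'a) (1/\<epsilon>) \<subseteq> cball 0 (1/\<delta>)"
    using assms by (intro subset_cball frac_le) auto
  have restrict: "tiles_meeting X (cball 0 (1/\<epsilon>)) =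
      tiles_meeting (tiles_meeting X (cball 0 (1/\<delta>))) (cball 0 (1/\<epsilon>))" for X :: "('a, 'b) tile set"
    using sub unfolding tiles_meeting_def by blast
  have "tiles_meeting (translate u T) (cball 0 (1/\<epsilon>)) =
        tiles_meeting (translate u' T') (cball 0 (1/\<epsilon>))"
    using restrict[of "translate u T"] restrict[of "translate u' T'"] eq by simp
  then show ?thesis
    using u assms(3) unfolding tilings_within_def by (meson order_trans)
qed

lemma istopology_tiling_open: "istopology (tiling_open Pr)"
  unfolding istopology_def
proof (intro conjI allI impI)
  fix U V assume U: "tiling_open Pr U" and V: "tiling_open Pr V"
  show "tiling_open Pr (U \<inter> V)"
    unfolding tiling_open_def
  proof (intro conjI ballI)
    show "U \<inter> V \<subseteq> tilings Pr"
      using U unfolding tiling_open_def by blast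
    fix T assume T: "T \<in> U \<inter> V"
    obtain \<delta> where d: "\<delta> > 0" "\<forall>T'\<in>tilings Pr. tilings_within \<delta> T T' \<longrightarrow> T' \<in> U"
      using T U unfolding tiling_open_def by blast
    obtain \<epsilon> where e: "\<epsilon> > 0" "\<forall>T'\<in>tilings Pr. tilings_within \<epsilon> T T' \<longrightarrow> T' \<in> V"
      using T V unfolding tiling_open_def by blast
    have "\<forall>T'\<in>tilings Pr. tilings_within (min \<delta> \<epsilon>) T T' \<longrightarrow> T' \<in> U \<inter> V"
      using d e tilings_within_mono[of "min \<delta> \<epsilon>"] by (metis IntI min.cobounded1 min.cobounded2 min_less_iff_conj)
    then show "\<exists>\<eta>>0. \<forall>T'\<in>tilings Pr. tilings_within \<eta> T T' \<longrightarrow> T' \<in> U \<inter> V"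
      using d(1) e(1) by (metis min_less_iff_conj)
  qed
next
  fix \<U> assume "\<forall>U\<in>\<U>. tiling_open Pr U"
  then show "tiling_open Pr (\<Union>\<U>)"
    unfolding tiling_open_def by (meson UnionE UnionI Sup_least)
qed

lemma openin_tiling_topology: "openin (tiling_topology Pr) = tiling_open Pr"
  unfolding tiling_topology_def by (rule topology_inverse'[OF istopology_tiling_open])

lemma topspace_tiling_topology: "topspace (tiling_topology Pr) = tilings Pr"
proof -
  have "tiling_open Pr (tilings Pr)"
    unfolding tiling_open_def using zero_less_one by blast
  then show ?thesis
    unfolding topspace_def openin_tiling_topology by (metis (mono_tags, lifting) Sup_upper Union_least mem_Collect_eq subset_antisym tiling_open_def)
qed

definition tiling_space :: "('a::euclidean_space, 'm) tile set \<Rightarrow> ('a, 'm) tile set set \<Rightarrow> bool" where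
  "tiling_space Pr P \<longleftrightarrow>
     finite Pr \<and> closedin (tiling_topology Pr) P \<and> P \<noteq> {} \<and>
     (\<forall>T\<in>P. \<forall>v. translate v T \<in> P)"

definition local_matching_rules ::
    "('a::euclidean_space, 'm) tile set \<Rightarrow> ('a, 'm) tile set set \<Rightarrow> bool" where
  "local_matching_rules Pr P \<longleftrightarrow>
     (\<exists>\<rho>>0. \<exists>\<F>. finite \<F> \<and> (\<forall>p\<in>\<F>. finite p \<and> face_to_face_tiles Pr p) \<and>
        (\<forall>T\<in>tilings Pr.
           T \<in> P \<longleftrightarrow> (\<forall>x. \<exists>p\<in>\<F>. \<exists>v. tiles_meeting T (cball x \<rho>) = translate v p)))"

definition shift :: "int ^ 'n \<Rightarrow> (int ^ 'n \<Rightarrow> 'm) \<Rightarrow> int ^ 'n \<Rightarrow> 'm" where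
  "shift n x = (\<lambda>m. x (m + n))"

definition config_topology :: "'m set \<Rightarrow> (int ^ 'n \<Rightarrow> 'm) topology" where
  "config_topology A = product_topology (\<lambda>_. discrete_topology A) UNIV"

definition subshift :: "'m set \<Rightarrow> (int ^ 'n \<Rightarrow> 'm) set \<Rightarrow> bool" where
  "subshift A X \<longleftrightarrow>
     finite A \<and> closedin (config_topology A) X \<and> X \<noteq> {} \<and> (\<forall>x\<in>X. \<forall>n. shift n x \<in> X)"

definition suspension_rel ::
    "(int ^ 'n \<Rightarrow> 'm) set \<Rightarrow> (((int ^ 'n \<Rightarrow> 'm) \<times> (real ^ 'n)) \<times> ((int ^ 'n \<Rightarrow> 'm) \<times> (real ^ 'n))) set" where
  "suspension_rel X =
     {((shift n x, v), (x, v + (\<chi> i. real_of_int (n $ i)))) | n x v. x \<in> X}"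

text \<open>Quotient topology: a set of classes is open iff its preimage, the union of the classes, is.\<close>

definition suspension_open ::
    "'m set \<Rightarrow> (int ^ 'n \<Rightarrow> 'm) set \<Rightarrow> ((int ^ 'n \<Rightarrow> 'm) \<times> (real ^ 'n)) set set \<Rightarrow> bool" where
  "suspension_open A X U \<longleftrightarrow>
     U \<subseteq> (X \<times> UNIV) // suspension_rel X \<and>
     openin (prod_topology (subtopology (config_topology A) X) euclidean) (\<Union>U)"

definition suspension ::
    "'m set \<Rightarrow> (int ^ 'n \<Rightarrow> 'm) set \<Rightarrow> ((int ^ 'n \<Rightarrow> 'm) \<times> (real ^ 'n)) set topology" where
  "suspension A X = topology (suspension_open A X)"

lemma equiv_suspension_rel:
  fixes X :: "(int ^ 'n \<Rightarrow> 'm) set"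
  assumes "\<And>x n. x \<in> X \<Longrightarrow> shift n x \<in> X"
  shows "equiv (X \<times> UNIV) (suspension_rel X)"
proof (rule equivI)
  let ?r = "\<lambda>n::int^'n. (\<chi> i. real_of_int (n $ i)) :: real^'n"
  have r0: "?r 0 = 0" and radd: "\<And>m n. ?r (m + n) = ?r m + ?r n" and rneg: "\<And>n. ?r (- n) = - ?r n"
    by (simp_all add: vec_eq_iff)
  have s0: "\<And>x. shift (0::int^'n) x = x"
    and sadd: "\<And>m n x. shift (m::int^'n) (shift n x) = shift (m + n) x"
    by (auto simp: shift_def add.assoc)
  show "suspension_rel X \<subseteq> (X \<times> UNIV) \<times> (X \<times> UNIV)"
    using assms unfolding suspension_rel_def by auto
  show "refl_on (X \<times> UNIV) (suspension_rel X)"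
  proof (rule refl_onI)
    fix p assume "p \<in> X \<times> (UNIV :: (real^'n) set)"
    then obtain x v where p: "p = (x, v)" "x \<in> X" by auto
    have "((shift 0 x, v), (x, v + ?r 0)) \<in> suspension_rel X"
      unfolding suspension_rel_def using p(2) by blast
    then show "(p, p) \<in> suspension_rel X" by (simp only: p(1) r0 s0 add_0_right)
  qed
  show "sym (suspension_rel X)"
  proof (rule symI)
    fix p q assume "(p, q) \<in> suspension_rel X"
    then obtain n x v where pq: "p = (shift n x, v)" "q = (x, v + ?r n)" "x \<in> X"
      unfolding suspension_rel_def by blast
    have "((shift (- n) (shift n x), v + ?r n), (shift n x, (v + ?r n) + ?r (- n))) \<in> suspension_rel X"
      unfolding suspension_rel_def using assms[OF pq(3)] by blast
    then show "(q, p) \<in> suspension_rel X"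
      unfolding pq(1,2) sadd rneg by (simp only: left_minus s0 add.assoc right_minus add_0_right)
  qed
  show "trans (suspension_rel X)"
  proof (rule transI)
    fix p q s assume "(p, q) \<in> suspension_rel X" "(q, s) \<in> suspension_rel X"
    then obtain m n x v where pqs: "p = (shift m (shift n x), v)"
        "s = (x, (v + ?r m) + ?r n)" "x \<in> X"
      unfolding suspension_rel_def by auto
    have "((shift (m + n) x, v), (x, v + ?r (m + n))) \<in> suspension_rel X"
      unfolding suspension_rel_def using pqs(3) by blast
    then show "(p, s) \<in> suspension_rel X"
      unfolding pqs(1,2) sadd radd by (simp only: add.assoc)
  qed
qed

lemma istopology_suspension_open:
  assumes "subshift A X"
  shows "istopology (suspension_open A X)"
proof -
  have eq: "equiv (X \<times> UNIV) (suspension_rel X)"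
    using assms by (intro equiv_suspension_rel) (auto simp: subshift_def)
  have int: "\<Union>(U \<inter> V) = \<Union>U \<inter> \<Union>V"
    if "U \<subseteq> (X \<times> UNIV) // suspension_rel X" "V \<subseteq> (X \<times> UNIV) // suspension_rel X" for U V
  proof
    show "\<Union>U \<inter> \<Union>V \<subseteq> \<Union>(U \<inter> V)"
    proof
      fix p assume "p \<in> \<Union>U \<inter> \<Union>V"
      then obtain C D where "p \<in> C" "C \<in> U" "p \<in> D" "D \<in> V" by blast
      moreover from this have "C = D" using quotient_disj[OF eq, of C D] that by blast
      ultimately show "p \<in> \<Union>(U \<inter> V)" by blast
    qed
  qed blast
  show ?thesis
    unfolding istopology_def
  proof (intro conjI allI impI)
    fix U V assume U: "suspension_open A X U" and V: "suspension_open A X V"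
    then show "suspension_open A X (U \<inter> V)"
      using int[of U V] unfolding suspension_open_def by (auto intro: openin_Int)
  next
    fix \<U> assume *: "\<forall>U\<in>\<U>. suspension_open A X U"
    have "\<Union>(\<Union>\<U>) = \<Union>(Union ` \<U>)" by blast
    moreover have "openin (prod_topology (subtopology (config_topology A) X) euclidean) (\<Union>(Union ` \<U>))"
      using * unfolding suspension_open_def by (intro openin_Union) blast
    ultimately show "suspension_open A X (\<Union>\<U>)"
      using * unfolding suspension_open_def by (metis Sup_least)
  qed
qed

lemma openin_suspension: "subshift A X \<Longrightarrow> openin (suspension A X) = suspension_open A X"
  unfolding suspension_def by (rule topology_inverse'[OF istopology_suspension_open])

end

theory Submission
  imports Defs
begin

text \<open>
  There are finitely many displacements between neighbouring tiles. An additive map \<open>\<phi>\<close> close to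
  \<open>N\<close> times the identity on them and with integral values there gives, by averaging
  \<open>\<phi> (pos t) + N (x - pos t)\<close> over the tiles \<open>t\<close> of \<open>T\<close> near \<open>x\<close>, a map \<open>F T\<close> that depends on \<open>T\<close> only
  locally, is a Lipschitz-small perturbation of the scaling by \<open>N\<close>, hence a bijection, and satisfies
  \<open>F (T - x) y = F T (x + y) - \<phi> x\<close>. Pulling back the cosets of the integer lattice by \<open>F T\<close> yields a set
  of vertices, and placing at the image of each vertex a unit cube marked by the pattern of \<open>T\<close> around
  that vertex turns \<open>T\<close> into a marked lattice cubing \<open>\<Psi> T\<close>. This is not a conjugacy of the translation
  actions (\<open>\<Psi> (T - x) = \<Psi> T - f T x\<close> with \<open>f T x = F T x - F T 0\<close>), but \<open>\<Psi>\<close> and its inverse are local.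
  For the matching rules one must see that a tiling by cubes that locally looks like some \<open>\<Psi> p\<close> is
  itself of the form \<open>\<Psi> T\<close>: the local preimages differ by translations forming a local cocycle on
  Euclidean space, which is a coboundary, so they can be translated into one tiling \<open>T\<close>.
\<close>

section \<open>Translations and agreement on balls\<close>

text \<open>Displacements between neighbouring tiles may be irrational. No tile is deformed to
  repair this; only displacement vectors are perturbed. The perturbation \<phi> is linear over the
  rationals, in general discontinuous, and close to \<open>N\<close> times the identity only on the
  displacements under control. Hence it is applied to positions of tiles alone and interpolated
  between them. How far the interpolation deviates from the scaling depends on the tile size and on
  the number of tiles in a ball, both known before \<phi> is chosen, so the Lipschitz constant of
  the deviation can be kept below \<open>N/3\<close>. The fraction 1/3 leaves room for inversion:
  the inverse deviates from the scaling by \<open>1/N\<close> with constant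
  \<open>1/(2 * N)\<close>, still smaller than \<open>1/N\<close>, so a map glued from such inverses
  is again a bijection. Integrality on displacements of touching tiles makes the lattice coset
  independent of the tile from which it is measured. A mark has to record so much of
  \<open>T\<close> that the single cube over the origin fixes \<open>T\<close> near the origin,
  including the position of the vertex from which that cube arose.\<close>

lemma translate_tile_0 [simp]: "translate_tile 0 t = t"
  by (cases t) (simp add: translate_tile_def)

lemma translate_tile_add: "translate_tile v (translate_tile w t) = translate_tile (v + w) t"
  by (simp add: translate_tile_def image_image add.assoc)

lemma translate_tile_inverse [simp]:
  "translate_tile (- v) (translate_tile v t) = t" "translate_tile v (translate_tile (- v) t) = t"
  by (simp_all add: translate_tile_add)

lemma support_translate_tile: "support (translate_tile v t) = (+) v ` support t"
  by (auto simp: support_def translate_tile_def)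

lemma translate_0 [simp]: "translate 0 T = T"
  by (simp add: translate_def)

lemma translate_add: "translate v (translate w T) = translate (v + w) T"
  by (simp add: translate_def image_image translate_tile_add)

lemma translate_inverse [simp]:
  "translate (- v) (translate v T) = T" "translate v (translate (- v) T) = T"
  by (simp_all add: translate_add)

lemma mem_translate: "t \<in> translate v T \<longleftrightarrow> translate_tile (- v) t \<in> T"
  unfolding translate_def by (metis image_iff translate_tile_inverse)

lemma translate_eq_iff: "translate v T = translate v T' \<longleftrightarrow> T = T'"
  by (metis translate_inverse(1))

lemma translate_tile_inj: "translate_tile v s = translate_tile v t \<longleftrightarrow> s = t"
  by (metis translate_tile_inverse(1))

lemma tiles_meeting_translate:
  fixes v :: "'a::real_normed_vector" and T :: "('a, 'm) tile set"
  shows "tiles_meeting (translate v T) (cball x R) = translate v (tiles_meeting T (cball (x - v) R))"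
proof -
  have iff: "support (translate_tile v t) \<inter> cball x R \<noteq> {} \<longleftrightarrow> support t \<inter> cball (x - v) R \<noteq> {}"
    for t :: "('a, 'm) tile"
  proof -
    have "dist x (v + y) = dist (x - v) y" for y
      by (simp add: dist_norm algebra_simps)
    then show ?thesis by (auto simp: support_translate_tile)
  qed
  show ?thesis
  proof (rule set_eqI)
    fix t
    show "t \<in> tiles_meeting (translate v T) (cball x R) \<longleftrightarrow>
        t \<in> translate v (tiles_meeting T (cball (x - v) R))"
      using iff[of "translate_tile (- v) t"] unfolding mem_translate tiles_meeting_def
      by (simp add: mem_translate)
  qed
qed

lemma tiles_meeting_subset:
  assumes "tiles_meeting T B = tiles_meeting T' B" "C \<subseteq> B"
  shows "tiles_meeting T C = tiles_meeting T' C"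
  using assms unfolding tiles_meeting_def by blast

text \<open>Agreement is stated about the origin only; agreement about \<open>x\<close> is expressed
  by translating both tilings by \<open>- x\<close>, the form to which equivariance applies.\<close>

definition agree :: "real \<Rightarrow> ('a::real_normed_vector, 'm) tile set \<Rightarrow> ('a, 'm) tile set \<Rightarrow> bool" where
  "agree R T T' \<longleftrightarrow> tiles_meeting T (cball 0 R) = tiles_meeting T' (cball 0 R)"

lemma agree_refl [simp]: "agree R T T"
  by (simp add: agree_def)

lemma agree_sym: "agree R T T' \<Longrightarrow> agree R T' T"
  by (simp add: agree_def)

lemma agree_trans [trans]: "agree R T T' \<Longrightarrow> agree R T' T'' \<Longrightarrow> agree R T T''"
  by (simp add: agree_def)

lemma agree_mono: "agree R T T' \<Longrightarrow> R' \<le> R \<Longrightarrow> agree R' T T'"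
  unfolding agree_def by (erule tiles_meeting_subset) auto

lemma agree_translate_iff:
  "agree R (translate v T) (translate v T') \<longleftrightarrow>
    tiles_meeting T (cball (- v) R) = tiles_meeting T' (cball (- v) R)"
  by (simp add: agree_def tiles_meeting_translate translate_eq_iff)

lemma agree_translate:
  assumes "agree R T T'" "norm v + R' \<le> R"
  shows "agree R' (translate v T) (translate v T')"
  unfolding agree_translate_iff
proof (rule tiles_meeting_subset)
  show "tiles_meeting T (cball 0 R) = tiles_meeting T' (cball 0 R)"
    using assms(1) by (simp add: agree_def)
  show "cball (- v) R' \<subseteq> cball 0 R"
  proof
    fix y assume "y \<in> cball (- v) R'"
    then show "y \<in> cball 0 R"
      using assms(2) norm_triangle_ineq[of "y + v" "- v"] by (simp add: dist_norm norm_minus_commute add.commute)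
  qed
qed

lemma agree_mem:
  assumes "agree R T T'" "y \<in> support t" "norm y \<le> R"
  shows "t \<in> T \<longleftrightarrow> t \<in> T'"
proof -
  have "t \<in> tiles_meeting T (cball 0 R) \<longleftrightarrow> t \<in> T" "t \<in> tiles_meeting T' (cball 0 R) \<longleftrightarrow> t \<in> T'"
    using assms(2,3) unfolding tiles_meeting_def by auto
  then show ?thesis using assms(1) by (simp add: agree_def)
qed

lemma tilings_within_agree:
  "tilings_within \<epsilon> T T' \<longleftrightarrow>
    (\<exists>u u'. norm u \<le> \<epsilon> \<and> norm u' \<le> \<epsilon> \<and> agree (1/\<epsilon>) (translate u T) (translate u' T'))"
  by (simp add: tilings_within_def agree_def)

lemma agree_imp_within: "agree (1/\<epsilon>) T T' \<Longrightarrow> 0 < \<epsilon> \<Longrightarrow> tilings_within \<epsilon> T T'"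
  unfolding tilings_within_agree by (intro exI[of _ 0]) auto

lemma translate_tiles_of: "t \<in> tiles_of Pr \<Longrightarrow> translate_tile v t \<in> tiles_of Pr"
  unfolding tiles_of_def using translate_tile_add by blast

lemma image_plus_subset_iff: "(+) v ` A \<subseteq> (+) v ` B \<longleftrightarrow> A \<subseteq> B" for v :: "'a::ab_group_add"
  by (rule inj_image_subset_iff) (simp add: inj_on_def)

lemma meet_face_to_face_translate:
  assumes "meet_face_to_face t t'"
  shows "meet_face_to_face (translate_tile v t) (translate_tile v t')"
proof -
  have I: "(+) v ` A \<inter> (+) v ` B = (+) v ` (A \<inter> B)" for A B
    by auto
  obtain \<C> where C: "\<C> \<subseteq> cells t \<inter> cells t'" "support t \<inter> support t' = \<Union>\<C>"
    and eq: "{C \<in> cells t. C \<subseteq> support t \<inter> support t'} = {C \<in> cells t'. C \<subseteq> support t \<inter> support t'}"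
    using assms unfolding meet_face_to_face_def by (elim conjE exE) (rule that; assumption)
  have *: "{C \<in> (`) ((+) v) ` cells s. C \<subseteq> (+) v ` B} = (`) ((+) v) ` {C \<in> cells s. C \<subseteq> B}" for s B
  proof (rule set_eqI)
    fix X
    show "X \<in> {C \<in> (`) ((+) v) ` cells s. C \<subseteq> (+) v ` B} \<longleftrightarrow> X \<in> (`) ((+) v) ` {C \<in> cells s. C \<subseteq> B}"
      using image_plus_subset_iff[of v _ B] by blast
  qed
  show ?thesis
    unfolding meet_face_to_face_def support_translate_tile I
  proof (intro conjI exI)
    show "(`) ((+) v) ` \<C> \<subseteq> cells (translate_tile v t) \<inter> cells (translate_tile v t')"
      using C(1) by (auto simp: translate_tile_def)
    show "(+) v ` (support t \<inter> support t') = \<Union> ((`) ((+) v) ` \<C>)"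
      unfolding C(2) by blast
    show "{C \<in> cells (translate_tile v t). C \<subseteq> (+) v ` (support t \<inter> support t')} =
        {C \<in> cells (translate_tile v t'). C \<subseteq> (+) v ` (support t \<inter> support t')}"
      using eq unfolding translate_tile_def fst_conv * by simp
  qed
qed

lemma tilings_translate:
  fixes T :: "('a::euclidean_space, 'm) tile set"
  assumes "T \<in> tilings Pr"
  shows "translate v T \<in> tilings Pr"
proof -
  have tiles: "translate v T \<subseteq> tiles_of Pr"
  proof
    fix s assume "s \<in> translate v T"
    then obtain t where t: "t \<in> T" "s = translate_tile v t"
      unfolding translate_def by (rule imageE)
    have "t \<in> tiles_of Pr"
      using assms t(1) unfolding tilings_def face_to_face_tiles_def by (elim CollectE conjE) (rule subsetD)
    then show "s \<in> tiles_of Pr"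
      unfolding t(2) by (rule translate_tiles_of)
  qed
  have pair: "interior (support (translate_tile v t)) \<inter> interior (support (translate_tile v t')) = {} \<and>
      meet_face_to_face (translate_tile v t) (translate_tile v t')"
    if "t \<in> T" "t' \<in> T" "t \<noteq> t'" for t t'
  proof
    have "interior (support t) \<inter> interior (support t') = {}" "meet_face_to_face t t'"
      using assms that unfolding tilings_def face_to_face_tiles_def by auto
    then show "interior (support (translate_tile v t)) \<inter> interior (support (translate_tile v t')) = {}"
        "meet_face_to_face (translate_tile v t) (translate_tile v t')"
      by (auto simp: support_translate_tile interior_translation intro: meet_face_to_face_translate)
  qed
  have "(\<Union>t\<in>translate v T. support t) = UNIV"
  proof -
    have "x \<in> (\<Union>t\<in>translate v T. support t)" for x
    proof -
      have "x - v \<in> (\<Union>t\<in>T. support t)"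
        using assms unfolding tilings_def by auto
      then obtain t where "t \<in> T" "x - v \<in> support t" by blast
      then have "translate_tile v t \<in> translate v T" "x \<in> support (translate_tile v t)"
        unfolding translate_def support_translate_tile by (auto intro: image_eqI[of _ _ "x - v"])
      then show ?thesis by blast
    qed
    then show ?thesis by blast
  qed
  moreover have "interior (support s) \<inter> interior (support s') = {} \<and> meet_face_to_face s s'"
    if st: "s \<in> translate v T" "s' \<in> translate v T" "s \<noteq> s'" for s s'
  proof -
    obtain t t' where "t \<in> T" "s = translate_tile v t" "t' \<in> T" "s' = translate_tile v t'"
      using st(1,2) unfolding translate_def by (elim imageE) (rule that)
    then show ?thesis using pair[of t t'] st(3) by (simp add: translate_tile_inj)
  qed
  ultimately show ?thesis
    using tiles unfolding tilings_def face_to_face_tiles_def by (simp only: mem_Collect_eq) simp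
qed

lemma tilings_cover: "T \<in> tilings Pr \<Longrightarrow> \<exists>t\<in>T. x \<in> support t"
  unfolding tilings_def by blast

section \<open>Closed sets and continuous maps in the tiling topology\<close>

lemma closedin_tilingsD:
  assumes "closedin (tiling_topology Pr) P" "T \<in> tilings Pr" "T \<notin> P"
  shows "\<exists>\<epsilon>>0. \<forall>T'\<in>P. \<not> tilings_within \<epsilon> T T'"
proof -
  have "tiling_open Pr (tilings Pr - P)" "P \<subseteq> tilings Pr"
    using assms(1) unfolding closedin_def openin_tiling_topology topspace_tiling_topology by auto
  then show ?thesis
    using assms(2,3) unfolding tiling_open_def by blast
qed

lemma closedin_tilingsI:
  assumes "P \<subseteq> tilings Pr"
    and "\<And>T. T \<in> tilings Pr \<Longrightarrow> (\<And>\<epsilon>. \<epsilon> > 0 \<Longrightarrow> \<exists>T'\<in>P. tilings_within \<epsilon> T T') \<Longrightarrow> T \<in> P"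
  shows "closedin (tiling_topology Pr) P"
  using assms unfolding closedin_def openin_tiling_topology topspace_tiling_topology tiling_open_def
  by blast

lemma tiling_space_subset: "tiling_space Pr P \<Longrightarrow> P \<subseteq> tilings Pr"
  unfolding tiling_space_def by (metis closedin_subset topspace_tiling_topology)

text \<open>As \<open>P\<close> is closed, the union of the preimage of an open set with the complement of \<open>P\<close> is open
  directly by definition; the approximate triangle inequality for \<^const>\<open>tilings_within\<close> is avoided.\<close>

lemma continuous_map_tilings:
  assumes P: "closedin (tiling_topology Pr) P" and h: "h ` P \<subseteq> topspace Y"
    and near: "\<And>T U. T \<in> P \<Longrightarrow> openin Y U \<Longrightarrow> h T \<in> U \<Longrightarrow>
      \<exists>\<epsilon>>0. \<forall>T'\<in>P. tilings_within \<epsilon> T T' \<longrightarrow> h T' \<in> U"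
  shows "continuous_map (subtopology (tiling_topology Pr) P) Y h"
proof -
  have sub: "P \<subseteq> tilings Pr"
    using P by (metis closedin_subset topspace_tiling_topology)
  then have top: "topspace (subtopology (tiling_topology Pr) P) = P"
    by (auto simp: topspace_tiling_topology)
  show ?thesis
    unfolding continuous_map_def top
  proof (intro conjI allI impI)
    show "h \<in> P \<rightarrow> topspace Y" using h by blast
    fix U assume U: "openin Y U"
    define W where "W = {T \<in> tilings Pr. T \<in> P \<longrightarrow> h T \<in> U}"
    have "tiling_open Pr W"
      unfolding tiling_open_def
    proof (intro conjI ballI)
      show "W \<subseteq> tilings Pr" by (auto simp: W_def)
      fix T assume T: "T \<in> W"
      show "\<exists>\<epsilon>>0. \<forall>T'\<in>tilings Pr. tilings_within \<epsilon> T T' \<longrightarrow> T' \<in> W"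
      proof (cases "T \<in> P")
        case True
        then show ?thesis using near[OF True U] T unfolding W_def by blast
      next
        case False
        then show ?thesis using closedin_tilingsD[OF P] T unfolding W_def by blast
      qed
    qed
    moreover have "{T \<in> P. h T \<in> U} = W \<inter> P"
      using sub by (auto simp: W_def)
    ultimately show "openin (subtopology (tiling_topology Pr) P) {T \<in> P. h T \<in> U}"
      unfolding openin_subtopology openin_tiling_topology by blast
  qed
qed

lemma continuous_map_between_tilings:
  assumes P: "closedin (tiling_topology Pr) P" and h: "h ` P \<subseteq> S" and S: "S \<subseteq> tilings Pr'"
    and near: "\<And>T \<epsilon>. T \<in> P \<Longrightarrow> \<epsilon> > 0 \<Longrightarrow>
      \<exists>\<delta>>0. \<forall>T'\<in>P. tilings_within \<delta> T T' \<longrightarrow> tilings_within \<epsilon> (h T) (h T')"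
  shows "continuous_map (subtopology (tiling_topology Pr) P) (subtopology (tiling_topology Pr') S) h"
proof (rule continuous_map_tilings[OF P])
  show "h ` P \<subseteq> topspace (subtopology (tiling_topology Pr') S)"
    using h S by (auto simp: topspace_tiling_topology)
  fix T U assume T: "T \<in> P" "openin (subtopology (tiling_topology Pr') S) U" "h T \<in> U"
  then obtain U0 where U0: "tiling_open Pr' U0" "U = U0 \<inter> S"
    unfolding openin_subtopology openin_tiling_topology by blast
  then obtain \<epsilon> where "\<epsilon> > 0" "\<forall>T'\<in>tilings Pr'. tilings_within \<epsilon> (h T) T' \<longrightarrow> T' \<in> U0"
    using T(3) unfolding tiling_open_def by blast
  then show "\<exists>\<epsilon>>0. \<forall>T'\<in>P. tilings_within \<epsilon> T T' \<longrightarrow> h T' \<in> U"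
    using near[OF T(1), of \<epsilon>] U0(2) h S by blast
qed

text \<open>Tiles are pairs, and quantifiers over tiles should not be split into cells and
  mark.\<close>

declare split_paired_All [simp del] split_paired_Ex [simp del]

lemma tilings_tiles: "T \<in> tilings Pr \<Longrightarrow> t \<in> T \<Longrightarrow> t \<in> tiles_of Pr"
  unfolding tilings_def face_to_face_tiles_def by (elim CollectE conjE) (rule subsetD)

lemma tilings_interiors:
  "T \<in> tilings Pr \<Longrightarrow> s \<in> T \<Longrightarrow> t \<in> T \<Longrightarrow> s \<noteq> t \<Longrightarrow> interior (support s) \<inter> interior (support t) = {}"
  unfolding tilings_def face_to_face_tiles_def by simp

lemma tilings_meet:
  "T \<in> tilings Pr \<Longrightarrow> s \<in> T \<Longrightarrow> t \<in> T \<Longrightarrow> s \<noteq> t \<Longrightarrow> meet_face_to_face s t"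
  unfolding tilings_def face_to_face_tiles_def by simp

lemma tilingsI:
  assumes "\<And>t. t \<in> T \<Longrightarrow> t \<in> tiles_of Pr"
    and "\<And>s t. s \<in> T \<Longrightarrow> t \<in> T \<Longrightarrow> s \<noteq> t \<Longrightarrow> interior (support s) \<inter> interior (support t) = {}"
    and "\<And>s t. s \<in> T \<Longrightarrow> t \<in> T \<Longrightarrow> s \<noteq> t \<Longrightarrow> meet_face_to_face s t"
    and "\<And>x. \<exists>t\<in>T. x \<in> support t"
  shows "T \<in> tilings Pr"
  unfolding tilings_def face_to_face_tiles_def mem_Collect_eq
  using assms by (intro conjI ballI impI subsetI set_eqI) simp_all

section \<open>Finite local complexity\<close>

text \<open>The lower corner of the bounding box: a reference point that moves along with every
  nonempty bounded set. It serves tiles and single cells alike.\<close>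

definition corner :: "'a::euclidean_space set \<Rightarrow> 'a" where
  "corner A = (\<Sum>b\<in>Basis. Inf ((\<lambda>x. x \<bullet> b) ` A) *\<^sub>R b)"

lemma corner_translate:
  assumes "A \<noteq> {}" "bounded A"
  shows "corner ((+) v ` A) = v + corner A"
proof -
  have Inf: "Inf ((\<lambda>x. x \<bullet> b) ` (+) v ` A) = v \<bullet> b + Inf ((\<lambda>x. x \<bullet> b) ` A)" if b: "b \<in> Basis" for b
  proof (rule antisym)
    obtain B where B: "\<And>x. x \<in> A \<Longrightarrow> norm x \<le> B"
      using assms(2) bounded_iff by blast
    have low: "- B \<le> x \<bullet> b" if "x \<in> A" for x
      using Basis_le_norm[OF b, of x] B[OF that] by linarith
    have "- B + v \<bullet> b \<le> (v + x) \<bullet> b" if "x \<in> A" for x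
      using low[OF that] by (simp add: inner_add_left)
    then have bd: "bdd_below ((\<lambda>x. x \<bullet> b) ` A)" "bdd_below ((\<lambda>x. x \<bullet> b) ` (+) v ` A)"
      using low by (auto simp: bdd_below_def)
    have "Inf ((\<lambda>x. x \<bullet> b) ` (+) v ` A) - v \<bullet> b \<le> Inf ((\<lambda>x. x \<bullet> b) ` A)"
    proof (rule cInf_greatest)
      fix y assume "y \<in> (\<lambda>x. x \<bullet> b) ` A"
      then obtain x where "x \<in> A" "y = x \<bullet> b" by blast
      then have "Inf ((\<lambda>x. x \<bullet> b) ` (+) v ` A) \<le> (v + x) \<bullet> b"
        by (intro cInf_lower bd) auto
      then show "Inf ((\<lambda>x. x \<bullet> b) ` (+) v ` A) - v \<bullet> b \<le> y"
        by (simp add: \<open>y = x \<bullet> b\<close> inner_add_left)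
    qed (use assms in auto)
    then show "Inf ((\<lambda>x. x \<bullet> b) ` (+) v ` A) \<le> v \<bullet> b + Inf ((\<lambda>x. x \<bullet> b) ` A)" by simp
    show "v \<bullet> b + Inf ((\<lambda>x. x \<bullet> b) ` A) \<le> Inf ((\<lambda>x. x \<bullet> b) ` (+) v ` A)"
    proof (rule cInf_greatest)
      fix y assume "y \<in> (\<lambda>x. x \<bullet> b) ` (+) v ` A"
      then obtain x where x: "x \<in> A" "y = (v + x) \<bullet> b" by blast
      then have "Inf ((\<lambda>x. x \<bullet> b) ` A) \<le> x \<bullet> b"
        by (intro cInf_lower bd) auto
      then show "v \<bullet> b + Inf ((\<lambda>x. x \<bullet> b) ` A) \<le> y"
        by (simp add: x(2) inner_add_left)
    qed (use assms in auto)
  qed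
  have "corner ((+) v ` A) = (\<Sum>b\<in>Basis. (v \<bullet> b) *\<^sub>R b + Inf ((\<lambda>x. x \<bullet> b) ` A) *\<^sub>R b)"
    unfolding corner_def by (intro sum.cong refl) (simp add: Inf scaleR_add_left)
  then show ?thesis
    by (simp add: sum.distrib euclidean_representation corner_def)
qed

abbreviation pos :: "('a::euclidean_space, 'm) tile \<Rightarrow> 'a" where
  "pos t \<equiv> corner (support t)"

text \<open>Normal form up to translation; all translates of one prototile share it, so only
  finitely many shapes occur.\<close>

definition shape :: "('a::euclidean_space, 'm) tile \<Rightarrow> ('a, 'm) tile" where
  "shape t = translate_tile (- pos t) t"

text \<open>These are the total displacements along chains of \<open>n\<close> steps from
  \<open>D\<close>.\<close>

primrec sums_of :: "'a::ab_group_add set \<Rightarrow> nat \<Rightarrow> 'a set" where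
  "sums_of D 0 = {0}"
| "sums_of D (Suc n) = (\<lambda>(x, d). x + d) ` (sums_of D n \<times> D)"

lemma finite_sums_of: "finite D \<Longrightarrow> finite (sums_of D n)"
  by (induction n) auto

lemma relpow_difference_sums_of:
  assumes "\<And>u v. (u, v) \<in> E \<Longrightarrow> c v - c u \<in> D"
  shows "(u, v) \<in> E ^^ n \<Longrightarrow> c v - c u \<in> sums_of D n"
proof (induction n arbitrary: v)
  case (Suc n)
  then obtain w where w: "(u, w) \<in> E ^^ n" "(w, v) \<in> E" by auto
  have "c v - c u = (c w - c u) + (c v - c w)" by simp
  then show ?case using Suc.IH[OF w(1)] assms[OF w(2)] by (auto intro: image_eqI[of _ _ "(c w - c u, c v - c w)"])
qed auto

text \<open>If \<open>U\<close> does not lie in \<open>A\<close>, then \<open>U - A\<close> is again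
  open and nonempty and is covered by the remaining sets. This is the finite case of Baire's
  theorem.\<close>

lemma open_subset_finite_Union_closed:
  assumes "finite \<F>" "\<And>A. A \<in> \<F> \<Longrightarrow> closed A" "open U" "U \<noteq> {}" "U \<subseteq> \<Union>\<F>"
  shows "\<exists>A\<in>\<F>. U \<inter> interior A \<noteq> {}"
  using assms
proof (induction \<F> arbitrary: U rule: finite_induct)
  case (insert A \<F>)
  show ?case
  proof (cases "U \<subseteq> A")
    case True
    then have "U \<subseteq> interior A" using insert.prems by (intro interior_maximal) auto
    then show ?thesis using insert.prems by auto
  next
    case False
    have "\<exists>B\<in>\<F>. (U - A) \<inter> interior B \<noteq> {}"
      using False insert.prems by (intro insert.IH) auto
    then show ?thesis by auto
  qed
qed auto

text \<open>The common ground of polyhedral prototiles and marked cubes. The empty cell makes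
  disjoint tiles meet face to face: each then has exactly the empty cell inside the
  intersection.\<close>

locale protoset =
  fixes Pr :: "('a::euclidean_space, 'm) tile set"
  assumes finite_Pr: "finite Pr"
    and finite_cells: "t \<in> Pr \<Longrightarrow> finite (cells t)"
    and empty_cell: "t \<in> Pr \<Longrightarrow> {} \<in> cells t"
    and compact_cell: "t \<in> Pr \<Longrightarrow> C \<in> cells t \<Longrightarrow> compact C"
    and interior_nonempty: "t \<in> Pr \<Longrightarrow> interior (support t) \<noteq> {}"
begin

lemma tiles_ofE:
  assumes "t \<in> tiles_of Pr"
  obtains v p where "p \<in> Pr" "t = translate_tile v p"
  using assms unfolding tiles_of_def by blast

lemma tile_empty_cell: "t \<in> tiles_of Pr \<Longrightarrow> {} \<in> cells t"
  by (erule tiles_ofE) (auto simp: translate_tile_def empty_cell image_iff intro: bexI[of _ "{}"])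

lemma tile_finite_cells: "t \<in> tiles_of Pr \<Longrightarrow> finite (cells t)"
  by (erule tiles_ofE) (auto simp: translate_tile_def finite_cells)

lemma tile_compact_cell: "t \<in> tiles_of Pr \<Longrightarrow> C \<in> cells t \<Longrightarrow> compact C"
  by (erule tiles_ofE) (auto simp: translate_tile_def intro!: compact_translation compact_cell)

lemma tile_compact: "t \<in> tiles_of Pr \<Longrightarrow> compact (support t)"
  unfolding support_def by (intro compact_Union tile_finite_cells) (auto intro: tile_compact_cell)

lemma tile_interior: "t \<in> tiles_of Pr \<Longrightarrow> interior (support t) \<noteq> {}"
  by (erule tiles_ofE) (auto simp: support_translate_tile interior_translation interior_nonempty)

lemma tile_nonempty: "t \<in> tiles_of Pr \<Longrightarrow> support t \<noteq> {}"
  using tile_interior interior_subset by blast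

lemma tile_closed: "t \<in> tiles_of Pr \<Longrightarrow> closed (support t)"
  by (simp add: tile_compact compact_imp_closed)

lemma pos_translate: "t \<in> tiles_of Pr \<Longrightarrow> pos (translate_tile v t) = v + pos t"
  by (simp add: support_translate_tile corner_translate tile_nonempty tile_compact compact_imp_bounded)

lemma shape_translate: "t \<in> tiles_of Pr \<Longrightarrow> shape (translate_tile v t) = shape t"
  by (simp add: shape_def pos_translate translate_tile_add)

lemma Pr_tiles_of: "p \<in> Pr \<Longrightarrow> p \<in> tiles_of Pr"
  unfolding tiles_of_def mem_Collect_eq by (intro exI[of _ 0] exI[of _ p]) simp

lemma shape_mem: "t \<in> tiles_of Pr \<Longrightarrow> shape t \<in> shape ` Pr"
  by (erule tiles_ofE) (auto simp: shape_translate Pr_tiles_of)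

lemma shape_tile: "t \<in> tiles_of Pr \<Longrightarrow> shape t \<in> tiles_of Pr"
  by (simp add: shape_def translate_tiles_of)

lemma ex_radius: "\<exists>\<delta>>0. \<forall>t\<in>tiles_of Pr. support t \<subseteq> cball (pos t) \<delta>"
proof -
  have "bounded (\<Union>n\<in>shape ` Pr. support n)"
    using finite_Pr compact_imp_bounded[OF tile_compact[OF shape_tile[OF Pr_tiles_of]]]
    by (intro bounded_UN ballI finite_imageI) blast+
  then obtain B where B: "B > 0" "\<And>n x. n \<in> shape ` Pr \<Longrightarrow> x \<in> support n \<Longrightarrow> norm x \<le> B"
    unfolding bounded_pos by blast
  have "support t \<subseteq> cball (pos t) B" if t: "t \<in> tiles_of Pr" for t
  proof
    fix x assume "x \<in> support t"
    then have "x - pos t \<in> support (shape t)"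
      by (auto simp: shape_def support_translate_tile)
    then show "x \<in> cball (pos t) B"
      using B(2)[OF shape_mem[OF t]] by (auto simp: dist_norm norm_minus_commute)
  qed
  then show ?thesis using B(1) by blast
qed

definition radius :: real where
  "radius = (SOME \<delta>. \<delta> > 0 \<and> (\<forall>t\<in>tiles_of Pr. support t \<subseteq> cball (pos t) \<delta>))"

lemma radius: "radius > 0" "t \<in> tiles_of Pr \<Longrightarrow> x \<in> support t \<Longrightarrow> norm (x - pos t) \<le> radius"
proof -
  have "radius > 0 \<and> (\<forall>t\<in>tiles_of Pr. support t \<subseteq> cball (pos t) radius)"
    unfolding radius_def by (rule someI_ex[OF ex_radius])
  then show "radius > 0" "t \<in> tiles_of Pr \<Longrightarrow> x \<in> support t \<Longrightarrow> norm (x - pos t) \<le> radius"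
    by (auto simp: subset_iff dist_norm norm_minus_commute)
qed

lemma tile_diameter:
  assumes "t \<in> tiles_of Pr" "x \<in> support t" "y \<in> support t"
  shows "norm (x - y) \<le> 2 * radius"
  using radius(2)[OF assms(1,2)] radius(2)[OF assms(1,3)] norm_triangle_ineq4[of "x - pos t" "y - pos t"]
  by simp

lemma ex_inner_radius: "\<exists>r>0. \<forall>t\<in>tiles_of Pr. \<exists>z\<in>support t. ball z r \<subseteq> interior (support t)"
proof -
  have "\<exists>z r. r > 0 \<and> ball z r \<subseteq> interior (support n)" if "n \<in> Pr" for n
    using interior_nonempty[OF that] open_interior open_contains_ball by blast
  then obtain z r where zr: "\<And>n. n \<in> Pr \<Longrightarrow> r n > (0::real) \<and> ball (z n) (r n) \<subseteq> interior (support n)"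
    by metis
  define r0 where "r0 = Min (insert 1 (r ` Pr))"
  have r0: "r0 > 0" "\<And>n. n \<in> Pr \<Longrightarrow> r0 \<le> r n"
    using finite_Pr zr by (auto simp: r0_def)
  have "\<exists>z\<in>support t. ball z r0 \<subseteq> interior (support t)" if "t \<in> tiles_of Pr" for t
  proof -
    obtain v p where p: "p \<in> Pr" "t = translate_tile v p"
      using \<open>t \<in> tiles_of Pr\<close> unfolding tiles_of_def by blast
    have "ball (v + z p) r0 = (+) v ` ball (z p) r0"
      by (rule ball_translation)
    also have "\<dots> \<subseteq> (+) v ` interior (support p)"
      using zr[OF p(1)] r0(2)[OF p(1)] by (intro image_mono) (auto simp: subset_iff)
    finally have "ball (v + z p) r0 \<subseteq> interior (support t)"
      by (simp add: p(2) support_translate_tile interior_translation)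
    moreover have "v + z p \<in> ball (v + z p) r0" using r0(1) by simp
    ultimately show ?thesis using interior_subset by blast
  qed
  then show ?thesis using r0(1) by blast
qed

text \<open>Every tile contains a ball of a fixed radius \<open>r\<close> in its interior. The
  centres of these balls are covered by boundedly many balls of radius \<open>r/2\<close>, and two
  tiles with centres in the same one would have the centre of one in both interiors. The bound
  depends neither on \<open>T\<close> nor on \<open>x\<close>.\<close>

lemma packing: "\<exists>M. \<forall>T\<in>tilings Pr. \<forall>x. finite {t \<in> T. norm (pos t - x) \<le> R} \<and> card {t \<in> T. norm (pos t - x) \<le> R} \<le> M"
proof -
  obtain r where r: "r > 0" "\<And>t. t \<in> tiles_of Pr \<Longrightarrow> \<exists>z\<in>support t. ball z r \<subseteq> interior (support t)"
    using ex_inner_radius by blast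
  then obtain z where z: "\<And>t. t \<in> tiles_of Pr \<Longrightarrow> z t \<in> support t \<and> ball (z t) r \<subseteq> interior (support t)"
    by metis
  have "compact (cball (0::'a) (R + radius))" by simp
  then obtain F where F: "finite F" "cball (0::'a) (R + radius) \<subseteq> (\<Union>x\<in>F. ball x (r/2))"
    using r(1) unfolding compact_eq_totally_bounded by (meson half_gt_zero)
  show ?thesis
  proof (intro exI ballI allI)
    fix T x assume T: "T \<in> tilings Pr"
    let ?A = "{t \<in> T. norm (pos t - x) \<le> R}"
    have "\<exists>a\<in>F. norm (z t - x - a) < r/2" if "t \<in> ?A" for t
    proof -
      have "t \<in> tiles_of Pr" using that tilings_tiles[OF T] by blast
      then have "norm (z t - pos t) \<le> radius" using radius(2) z by blast
      then have "norm (z t - x) \<le> R + radius"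
        using that norm_triangle_ineq[of "z t - pos t" "pos t - x"] by simp
      then have "z t - x \<in> cball 0 (R + radius)" by simp
      then have "z t - x \<in> (\<Union>x\<in>F. ball x (r/2))" using F(2) by blast
      then show ?thesis by (simp add: dist_norm norm_minus_commute)
    qed
    then have "\<forall>t\<in>?A. \<exists>a. a \<in> F \<and> norm (z t - x - a) < r/2" by blast
    from bchoice[OF this] obtain a where "\<forall>t\<in>?A. a t \<in> F \<and> norm (z t - x - a t) < r/2" ..
    then have a: "\<And>t. t \<in> ?A \<Longrightarrow> a t \<in> F \<and> norm (z t - x - a t) < r/2" by (rule bspec)
    have inj: "inj_on a ?A"
    proof (rule inj_onI, rule ccontr)
      fix s t assume st: "s \<in> ?A" "t \<in> ?A" "a s = a t" "s \<noteq> t"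
      have "norm (z s - z t) < r"
        using a[OF st(1)] a[OF st(2)] norm_triangle_ineq4[of "z s - x - a s" "z t - x - a t"] st(3) by simp
      then have zs: "z t \<in> ball (z s) r" by (simp add: dist_norm)
      have T2: "s \<in> T" "t \<in> T" using st by simp_all
      have "z t \<in> interior (support s)"
        using z[OF tilings_tiles[OF T T2(1)]] zs by (meson subsetD)
      moreover have "z t \<in> interior (support t)"
        using z[OF tilings_tiles[OF T T2(2)]] r(1) centre_in_ball by (meson subsetD)
      ultimately show False using tilings_interiors[OF T T2 st(4)] by (meson disjoint_iff)
    qed
    have sub: "a ` ?A \<subseteq> F" using a by blast
    show "finite ?A \<and> card ?A \<le> card F"
      using inj_on_finite[OF inj sub F(1)] card_inj_on_le[OF inj sub F(1)] by blast
  qed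
qed

text \<open>Two tiles that share a nonempty cell \<open>C\<close> see \<open>corner C\<close> at two
  of finitely many relative positions; the difference of these is the displacement of the
  tiles.\<close>

definition steps :: "'a set" where
  "steps = (\<lambda>(x, y). x - y) ` ((\<Union>n\<in>shape ` Pr. corner ` cells n) \<times> (\<Union>n\<in>shape ` Pr. corner ` cells n))"

lemma finite_steps: "finite steps"
  unfolding steps_def using finite_Pr tile_finite_cells[OF shape_tile[OF Pr_tiles_of]]
  by (intro finite_imageI finite_cartesian_product finite_UN_I) blast+

lemma corner_cell:
  assumes "t \<in> tiles_of Pr" "C \<in> cells t" "C \<noteq> {}"
  shows "corner C - pos t \<in> (\<Union>n\<in>shape ` Pr. corner ` cells n)"
proof -
  have "(+) (- pos t) ` C \<in> cells (shape t)"
    using assms(2) by (auto simp: shape_def translate_tile_def)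
  moreover have "corner ((+) (- pos t) ` C) = corner C - pos t"
    using assms by (subst corner_translate) (simp_all add: tile_compact_cell compact_imp_bounded)
  ultimately show ?thesis using shape_mem[OF assms(1)] by force
qed

lemma steps_adjacent:
  assumes T: "T \<in> tilings Pr" and st: "s \<in> T" "t \<in> T" and meet: "support s \<inter> support t \<noteq> {}"
  shows "pos t - pos s \<in> steps"
proof -
  have tt: "s \<in> tiles_of Pr" "t \<in> tiles_of Pr" using st tilings_tiles[OF T] by auto
  obtain C where C: "C \<in> cells s" "C \<in> cells t" "C \<noteq> {}"
  proof (cases "s = t")
    case True
    with meet show ?thesis using that unfolding support_def by blast
  next
    case False
    obtain \<C> where "\<C> \<subseteq> cells s \<inter> cells t" "support s \<inter> support t = \<Union>\<C>"
      using tilings_meet[OF T st False] unfolding meet_face_to_face_def by (elim conjE exE) (rule that; assumption)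
    then show ?thesis using that meet by blast
  qed
  have "pos t - pos s = (corner C - pos s) - (corner C - pos t)" by simp
  then show ?thesis
    unfolding steps_def using corner_cell[OF tt(1) C(1,3)] corner_cell[OF tt(2) C(2,3)] by force
qed

text \<open>The tiles along a segment from one tile to the other contain a chain of touching tiles.
  Packing bounds their number, hence the length of a shortest chain, and each link of the chain is
  in \<open>steps\<close>.\<close>

lemma ex_chain_bound:
  "\<exists>M. \<forall>T\<in>tilings Pr. \<forall>s\<in>T. \<forall>t\<in>T. norm (pos t - pos s) \<le> R \<longrightarrow> (\<exists>n\<le>M. pos t - pos s \<in> sums_of steps n)"
proof -
  obtain M where M: "\<And>T x. T \<in> tilings Pr \<Longrightarrow> finite {t \<in> T. norm (pos t - x) \<le> R + 3 * radius} \<and>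
      card {t \<in> T. norm (pos t - x) \<le> R + 3 * radius} \<le> M"
    using packing[of "R + 3 * radius"] by blast
  show ?thesis
  proof (rule exI[of _ "M * M"], intro ballI impI)
    fix T s t assume T: "T \<in> tilings Pr" and st: "s \<in> T" "t \<in> T" and R: "norm (pos t - pos s) \<le> R"
    have tiles: "\<And>u. u \<in> T \<Longrightarrow> u \<in> tiles_of Pr" using tilings_tiles[OF T] by blast
    obtain a b where ab: "a \<in> support s" "b \<in> support t"
      using tile_nonempty[OF tiles[OF st(1)]] tile_nonempty[OF tiles[OF st(2)]] that by (meson ex_in_conv)
    let ?L = "closed_segment a b"
    \<comment> \<open>The segment stays within \<open>R + 2 * radius\<close> of
      \<open>pos s\<close>, and a tile has its position within \<open>radius\<close> of each of its
      points; together this is the \<open>3 * radius\<close> of the packing bound.\<close>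
    define K where "K = {u \<in> T. support u \<inter> ?L \<noteq> {}}"
    define E where "E = {(u, v). u \<in> K \<and> v \<in> K \<and> support u \<inter> support v \<noteq> {}}"
    have "a \<in> cball (pos s) (R + 2 * radius)" "b \<in> cball (pos s) (R + 2 * radius)"
    proof -
      have R0: "0 \<le> R" using R norm_ge_zero order_trans by blast
      have as: "norm (a - pos s) \<le> radius" and bt: "norm (b - pos t) \<le> radius"
        using radius(2)[OF tiles[OF st(1)] ab(1)] radius(2)[OF tiles[OF st(2)] ab(2)] by auto
      show "a \<in> cball (pos s) (R + 2 * radius)"
        using as R0 radius(1) by (simp add: dist_norm norm_minus_commute)
      show "b \<in> cball (pos s) (R + 2 * radius)"
        using bt R radius(1) norm_triangle_ineq[of "b - pos t" "pos t - pos s"] by (simp add: dist_norm norm_minus_commute)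
    qed
    then have L: "?L \<subseteq> cball (pos s) (R + 2 * radius)"
      by (simp add: closed_segment_subset)
    have Ksub: "K \<subseteq> {t \<in> T. norm (pos t - pos s) \<le> R + 3 * radius}"
    proof
      fix u assume "u \<in> K"
      then obtain y where y: "u \<in> T" "y \<in> support u" "y \<in> ?L" unfolding K_def by blast
      have "norm (y - pos u) \<le> radius" by (rule radius(2)[OF tiles[OF y(1)] y(2)])
      moreover have "norm (y - pos s) \<le> R + 2 * radius"
        using subsetD[OF L y(3)] by (simp add: dist_norm norm_minus_commute)
      ultimately have "norm (pos u - pos s) \<le> R + 3 * radius"
        using norm_triangle_ineq4[of "y - pos s" "y - pos u"] by simp
      then show "u \<in> {t \<in> T. norm (pos t - pos s) \<le> R + 3 * radius}" using y(1) by simp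
    qed
    have finK: "finite K" and cardK: "card K \<le> M"
      using M[OF T, of "pos s"] Ksub by (auto intro: finite_subset order_trans[OF card_mono])
    have E: "E \<subseteq> K \<times> K" by (auto simp: E_def)
    then have finE: "finite E" using finK by (meson finite_SigmaI finite_subset)
    have cardE: "card E \<le> M * M"
      using card_mono[OF _ E] finK cardK mult_le_mono[OF cardK cardK] by (simp add: card_cartesian_product)
    have sK: "s \<in> K" and tK: "t \<in> K" using st ab by (auto simp: K_def)
    \<comment> \<open>Otherwise the tiles that can be reached from \<open>s\<close> and those that
      cannot would split the segment into two nonempty disjoint closed parts.\<close>
    have reach: "(s, t) \<in> E\<^sup>*"
    proof (rule ccontr)
      assume nt: "(s, t) \<notin> E\<^sup>*"
      let ?A = "\<Union>u\<in>{u \<in> K. (s, u) \<in> E\<^sup>*}. support u" and ?B = "\<Union>u\<in>{u \<in> K. (s, u) \<notin> E\<^sup>*}. support u"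
      have closed: "closed ?A" "closed ?B"
      proof -
        have "closed (support u)" if "u \<in> K" for u
          using that tiles by (intro tile_closed) (simp add: K_def)
        then show "closed ?A" "closed ?B"
          using finK by (intro closed_UN ballI; simp)+
      qed
      have "?L \<subseteq> ?A \<union> ?B"
      proof
        fix x assume x: "x \<in> ?L"
        obtain u where "u \<in> T" "x \<in> support u" using tilings_cover[OF T] by blast
        then have "u \<in> K" "x \<in> support u" using x by (auto simp: K_def)
        then show "x \<in> ?A \<union> ?B" by blast
      qed
      moreover have "?A \<inter> ?B \<inter> ?L = {}"
      proof -
        have "False" if "x \<in> support u" "x \<in> support v" "u \<in> K" "v \<in> K" "(s, u) \<in> E\<^sup>*" "(s, v) \<notin> E\<^sup>*" for x u v
        proof -
          have "(u, v) \<in> E" using that unfolding E_def by blast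
          then show False using that rtrancl.rtrancl_into_rtrancl by metis
        qed
        then show ?thesis by blast
      qed
      moreover have "a \<in> ?A \<inter> ?L" using ab(1) sK by (intro IntI ends_in_segment UN_I[of s]) blast+
      then have "?A \<inter> ?L \<noteq> {}" by (rule contrapos_pn) (rule equals0D)
      moreover have "b \<in> ?B \<inter> ?L" using ab(2) tK nt by (intro IntI ends_in_segment UN_I[of t]) blast+
      then have "?B \<inter> ?L \<noteq> {}" by (rule contrapos_pn) (rule equals0D)
      moreover have "connected ?L" by simp
      ultimately show False using closed unfolding connected_closed by meson
    qed
    then obtain n where n: "n \<le> card E" "(s, t) \<in> E ^^ n"
      using rtrancl_finite_eq_relpow[OF finE] by auto
    have "pos t - pos s \<in> sums_of steps n"
    proof (rule relpow_difference_sums_of[where c = pos])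
      show "pos v - pos u \<in> steps" if "(u, v) \<in> E" for u v
        using that by (intro steps_adjacent[OF T]) (simp_all add: E_def K_def)
    qed (rule n(2))
    then show "\<exists>n\<le>M * M. pos t - pos s \<in> sums_of steps n"
      using n(1) cardE by (meson order_trans)
  qed
qed

lemma finite_local_complexity:
  "\<exists>D. finite D \<and> (\<forall>T\<in>tilings Pr. \<forall>s\<in>T. \<forall>t\<in>T. norm (pos t - pos s) \<le> R \<longrightarrow> pos t - pos s \<in> D)"
proof -
  obtain M where "\<forall>T\<in>tilings Pr. \<forall>s\<in>T. \<forall>t\<in>T. norm (pos t - pos s) \<le> R \<longrightarrow> (\<exists>n\<le>M. pos t - pos s \<in> sums_of steps n)"
    using ex_chain_bound by blast
  then show ?thesis
    by (intro exI[of _ "\<Union>n\<le>M. sums_of steps n"] conjI) (simp add: finite_steps finite_sums_of, blast)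
qed

section \<open>Finiteness of patches\<close>

lemma finite_tiles_meeting: "T \<in> tilings Pr \<Longrightarrow> finite (tiles_meeting T (cball x R))"
proof -
  assume T: "T \<in> tilings Pr"
  obtain M where M: "finite {t \<in> T. norm (pos t - x) \<le> R + radius}"
    using packing[of "R + radius"] T by blast
  have "tiles_meeting T (cball x R) \<subseteq> {t \<in> T. norm (pos t - x) \<le> R + radius}"
  proof
    fix t assume "t \<in> tiles_meeting T (cball x R)"
    then obtain y where y: "t \<in> T" "y \<in> support t" "norm (y - x) \<le> R"
      unfolding tiles_meeting_def by (auto simp: dist_norm norm_minus_commute)
    then show "t \<in> {t \<in> T. norm (pos t - x) \<le> R + radius}"
      using radius(2)[OF tilings_tiles[OF T y(1)] y(2)] norm_triangle_ineq4[of "y - x" "y - pos t"] by simp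
  qed
  then show ?thesis using M finite_subset by blast
qed

text \<open>Seen from \<open>t\<close>, each tile of the patch is one of finitely many shapes
  displaced by one of finitely many vectors, so a patch is a subset of a fixed finite set. The bound
  \<open>R'\<close> ties the centre of the patch to the base tile.\<close>

lemma finite_patches:
  "finite {translate (- pos t) (tiles_meeting T (cball x R)) | T t x.
     T \<in> tilings Pr \<and> t \<in> T \<and> norm (x - pos t) \<le> R'}" (is "finite ?F")
proof -
  obtain D where D: "finite D" "\<And>T s t. T \<in> tilings Pr \<Longrightarrow> s \<in> T \<Longrightarrow> t \<in> T \<Longrightarrow>
      norm (pos t - pos s) \<le> R + R' + radius \<Longrightarrow> pos t - pos s \<in> D"
    using finite_local_complexity[of "R + R' + radius"] by blast
  let ?N = "(\<lambda>(d, n). translate_tile d n) ` (D \<times> shape ` Pr)"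
  have "?F \<subseteq> Pow ?N"
  proof (clarify)
    fix T t x s1 s2
    assume T: "T \<in> tilings Pr" "t \<in> T" "norm (x - pos t) \<le> R'"
      and "(s1, s2) \<in> translate (- pos t) (tiles_meeting T (cball x R))"
    then obtain s where s: "s \<in> tiles_meeting T (cball x R)" "(s1, s2) = translate_tile (- pos t) s"
      unfolding translate_def by blast
    then obtain y where y: "s \<in> T" "y \<in> support s" "norm (y - x) \<le> R"
      unfolding tiles_meeting_def by (auto simp: dist_norm norm_minus_commute)
    have st: "s \<in> tiles_of Pr" by (rule tilings_tiles[OF T(1) y(1)])
    have "norm (y - pos s) \<le> radius" by (rule radius(2)[OF st y(2)])
    then have "norm (pos s - pos t) \<le> R + R' + radius"
      using y(3) T(3) norm_triangle_ineq[of "y - x" "x - pos t"] norm_triangle_ineq4[of "y - pos t" "y - pos s"]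
      by simp
    then have "pos s - pos t \<in> D" using D(2) T y(1) by blast
    moreover have "(s1, s2) = translate_tile (pos s - pos t) (shape s)"
      by (simp add: s(2) shape_def translate_tile_add)
    ultimately show "(s1, s2) \<in> ?N"
      using shape_mem[OF st] by (intro image_eqI[of _ _ "(pos s - pos t, shape s)"]) auto
  qed
  moreover have "finite ?N" using D(1) finite_Pr by auto
  ultimately show ?thesis using finite_subset by blast
qed

end

section \<open>Local matching rules\<close>

text \<open>Finite type without a list of patches: a tiling belongs to \<open>P\<close> once it
  looks like some member of \<open>P\<close> around every point. This form only uses
  \<open>agree\<close> and so can be carried through local maps.\<close>

definition locally_determined :: "('a::euclidean_space, 'm) tile set \<Rightarrow> ('a, 'm) tile set set \<Rightarrow> bool" where
  "locally_determined Pr P \<longleftrightarrow>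
    (\<exists>\<rho>>0. \<forall>T\<in>tilings Pr. (\<forall>x. \<exists>p\<in>P. agree \<rho> (translate (- x) T) p) \<longrightarrow> T \<in> P)"

lemma locally_determined_of_matching_rules:
  assumes P: "P \<subseteq> tilings Pr" and "local_matching_rules Pr P"
  shows "locally_determined Pr P"
proof -
  obtain \<rho> \<F> where \<rho>: "\<rho> > 0" and rule: "\<forall>T\<in>tilings Pr.
      T \<in> P \<longleftrightarrow> (\<forall>x. \<exists>p\<in>\<F>. \<exists>v. tiles_meeting T (cball x \<rho>) = translate v p)"
    using assms(2) unfolding local_matching_rules_def by (elim exE conjE) (rule that)
  have "T \<in> P" if T: "T \<in> tilings Pr" and *: "\<forall>x. \<exists>p\<in>P. agree \<rho> (translate (- x) T) p" for T
  proof -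
    have "\<exists>q\<in>\<F>. \<exists>v. tiles_meeting T (cball x \<rho>) = translate v q" for x
    proof -
      obtain p where p: "p \<in> P" "agree \<rho> (translate (- x) T) p" using * by blast
      then obtain q v where q: "q \<in> \<F>" "tiles_meeting p (cball 0 \<rho>) = translate v q"
        using rule P by blast
      then have "translate (- x) (tiles_meeting T (cball x \<rho>)) = translate v q"
        using p(2) by (simp add: agree_def tiles_meeting_translate)
      then have "tiles_meeting T (cball x \<rho>) = translate (x + v) q"
        by (metis translate_add translate_inverse(2))
      then show ?thesis using q(1) by blast
    qed
    then show ?thesis using rule T by blast
  qed
  then show ?thesis unfolding locally_determined_def using \<rho> by blast
qed

context protoset begin

text \<open>A patch equal to a patch of another tiling covers a ball, so it contains every tile of that
  tiling near the centre of the ball: the interior of a missing tile would be covered by finitely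
  many tiles with disjoint interiors.\<close>

lemma same_patch_agree:
  assumes T: "T \<in> tilings Pr" and T': "T' \<in> tilings Pr"
    and eq: "tiles_meeting T (cball x (\<rho> + 2 * radius)) = tiles_meeting T' (cball y (\<rho> + 2 * radius))"
  shows "tiles_meeting T (cball x \<rho>) = tiles_meeting T' (cball x \<rho>)"
proof
  let ?F = "tiles_meeting T (cball x (\<rho> + 2 * radius))"
  have sub: "?F \<subseteq> T" "?F \<subseteq> T'"
    by (simp add: tiles_meeting_def) (unfold eq, simp add: tiles_meeting_def)
  show "tiles_meeting T (cball x \<rho>) \<subseteq> tiles_meeting T' (cball x \<rho>)"
  proof
    fix t assume t: "t \<in> tiles_meeting T (cball x \<rho>)"
    have "t \<in> ?F" using t radius(1) unfolding tiles_meeting_def by fastforce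
    then show "t \<in> tiles_meeting T' (cball x \<rho>)" using t sub by (auto simp: tiles_meeting_def)
  qed
  show "tiles_meeting T' (cball x \<rho>) \<subseteq> tiles_meeting T (cball x \<rho>)"
  proof
    fix u assume u: "u \<in> tiles_meeting T' (cball x \<rho>)"
    then obtain z where z: "u \<in> T'" "z \<in> support u" "norm (z - x) \<le> \<rho>"
      unfolding tiles_meeting_def by (auto simp: dist_norm norm_minus_commute)
    have ut: "u \<in> tiles_of Pr" by (rule tilings_tiles[OF T' z(1)])
    have "interior (support u) \<subseteq> \<Union>(support ` ?F)"
    proof
      fix w assume "w \<in> interior (support u)"
      then have w: "w \<in> support u" using interior_subset by blast
      obtain t where t: "t \<in> T" "w \<in> support t" using tilings_cover[OF T] by blast
      have "norm (w - x) \<le> \<rho> + 2 * radius"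
        using tile_diameter[OF ut w z(2)] z(3) norm_triangle_ineq[of "w - z" "z - x"] by simp
      then have "t \<in> ?F" using t by (auto simp: tiles_meeting_def dist_norm norm_minus_commute)
      then show "w \<in> \<Union>(support ` ?F)" using t(2) by blast
    qed
    then have "\<exists>A\<in>support ` ?F. interior (support u) \<inter> interior A \<noteq> {}"
      using sub tilings_tiles[OF T] tile_interior[OF ut] finite_tiles_meeting[OF T]
      by (intro open_subset_finite_Union_closed) (blast intro: tile_closed finite_imageI open_interior)+
    then obtain t where t: "t \<in> ?F" "interior (support u) \<inter> interior (support t) \<noteq> {}" by blast
    then have "t = u" using tilings_interiors[OF T' z(1), of t] sub by blast
    then have "u \<in> T" using t(1) sub by blast
    then show "u \<in> tiles_meeting T (cball x \<rho>)" using u by (auto simp: tiles_meeting_def)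
  qed
qed

text \<open>Finite local complexity supplies the finite list. A patch known up to translation has
  lost its centre, so the rule is formulated for the larger radius
  \<open>\<rho> + 2 * radius\<close>, from which \<open>same_patch_agree\<close> restores agreement
  about one and the same centre.\<close>

lemma matching_rules_of_locally_determined:
  assumes P: "P \<subseteq> tilings Pr" and transl: "\<And>T v. T \<in> P \<Longrightarrow> translate v T \<in> P"
    and "locally_determined Pr P"
  shows "local_matching_rules Pr P"
proof -
  obtain \<rho> where \<rho>: "\<rho> > 0" and det: "\<And>T. T \<in> tilings Pr \<Longrightarrow> (\<And>x. \<exists>p\<in>P. agree \<rho> (translate (- x) T) p) \<Longrightarrow> T \<in> P"
    using assms(3) unfolding locally_determined_def by blast
  define \<rho>' where "\<rho>' = \<rho> + 2 * radius"
  \<comment> \<open>Each patch is translated to a tile near its centre, which exists since every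
    \<open>x\<close> lies in some tile; this normalization makes the list finite.\<close>
  define \<F> where "\<F> = {translate (- pos t) (tiles_meeting T (cball x \<rho>')) | T t x.
     T \<in> P \<and> t \<in> T \<and> norm (x - pos t) \<le> radius}"
  have "finite \<F>"
    using finite_patches[of \<rho>' radius] by (rule rev_finite_subset) (use P in \<open>unfold \<F>_def, blast\<close>)
  moreover have "finite p \<and> face_to_face_tiles Pr p" if "p \<in> \<F>" for p
  proof -
    obtain T t x where p: "p = translate (- pos t) (tiles_meeting T (cball x \<rho>'))" "T \<in> P" "t \<in> T"
      using \<open>p \<in> \<F>\<close> unfolding \<F>_def mem_Collect_eq by metis
    have T: "T \<in> tilings Pr" using p(2) P by blast
    have T': "translate (- pos t) T \<in> tilings Pr" by (rule tilings_translate[OF T])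
    have "finite p" unfolding p(1) translate_def using finite_tiles_meeting[OF T] by blast
    moreover have "p \<subseteq> translate (- pos t) T"
      unfolding p(1) translate_def tiles_meeting_def by (intro image_mono) simp
    then have "face_to_face_tiles Pr p"
      using tilings_tiles[OF T'] tilings_interiors[OF T'] tilings_meet[OF T'] unfolding face_to_face_tiles_def
      by (intro conjI ballI impI subsetI) blast+
    ultimately show ?thesis ..
  qed
  moreover have "T \<in> P \<longleftrightarrow> (\<forall>x. \<exists>p\<in>\<F>. \<exists>v. tiles_meeting T (cball x \<rho>') = translate v p)"
    if T: "T \<in> tilings Pr" for T
  proof
    assume TP: "T \<in> P"
    show "\<forall>x. \<exists>p\<in>\<F>. \<exists>v. tiles_meeting T (cball x \<rho>') = translate v p"
    proof
      fix x
      obtain t where t: "t \<in> T" "x \<in> support t" using tilings_cover[OF T] by blast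
      have "norm (x - pos t) \<le> radius" by (rule radius(2)[OF tilings_tiles[OF T t(1)] t(2)])
      then have "translate (- pos t) (tiles_meeting T (cball x \<rho>')) \<in> \<F>"
        unfolding \<F>_def using TP t(1) by blast
      then show "\<exists>p\<in>\<F>. \<exists>v. tiles_meeting T (cball x \<rho>') = translate v p"
        by (metis translate_inverse(2))
    qed
  next
    assume *: "\<forall>x. \<exists>p\<in>\<F>. \<exists>v. tiles_meeting T (cball x \<rho>') = translate v p"
    show "T \<in> P"
    proof (rule det[OF T])
      fix x
      obtain p v where p: "p \<in> \<F>" "tiles_meeting T (cball x \<rho>') = translate v p" using * by blast
      obtain T1 t y where T1: "p = translate (- pos t) (tiles_meeting T1 (cball y \<rho>'))" "T1 \<in> P" "t \<in> T1"
        using p(1) unfolding \<F>_def mem_Collect_eq by metis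
      define w where "w = v - pos t"
      have "tiles_meeting T (cball x \<rho>') = translate w (tiles_meeting T1 (cball (w + y - w) \<rho>'))"
        by (simp add: p(2) T1(1) w_def translate_add)
      also have "\<dots> = tiles_meeting (translate w T1) (cball (w + y) \<rho>')"
        by (simp only: tiles_meeting_translate)
      finally have "tiles_meeting T (cball x \<rho>) = tiles_meeting (translate w T1) (cball x \<rho>)"
        unfolding \<rho>'_def by (rule same_patch_agree[OF T tilings_translate, rotated]) (use T1 P in auto)
      then have "agree \<rho> (translate (- x) T) (translate (- x) (translate w T1))"
        by (simp add: agree_translate_iff)
      then show "\<exists>p\<in>P. agree \<rho> (translate (- x) T) p" using transl T1(2) by blast
    qed
  qed
  moreover have "\<rho>' > 0" using \<rho> radius(1) by (simp add: \<rho>'_def)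
  ultimately show ?thesis
    unfolding local_matching_rules_def by (intro exI[of _ \<rho>'] conjI exI[of _ \<F>] ballI) auto
qed

lemma local_matching_rules_iff:
  assumes "P \<subseteq> tilings Pr" "\<And>T v. T \<in> P \<Longrightarrow> translate v T \<in> P"
  shows "local_matching_rules Pr P \<longleftrightarrow> locally_determined Pr P"
  using locally_determined_of_matching_rules matching_rules_of_locally_determined assms by metis

end

section \<open>Perturbations of a scaling\<close>

text \<open>The Lipschitz constant of \<open>h\<close> minus the scaling by \<open>s\<close> is at
  most \<open>c\<close>. Only differences enter, so additive constants in \<open>h\<close> do not
  matter.\<close>

definition near_scaling :: "real \<Rightarrow> real \<Rightarrow> ('a::euclidean_space \<Rightarrow> 'a) \<Rightarrow> bool" where
  "near_scaling c s h \<longleftrightarrow> (\<forall>x y. norm (h x - h y - s *\<^sub>R (x - y)) \<le> c * norm (x - y))"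

lemma near_scaling_upper:
  assumes "near_scaling c s h" "0 \<le> s"
  shows "norm (h x - h y) \<le> (s + c) * norm (x - y)"
proof -
  have "norm (h x - h y - s *\<^sub>R (x - y)) \<le> c * norm (x - y)"
    using assms(1) by (simp add: near_scaling_def)
  moreover have "norm (s *\<^sub>R (x - y)) = s * norm (x - y)" using assms(2) by simp
  ultimately show ?thesis
    using norm_triangle_ineq[of "h x - h y - s *\<^sub>R (x - y)" "s *\<^sub>R (x - y)"] by (simp add: algebra_simps)
qed

lemma near_scaling_lower:
  assumes "near_scaling c s h" "0 \<le> s"
  shows "(s - c) * norm (x - y) \<le> norm (h x - h y)"
proof -
  have "norm (h x - h y - s *\<^sub>R (x - y)) \<le> c * norm (x - y)"
    using assms(1) by (simp add: near_scaling_def)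
  moreover have "norm (s *\<^sub>R (x - y)) = s * norm (x - y)" using assms(2) by simp
  ultimately show ?thesis
    using norm_triangle_ineq4[of "h x - h y" "h x - h y - s *\<^sub>R (x - y)"] by (simp add: algebra_simps)
qed

text \<open>A solution of \<open>h x = w\<close> is a fixed point of the map that adds
  \<open>(w - h x) / s\<close> to \<open>x\<close>, a contraction with factor
  \<open>c / s\<close>.\<close>

lemma near_scaling_bij:
  assumes h: "near_scaling c s h" and c: "0 \<le> c" "c < s"
  shows "bij h"
proof (rule bijI)
  show "inj h"
  proof (rule injI)
    fix x y assume "h x = h y"
    then have "(s - c) * norm (x - y) \<le> 0" using near_scaling_lower[OF h, of x y] c by simp
    then have "norm (x - y) \<le> 0" using c by (simp add: mult_le_0_iff)
    then show "x = y" by simp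
  qed
  have s: "s > 0" using c by simp
  show "surj h"
    unfolding surj_def
  proof
    fix w
    define k where "k x = x + (1/s) *\<^sub>R (w - h x)" for x
    have lip: "dist (k x) (k y) \<le> c / s * dist x y" for x y
    proof -
      have "k x - k y = - ((1/s) *\<^sub>R (h x - h y - s *\<^sub>R (x - y)))"
        using s by (simp add: k_def algebra_simps)
      then have "norm (k x - k y) = norm (h x - h y - s *\<^sub>R (x - y)) / s"
        using s by simp
      also have "\<dots> \<le> c * norm (x - y) / s"
        using h s by (intro divide_right_mono) (auto simp: near_scaling_def)
      finally show ?thesis by (simp add: dist_norm)
    qed
    have "\<exists>!x. k x = x"
      by (rule banach_fix_type[of "c / s"]) (use c s lip in auto)
    then obtain x where "k x = x" by blast
    then have "w = h x" using s by (simp add: k_def)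
    then show "\<exists>x. w = h x" ..
  qed
qed

text \<open>Division by \<open>s\<close> turns the deviation of \<open>h\<close> into at most
  \<open>norm (x - y) / 3\<close>, and \<open>norm (x - y)\<close> is at most
  \<open>3/(2 * s)\<close> times the distance of the images.\<close>

lemma near_scaling_inv:
  assumes h: "near_scaling (s/3) s h" and s: "s > 0"
  shows "near_scaling (1/(2 * s)) (1/s) (inv h)"
  unfolding near_scaling_def
proof (intro allI)
  fix u w
  have bij: "bij h" using near_scaling_bij[OF h] s by simp
  define x y where "x = inv h u" and "y = inv h w"
  have xy: "h x = u" "h y = w"
    using bij by (simp_all add: x_def y_def bij_is_surj surj_f_inv_f)
  have "inv h u - inv h w - (1/s) *\<^sub>R (u - w) = - ((1/s) *\<^sub>R (h x - h y - s *\<^sub>R (x - y)))"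
    unfolding x_def[symmetric] y_def[symmetric] using s by (simp add: xy algebra_simps)
  then have "norm (inv h u - inv h w - (1/s) *\<^sub>R (u - w)) = norm (h x - h y - s *\<^sub>R (x - y)) / s"
    using s by simp
  also have "\<dots> \<le> (s/3 * norm (x - y)) / s"
    using h s by (intro divide_right_mono) (auto simp: near_scaling_def)
  also have "\<dots> = norm (x - y) / 3" using s by simp
  also have "\<dots> \<le> 1/(2 * s) * norm (u - w)"
    using near_scaling_lower[OF h, of x y] s by (simp add: xy field_simps)
  finally show "norm (inv h u - inv h w - (1/s) *\<^sub>R (u - w)) \<le> 1/(2 * s) * norm (u - w)" .
qed

text \<open>The segment is cut into equal pieces of length at most \<open>r\<close>. The additivity
  of norms given to the step lets Lipschitz bounds add up along the segment without loss.\<close>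

lemma segment_induction:
  fixes x y :: "'a::real_normed_vector"
  assumes r: "r > 0"
    and refl: "Q x x"
    and step: "\<And>a b. a \<in> closed_segment x y \<Longrightarrow> b \<in> closed_segment x y \<Longrightarrow> norm (b - a) \<le> r \<Longrightarrow>
      norm (a - x) + norm (b - a) = norm (b - x) \<Longrightarrow> Q x a \<Longrightarrow> Q x b"
  shows "Q x y"
proof -
  obtain n :: nat where n: "norm (y - x) / r < real n" using reals_Archimedean2 by blast
  have n0: "real n > 0" using n r by (meson divide_nonneg_pos norm_ge_zero order_le_less_trans)
  define p where "p k = x + (real k / real n) *\<^sub>R (y - x)" for k
  have seg: "p k \<in> closed_segment x y" if "k \<le> n" for k
    unfolding closed_segment_def p_def using that n0
    by (intro CollectI exI[of _ "real k / real n"]) (auto simp: algebra_simps)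
  have "Q x (p k)" if "k \<le> n" for k
    using that
  proof (induction k)
    case (Suc k)
    have d: "p (Suc k) - p k = (1 / real n) *\<^sub>R (y - x)"
      by (simp add: p_def algebra_simps add_divide_distrib)
    have nd: "norm (p (Suc k) - p k) = norm (y - x) / n"
      using n0 by (simp add: d)
    have "norm (y - x) / n \<le> r"
      using n n0 r by (simp add: field_simps)
    moreover have "norm (p j - x) = real j / real n * norm (y - x)" for j
      using n0 by (simp add: p_def)
    then have "norm (p k - x) + norm (p (Suc k) - p k) = norm (p (Suc k) - x)"
      using n0 by (simp add: nd add_divide_distrib algebra_simps)
    ultimately show ?case
      using step[OF seg[of k] seg[of "Suc k"]] Suc by (simp add: nd)
  qed (simp add: p_def refl)
  from this[of n] show ?thesis using n0 by (simp add: p_def)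
qed

lemma lipschitz_from_local:
  fixes g :: "'a::real_normed_vector \<Rightarrow> 'b::real_normed_vector"
  assumes r: "r > 0" and loc: "\<And>x y. norm (x - y) \<le> r \<Longrightarrow> norm (g x - g y) \<le> c * norm (x - y)"
  shows "norm (g x - g y) \<le> c * norm (x - y)"
proof (rule segment_induction[of r "\<lambda>x y. norm (g x - g y) \<le> c * norm (x - y)", OF r])
  fix a b assume *: "norm (b - a) \<le> r" "norm (a - x) + norm (b - a) = norm (b - x)"
    "norm (g x - g a) \<le> c * norm (x - a)"
  have "norm (g x - g b) \<le> norm (g x - g a) + norm (g a - g b)"
    using norm_triangle_ineq[of "g x - g a" "g a - g b"] by simp
  also have "\<dots> \<le> c * norm (x - a) + c * norm (a - b)"
    using *(3) loc[of a b] *(1) by (simp add: norm_minus_commute)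
  also have "\<dots> = c * norm (x - b)"
    using *(2) by (simp add: norm_minus_commute distrib_left[symmetric])
  finally show "norm (g x - g b) \<le> c * norm (x - b)" .
qed simp

lemma locally_constant_on_cball:
  fixes h :: "'a::real_normed_vector \<Rightarrow> 'b"
  assumes r: "r > 0" and loc: "\<And>x y. norm x \<le> R \<Longrightarrow> norm y \<le> R \<Longrightarrow> norm (x - y) \<le> r \<Longrightarrow> h x = h y"
    and x: "norm x \<le> R"
  shows "h x = h 0"
proof -
  have "h 0 = h x"
  proof (rule segment_induction[of r "\<lambda>x y. h x = h y", OF r])
    fix a b assume *: "a \<in> closed_segment 0 x" "b \<in> closed_segment 0 x" "norm (b - a) \<le> r" "h 0 = h a"
    have "norm z \<le> R" if "z \<in> closed_segment 0 x" for z
      using segment_bound1[OF that] x by simp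
    then show "h 0 = h b" using loc[of a b] * by (simp add: norm_minus_commute)
  qed simp
  then show ?thesis ..
qed

section \<open>Integration of local cocycles\<close>

text \<open>Extends a function of pairs at distance at most \<open>r\<close> to pairs at distance at
  most \<open>2 ^ n * r\<close>: its values are summed over the \<open>2 ^ n\<close> equal pieces of
  the segment.\<close>

primrec halving :: "('a::real_vector \<Rightarrow> 'a \<Rightarrow> 'b::plus) \<Rightarrow> nat \<Rightarrow> 'a \<Rightarrow> 'a \<Rightarrow> 'b" where
  "halving g 0 = g"
| "halving g (Suc n) = (\<lambda>a b. halving g n a (midpoint a b) + halving g n (midpoint a b) b)"

text \<open>The triangle is cut into four similar triangles by the midpoints of its sides.\<close>

lemma halving_cocycle:
  fixes g :: "'a::real_normed_vector \<Rightarrow> 'a \<Rightarrow> 'b::ab_group_add"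
  assumes g: "\<And>a b c. norm (a - b) \<le> r \<Longrightarrow> norm (b - c) \<le> r \<Longrightarrow> norm (a - c) \<le> r \<Longrightarrow> g a b + g b c = g a c"
  shows "norm (a - b) \<le> 2 ^ n * r \<Longrightarrow> norm (b - c) \<le> 2 ^ n * r \<Longrightarrow> norm (a - c) \<le> 2 ^ n * r \<Longrightarrow>
    halving g n a b + halving g n b c = halving g n a c"
proof (induction n arbitrary: a b c)
  case 0
  then show ?case using g by simp
next
  case (Suc n)
  let ?h = "halving g n" and ?R = "2 ^ n * r"
  define p q m where "p = midpoint a b" and "q = midpoint b c" and "m = midpoint a c"
  have half: "norm ((1/2) *\<^sub>R v) \<le> ?R" if "norm v \<le> 2 ^ Suc n * r" for v :: 'a
    using that by simp
  have v: "a - p = (1/2) *\<^sub>R (a - b)" "p - b = (1/2) *\<^sub>R (a - b)" "b - q = (1/2) *\<^sub>R (b - c)"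
    "q - c = (1/2) *\<^sub>R (b - c)" "a - m = (1/2) *\<^sub>R (a - c)" "m - c = (1/2) *\<^sub>R (a - c)"
    "p - q = (1/2) *\<^sub>R (a - c)" "p - m = (1/2) *\<^sub>R (b - c)" "q - m = (1/2) *\<^sub>R (b - a)"
    "m - q = (1/2) *\<^sub>R (a - b)" "m - p = (1/2) *\<^sub>R (c - b)"
    by (simp_all add: p_def q_def m_def midpoint_def algebra_simps)
      (simp_all add: scaleR_add_left[symmetric] flip: scaleR_add_right scaleR_diff_right)
  have ab: "norm (b - a) \<le> 2 ^ Suc n * r" "norm (c - b) \<le> 2 ^ Suc n * r"
    using Suc.prems by (simp_all add: norm_minus_commute)
  have "(?h a p + ?h p b) + (?h b q + ?h q c) = ?h a p + (?h p b + ?h b q) + ?h q c"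
    by (simp add: add.assoc)
  also have "?h p b + ?h b q = ?h p q"
    by (rule Suc.IH; unfold v; rule half; fact)
  also have "?h p q = ?h p m + ?h m q"
    by (rule Suc.IH[symmetric]; unfold v; rule half; fact)
  also have "?h a p + (?h p m + ?h m q) + ?h q c = (?h a p + ?h p m) + (?h m q + ?h q c)"
    by (simp add: add.assoc)
  also have "?h a p + ?h p m = ?h a m"
    by (rule Suc.IH; unfold v; rule half; fact)
  also have "?h m q + ?h q c = ?h m c"
    by (rule Suc.IH; unfold v; rule half; fact)
  finally show ?case by (simp add: p_def q_def m_def)
qed

text \<open>The extensions by \<open>halving\<close> are cocycles on ever larger scales and coincide
  where several are meaningful. The value at \<open>(0, x)\<close> on any sufficiently large scale
  is then the integral at \<open>x\<close>.\<close>

lemma cocycle_integral: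
  fixes g :: "'a::real_normed_vector \<Rightarrow> 'a \<Rightarrow> 'b::ab_group_add"
  assumes r: "r > 0"
    and g: "\<And>a b c. norm (a - b) \<le> r \<Longrightarrow> norm (b - c) \<le> r \<Longrightarrow> norm (a - c) \<le> r \<Longrightarrow> g a b + g b c = g a c"
  obtains G where "G 0 = 0" "\<And>a b. norm (a - b) \<le> r \<Longrightarrow> g a b = G b - G a"
proof -
  have mono: "2 ^ m * r \<le> 2 ^ n * r" if "m \<le> n" for m n :: nat
    using that r by (intro mult_right_mono power_increasing) auto
  have Suc: "halving g (Suc n) a b = halving g n a b" if "norm (a - b) \<le> 2 ^ n * r" for n a b
  proof -
    have "a - midpoint a b = (1/2) *\<^sub>R (a - b)" "midpoint a b - b = (1/2) *\<^sub>R (a - b)"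
      by (simp_all add: midpoint_def algebra_simps)
         (simp_all add: scaleR_add_left[symmetric] flip: scaleR_add_right scaleR_diff_right)
    moreover have "norm ((1/2) *\<^sub>R (a - b)) = norm (a - b) / 2" by simp
    then have "norm ((1/2) *\<^sub>R (a - b)) \<le> 2 ^ n * r"
      using that norm_ge_zero[of "a - b"] by linarith
    ultimately show ?thesis using halving_cocycle[OF g, where a = a and b = "midpoint a b" and c = b and n = n] that by simp
  qed
  have ext: "halving g n a b = halving g m a b" if "m \<le> n" "norm (a - b) \<le> 2 ^ m * r" for m n a b
    using that(1)
  proof (induction rule: dec_induct)
    case (step n)
    then show ?case using Suc[of a b n] mono[OF step(1)] that(2) by simp
  qed simp
  have "\<exists>n. norm x \<le> 2 ^ n * r" for x :: 'a
  proof -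
    obtain n where "norm x / r < 2 ^ n" using real_arch_pow[of 2 "norm x / r"] by auto
    then show ?thesis using r by (intro exI[of _ n]) (simp add: field_simps)
  qed
  then obtain N where N: "\<And>x :: 'a. norm x \<le> 2 ^ N x * r" by metis
  define G where "G x = halving g (N x) 0 x" for x
  have diff: "g a b = G b - G a" if "norm (a - b) \<le> r" for a b
  proof -
    define n where "n = max (N a) (N b)"
    have n: "norm a \<le> 2 ^ n * r" "norm b \<le> 2 ^ n * r" "norm (a - b) \<le> 2 ^ n * r"
      using N[of a] N[of b] mono[of "N a" n] mono[of "N b" n] mono[of 0 n] that by (simp_all add: n_def)
    have "halving g n 0 a + halving g n a b = halving g n 0 b"
      using n by (intro halving_cocycle[OF g]) simp_all
    moreover have "halving g n 0 a = G a" "halving g n 0 b = G b"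
      unfolding G_def using N by (auto intro!: ext simp: n_def)
    moreover have "halving g n a b = g a b"
      using ext[of 0 n a b] that by simp
    ultimately show ?thesis by (simp add: algebra_simps)
  qed
  show thesis
  proof (rule that[of "\<lambda>x. G x - G 0"])
    show "G 0 - G 0 = 0" by simp
    show "g a b = (G b - G 0) - (G a - G 0)" if "norm (a - b) \<le> r" for a b
      using diff[OF that] by simp
  qed
qed

section \<open>Local equivalences of tiling spaces\<close>

lemma agree_pointwise:
  assumes "\<And>x. norm x \<le> R \<Longrightarrow> agree 0 (translate (- x) T) (translate (- x) T')"
  shows "agree R T T'"
proof -
  have "t \<in> T \<longleftrightarrow> t \<in> T'" if "x \<in> support t" "norm x \<le> R" for t x
  proof -
    have "0 \<in> support (translate_tile (- x) t)"
      using that(1) by (auto simp: support_translate_tile)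
    from agree_mem[OF assms[OF that(2)] this] show ?thesis
      by (simp add: mem_translate translate_tile_add)
  qed
  then show ?thesis
    unfolding agree_def tiles_meeting_def by (auto simp: dist_norm)
qed

text \<open>Agreement only sees points of supports, so a tile with empty support would escape
  it.\<close>

lemma eq_of_agree_0:
  assumes "\<And>x. agree 0 (translate (- x) T) (translate (- x) T')"
    and "\<And>t. t \<in> T \<union> T' \<Longrightarrow> support t \<noteq> {}"
  shows "T = T'"
proof -
  have "t \<in> T \<longleftrightarrow> t \<in> T'" if t: "t \<in> T \<union> T'" for t
  proof -
    obtain x where x: "x \<in> support t" using assms(2)[OF t] by blast
    show ?thesis using agree_mem[OF agree_pointwise[OF assms(1)] x order_refl] .
  qed
  then show ?thesis by blast
qed

text \<open>\<open>f\<close> is a cocycle over the translation action and describes how \<Psi>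
  reparametrizes the orbits. \<open>\<Psi>_recover\<close> is demanded for the single radius
  \<open>\<rho> + 1\<close> only: this suffices to compute the inverse of \<open>f T\<close> over a
  step of length \<open>s/2\<close>, and larger radii follow by moving along.\<close>

locale local_equivalence =
  source: protoset Pr + target: protoset Pr'
  for Pr :: "('a::euclidean_space, 'm) tile set" and Pr' :: "('a, 'k) tile set" +
  fixes f :: "('a, 'm) tile set \<Rightarrow> 'a \<Rightarrow> 'a"
    and \<Psi> :: "('a, 'm) tile set \<Rightarrow> ('a, 'k) tile set"
    and s \<rho> :: real
  assumes s: "s > 0" and \<rho>: "\<rho> \<ge> 0"
    and f_translate: "T \<in> tilings Pr \<Longrightarrow> f (translate (- x) T) y = f T (x + y) - f T x"
    and f_scaling: "T \<in> tilings Pr \<Longrightarrow> near_scaling (s/3) s (f T)"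
    and f_local: "T \<in> tilings Pr \<Longrightarrow> T' \<in> tilings Pr \<Longrightarrow> agree R T T' \<Longrightarrow> norm x + \<rho> \<le> R \<Longrightarrow> f T x = f T' x"
    and \<Psi>_tilings: "T \<in> tilings Pr \<Longrightarrow> \<Psi> T \<in> tilings Pr'"
    and \<Psi>_translate: "T \<in> tilings Pr \<Longrightarrow> \<Psi> (translate (- x) T) = translate (- f T x) (\<Psi> T)"
    and \<Psi>_local: "\<exists>R'. \<forall>T\<in>tilings Pr. \<forall>T'\<in>tilings Pr. agree R' T T' \<longrightarrow> agree R (\<Psi> T) (\<Psi> T')"
    and \<Psi>_recover: "\<exists>K. \<forall>T\<in>tilings Pr. \<forall>T'\<in>tilings Pr. agree K (\<Psi> T) (\<Psi> T') \<longrightarrow> agree (\<rho> + 1) T T'"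
begin

lemma f_0: "T \<in> tilings Pr \<Longrightarrow> f T 0 = 0"
  using f_translate[of T 0 0] by simp

lemma f_bij: "T \<in> tilings Pr \<Longrightarrow> bij (f T)"
  using near_scaling_bij[OF f_scaling] s by simp

definition g :: "('a, 'm) tile set \<Rightarrow> 'a \<Rightarrow> 'a" where
  "g T = inv (f T)"

lemma f_g: "T \<in> tilings Pr \<Longrightarrow> f T (g T w) = w"
  by (simp add: g_def f_bij bij_is_surj surj_f_inv_f)

lemma g_f: "T \<in> tilings Pr \<Longrightarrow> g T (f T x) = x"
  by (simp add: g_def f_bij bij_is_inj)

lemma g_eqI: "T \<in> tilings Pr \<Longrightarrow> f T x = w \<Longrightarrow> g T w = x"
  using g_f by blast

lemma g_0: "T \<in> tilings Pr \<Longrightarrow> g T 0 = 0"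
  by (simp add: g_eqI f_0)

lemma g_scaling: "T \<in> tilings Pr \<Longrightarrow> near_scaling (1/(2 * s)) (1/s) (g T)"
  unfolding g_def by (rule near_scaling_inv[OF f_scaling s])

lemma f_bound: "T \<in> tilings Pr \<Longrightarrow> norm (f T x) \<le> 2 * s * norm x"
proof -
  assume T: "T \<in> tilings Pr"
  have "(s + s/3) * norm x \<le> 2 * s * norm x" using s by (intro mult_right_mono) auto
  moreover have "norm (f T x) \<le> (s + s/3) * norm x"
    using near_scaling_upper[OF f_scaling[OF T] less_imp_le[OF s], of x 0] unfolding f_0[OF T] diff_zero .
  ultimately show ?thesis by (rule order_trans[rotated])
qed

lemma g_bound: "T \<in> tilings Pr \<Longrightarrow> norm (g T w) \<le> 2/s * norm w"
proof -
  assume T: "T \<in> tilings Pr"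
  have "1/s + 1/(2 * s) \<le> 2/s" using s by (simp add: field_simps)
  then have "(1/s + 1/(2 * s)) * norm w \<le> 2/s * norm w" by (rule mult_right_mono) simp
  then show ?thesis
    using near_scaling_upper[OF g_scaling[OF T], of w 0] s g_0[OF T] by simp
qed

lemma g_translate:
  assumes T: "T \<in> tilings Pr"
  shows "g (translate (- g T w) T) u = g T (w + u) - g T w"
  by (rule g_eqI) (simp_all add: tilings_translate T f_translate f_g)

lemma \<Psi>_translate_g:
  "T \<in> tilings Pr \<Longrightarrow> \<Psi> (translate (- g T w) T) = translate (- w) (\<Psi> T)"
  by (simp add: \<Psi>_translate f_g)

lemma g_local:
  assumes "T \<in> tilings Pr" "T' \<in> tilings Pr" "agree R T T'" "2/s * norm u + \<rho> \<le> R"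
  shows "g T u = g T' u"
proof (rule g_eqI[symmetric, OF assms(2)])
  have "f T (g T u) = f T' (g T u)"
    by (rule f_local[OF assms(1-3)]) (use g_bound[OF assms(1), of u] assms(4) in simp)
  then show "f T' (g T u) = u" by (simp add: f_g assms(1))
qed

text \<open>Around every \<open>w\<close> the images determine the two tilings near
  \<open>g T w\<close> and \<open>g T' w\<close>. Hence \<open>g T\<close> and \<open>g T'\<close>
  have equal increments over short steps, their difference is constant on the ball, and it vanishes
  at 0.\<close>

lemma \<Psi>_recover_all:
  "\<exists>K. \<forall>T\<in>tilings Pr. \<forall>T'\<in>tilings Pr. agree K (\<Psi> T) (\<Psi> T') \<longrightarrow> agree R T T'"
proof -
  obtain K0 where K0: "\<And>T T'. T \<in> tilings Pr \<Longrightarrow> T' \<in> tilings Pr \<Longrightarrow> agree K0 (\<Psi> T) (\<Psi> T') \<Longrightarrow> agree (\<rho> + 1) T T'"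
    using \<Psi>_recover by meson
  \<comment> \<open>\<open>f T\<close> maps the ball of radius \<open>R\<close> into the ball of
    radius \<open>W\<close>.\<close>
  define W where "W = 2 * s * R"
  have "agree R T T'" if T: "T \<in> tilings Pr" "T' \<in> tilings Pr" and ag: "agree (W + K0) (\<Psi> T) (\<Psi> T')" for T T'
  proof -
    have near: "agree (\<rho> + 1) (translate (- g T w) T) (translate (- g T' w) T')" if w: "norm w \<le> W" for w :: 'a
    proof (rule K0)
      show "agree K0 (\<Psi> (translate (- g T w) T)) (\<Psi> (translate (- g T' w) T'))"
        unfolding \<Psi>_translate_g[OF T(1)] \<Psi>_translate_g[OF T(2)]
        by (rule agree_translate[OF ag]) (use w in simp)
    qed (intro tilings_translate T)+
    have const: "g T w - g T' w = g T 0 - g T' 0" if "norm w \<le> W" for w :: 'a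
    proof (rule locally_constant_on_cball[where h = "\<lambda>w. g T w - g T' w", OF _ _ that])
      show "s / 2 > 0" using s by simp
      fix w u :: 'a assume w: "norm w \<le> W" "norm u \<le> W" "norm (w - u) \<le> s / 2"
      have "2/s * norm (u - w) + \<rho> \<le> \<rho> + 1"
        using w(3) s by (simp add: norm_minus_commute field_simps)
      then have "g (translate (- g T w) T) (u - w) = g (translate (- g T' w) T') (u - w)"
        by (intro g_local[OF _ _ near[OF w(1)]] tilings_translate T)
      then show "g T w - g T' w = g T u - g T' u"
        by (simp add: g_translate T algebra_simps)
    qed
    show ?thesis
    proof (rule agree_pointwise)
      fix x :: 'a assume x: "norm x \<le> R"
      have w: "norm (f T x) \<le> W"
        unfolding W_def using f_bound[OF T(1), of x] mult_left_mono[OF x, of "2 * s"] s by linarith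
      have "g T (f T x) = x" "g T' (f T x) = x"
        using const[OF w] by (simp_all add: g_f g_0 T)
      then show "agree 0 (translate (- x) T) (translate (- x) T')"
        using near[OF w] \<rho> by (auto elim!: agree_mono)
    qed
  qed
  then show ?thesis by meson
qed

lemma \<Psi>_inj:
  assumes T: "T \<in> tilings Pr" "T' \<in> tilings Pr" and eq: "\<Psi> T = \<Psi> T'"
  shows "T = T'"
proof (rule eq_of_agree_0)
  fix x :: 'a
  obtain K where K: "\<And>T T'. T \<in> tilings Pr \<Longrightarrow> T' \<in> tilings Pr \<Longrightarrow> agree K (\<Psi> T) (\<Psi> T') \<Longrightarrow> agree (norm x) T T'"
    using \<Psi>_recover_all[of "norm x"] by meson
  show "agree 0 (translate (- x) T) (translate (- x) T')"
    by (rule agree_translate[OF K[OF T]]) (simp_all add: eq)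
next
  fix t assume "t \<in> T \<union> T'"
  then show "support t \<noteq> {}"
    using T by (auto intro!: source.tile_nonempty intro: tilings_tiles)
qed

text \<open>Local preimages of the patches of \<open>Z\<close> determine each other up to a translation \<open>g (p a) (b - a)\<close>.
  These translations form a cocycle on nearby pairs, and its integral \<open>G\<close> tells where to place
  the preimages so that they fit together.\<close>

lemma \<Psi>_glue:
  "\<exists>K. \<forall>Z\<in>tilings Pr'. \<forall>Q\<subseteq>tilings Pr. (\<forall>a. \<exists>p\<in>Q. agree K (\<Psi> p) (translate (- a) Z)) \<longrightarrow>
     (\<exists>T\<in>tilings Pr. \<Psi> T = Z \<and> (\<forall>x. \<exists>p\<in>Q. agree R p (translate (- x) T)))"
proof -
  obtain R1 where R1: "\<And>T T'. T \<in> tilings Pr \<Longrightarrow> T' \<in> tilings Pr \<Longrightarrow> agree R1 T T' \<Longrightarrow> agree 0 (\<Psi> T) (\<Psi> T')"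
    using \<Psi>_local[of 0] by meson
  \<comment> \<open>The patches to be glued need radius \<open>R\<close> for the conclusion,
    \<open>R1\<close> for \<Psi> of the result to match \<open>Z\<close>, and
    \<open>\<rho> + 1\<close> for \<open>f\<close> to be computed from them over a short
    step.\<close>
  define r where "r = max R (max R1 (\<rho> + 1))"
  have r: "R \<le> r" "R1 \<le> r" "\<rho> + 1 \<le> r" "0 \<le> r" using \<rho> by (auto simp: r_def)
  \<comment> \<open>If the patches placed at \<open>G a\<close> and \<open>G b\<close> have a tile
    in common, then \<open>G a\<close> and \<open>G b\<close> are at most
    \<open>2 * r + 2 * radius\<close> apart, and so \<open>a\<close> and \<open>b\<close> at most
    \<open>m\<close>. Such pairs have to be compared directly.\<close>
  define m where "m = 2 * s * (2 * r + 2 * source.radius)"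
  have m: "m > 0" using s r(4) source.radius(1) by (simp add: m_def)
  \<comment> \<open>The second bound lets \<open>g (p b)\<close> be evaluated at vectors of norm up
    to \<open>m\<close>; the cocycle identity depends on it.\<close>
  define r2 where "r2 = max r (2/s * m + \<rho>)"
  have r2: "r \<le> r2" "2/s * m + \<rho> \<le> r2" by (auto simp: r2_def)
  obtain K2 where K2: "\<And>T T'. T \<in> tilings Pr \<Longrightarrow> T' \<in> tilings Pr \<Longrightarrow> agree K2 (\<Psi> T) (\<Psi> T') \<Longrightarrow> agree r2 T T'"
    using \<Psi>_recover_all[of r2] by meson
  \<comment> \<open>The surplus \<open>m\<close> allows the patch of \<open>Z\<close> around
    \<open>b\<close> to be viewed from \<open>a\<close>.\<close>
  define K where "K = max 0 K2 + m"
  have K: "K2 + m \<le> K" "0 \<le> K" "K2 \<le> K" using m by (auto simp: K_def)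
  have "\<exists>T\<in>tilings Pr. \<Psi> T = Z \<and> (\<forall>x. \<exists>p\<in>Q. agree R p (translate (- x) T))"
    if Z: "Z \<in> tilings Pr'" and Q: "Q \<subseteq> tilings Pr" and ex: "\<And>a. \<exists>p\<in>Q. agree K (\<Psi> p) (translate (- a) Z)" for Z Q
  proof -
    obtain p where pQ: "\<And>a. p a \<in> Q" and pZ: "\<And>a. agree K (\<Psi> (p a)) (translate (- a) Z)"
      using ex by metis
    have p: "p a \<in> tilings Pr" for a using pQ Q by (rule subsetD[rotated])
    define \<gamma> where "\<gamma> a b = g (p a) (b - a)" for a b
    have step: "agree r2 (translate (- \<gamma> a b) (p a)) (p b)" if ab: "norm (a - b) \<le> m" for a b
    proof (rule K2)
      have "agree K2 (translate (- (b - a)) (\<Psi> (p a))) (translate (- (b - a)) (translate (- a) Z))"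
        by (rule agree_translate[OF pZ]) (use ab K(1) in \<open>simp add: norm_minus_commute\<close>)
      also have "translate (- (b - a)) (translate (- a) Z) = translate (- b) Z"
        by (simp add: translate_add)
      also have "agree K2 \<dots> (\<Psi> (p b))"
        by (rule agree_sym[OF agree_mono[OF pZ K(3)]])
      finally show "agree K2 (\<Psi> (translate (- \<gamma> a b) (p a))) (\<Psi> (p b))"
        by (simp add: \<gamma>_def \<Psi>_translate_g p)
    qed (intro tilings_translate p)+
    have cocycle: "\<gamma> a b + \<gamma> b c = \<gamma> a c" if ab: "norm (a - b) \<le> m" and bc: "norm (b - c) \<le> m" for a b c
    proof -
      have "2/s * norm (c - b) \<le> 2/s * m"
        using bc s by (intro mult_left_mono) (simp_all add: norm_minus_commute)
      then have "2/s * norm (c - b) + \<rho> \<le> r2" using r2 by simp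
      then have "g (translate (- \<gamma> a b) (p a)) (c - b) = g (p b) (c - b)"
        by (intro g_local[OF _ _ step[OF ab]] tilings_translate p)
      then have "g (p b) (c - b) = g (p a) (c - a) - g (p a) (b - a)"
        by (simp add: \<gamma>_def g_translate p)
      then show ?thesis by (simp add: \<gamma>_def)
    qed
    obtain G where G0: "G 0 = 0" and G: "\<And>a b. norm (a - b) \<le> m \<Longrightarrow> \<gamma> a b = G b - G a"
      using cocycle_integral[OF m, of \<gamma>] cocycle by metis
    \<comment> \<open>On pairs at distance at most \<open>m\<close>, the increments of
      \<open>G\<close> are increments of some \<open>g (p y)\<close>. The deviation bound is thus
      inherited locally, and local Lipschitz bounds are global.\<close>
    have Gscal: "near_scaling (1/(2 * s)) (1/s) G"
    proof -
      define H where "H x = G x - (1/s) *\<^sub>R x" for x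
      have "norm (H x - H y) \<le> 1/(2 * s) * norm (x - y)" for x y
      proof (rule lipschitz_from_local[OF m])
        fix x y :: 'a assume "norm (x - y) \<le> m"
        then have "G x - G y = g (p y) (x - y) - g (p y) 0"
          using G[of y x] by (simp add: \<gamma>_def g_0 p norm_minus_commute)
        then have "H x - H y = g (p y) (x - y) - g (p y) 0 - (1/s) *\<^sub>R (x - y - 0)"
          by (simp add: H_def algebra_simps)
        then show "norm (H x - H y) \<le> 1/(2 * s) * norm (x - y)"
          using g_scaling[OF p[of y]] unfolding near_scaling_def by (metis diff_zero)
      qed
      then show ?thesis unfolding near_scaling_def by (simp add: H_def algebra_simps)
    qed
    have Gbij: "bij G"
      using s by (intro near_scaling_bij[OF Gscal]) (simp_all add: divide_simps)
    have Glow: "norm (a - b) \<le> 2 * s * norm (G a - G b)" for a b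
    proof -
      have "1/s - 1/(2 * s) = 1/(2 * s)" using s by (simp add: field_simps)
      then have "1/(2 * s) * norm (a - b) \<le> norm (G a - G b)"
        using near_scaling_lower[OF Gscal, of a b] s by simp
      then show ?thesis using s by (simp add: field_simps)
    qed
    define T where "T = (\<Union>a. translate (G a) (tiles_meeting (p a) (cball 0 r)))"
    \<comment> \<open>The consistency of the gluing: a tile of \<open>T\<close> near
      \<open>G a\<close> may stem from another patch \<open>p b\<close>, but then \<open>b\<close>
      is within \<open>m\<close> of \<open>a\<close> and \<open>step\<close> puts the tile into
      \<open>p a\<close> as well.\<close>
    have T_mem: "translate_tile (- G a) t \<in> p a"
      if t: "t \<in> T" and y: "y \<in> support t" "norm (y - G a) \<le> r" for t a y
    proof -
      obtain b where b: "translate_tile (- G b) t \<in> tiles_meeting (p b) (cball 0 r)"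
        using t unfolding T_def by (auto simp: mem_translate)
      let ?t = "translate_tile (- G b) t"
      obtain z where z: "?t \<in> p b" "z \<in> support ?t" "norm z \<le> r"
        using b unfolding tiles_meeting_def by auto
      have "y - G b \<in> support ?t" using y(1) by (auto simp: support_translate_tile)
      then have "norm (y - G b - z) \<le> 2 * source.radius"
        by (intro source.tile_diameter[OF tilings_tiles[OF p z(1)]] z)
      then have "norm (G b - G a) \<le> 2 * r + 2 * source.radius"
        using y(2) z(3) norm_triangle_ineq4[of "y - G a" "y - G b - z"] norm_triangle_ineq4[of "G b - G a + z" z]
        by (simp add: algebra_simps)
      then have "2 * s * norm (G b - G a) \<le> m"
        unfolding m_def using s by (intro mult_left_mono) auto
      then have ba: "norm (b - a) \<le> m" using Glow[of b a] by simp
      have "agree r (translate (- (G a - G b)) (p b)) (p a)"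
        using agree_mono[OF step[OF ba] r2(1)] G[OF ba] by simp
      moreover have "y - G a \<in> support (translate_tile (- G a) t)"
        using y(1) by (auto simp: support_translate_tile)
      ultimately have "translate_tile (- G a) t \<in> translate (- (G a - G b)) (p b) \<longleftrightarrow> translate_tile (- G a) t \<in> p a"
        using y(2) by (rule agree_mem)
      then show ?thesis
        using z(1) by (simp add: mem_translate translate_tile_add)
    qed
    have T_agree: "agree r (translate (- G a) T) (p a)" for a
      unfolding agree_def
    proof
      show "tiles_meeting (translate (- G a) T) (cball 0 r) \<subseteq> tiles_meeting (p a) (cball 0 r)"
      proof
        fix t assume "t \<in> tiles_meeting (translate (- G a) T) (cball 0 r)"
        then obtain y where y: "translate_tile (G a) t \<in> T" "y \<in> support t" "norm y \<le> r"
          unfolding tiles_meeting_def by (auto simp: mem_translate)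
        then have "t \<in> p a"
          using T_mem[of "translate_tile (G a) t" "G a + y" a] by (simp add: support_translate_tile)
        then show "t \<in> tiles_meeting (p a) (cball 0 r)"
          using y unfolding tiles_meeting_def by auto
      qed
      show "tiles_meeting (p a) (cball 0 r) \<subseteq> tiles_meeting (translate (- G a) T) (cball 0 r)"
      proof
        fix t assume t: "t \<in> tiles_meeting (p a) (cball 0 r)"
        then have "translate_tile (G a) t \<in> T"
          unfolding T_def by (auto simp: mem_translate intro!: exI[of _ a])
        then have "t \<in> translate (- G a) T" by (simp add: mem_translate)
        then show "t \<in> tiles_meeting (translate (- G a) T) (cball 0 r)"
          using t by (simp add: tiles_meeting_def)
      qed
    qed
    have T_at: "translate_tile (- G a) t \<in> p a" if "t \<in> T" "G a \<in> support t" for t a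
      using T_mem[OF that, of a] r(4) by simp
    have surj: "\<exists>a. y = G a" for y using Gbij by (meson bij_is_surj surj_def)
    have T_tile: "t \<in> tiles_of Pr" if t: "t \<in> T" for t
    proof -
      obtain b where "translate_tile (- G b) t \<in> p b"
        using t unfolding T_def by (auto simp: mem_translate tiles_meeting_def)
      then have "translate_tile (G b) (translate_tile (- G b) t) \<in> tiles_of Pr"
        by (intro translate_tiles_of tilings_tiles[OF p])
      then show ?thesis by simp
    qed
    have T: "T \<in> tilings Pr"
    proof (rule tilingsI[OF T_tile])
      fix y
      obtain a where a: "y = G a" using surj by blast
      obtain t where t: "t \<in> p a" "0 \<in> support t" using tilings_cover[OF p] by blast
      then have "t \<in> translate (- G a) T"
        using agree_mem[OF T_agree t(2)] r(4) by simp
      then show "\<exists>t\<in>T. y \<in> support t"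
        using t(2) a by (intro bexI[of _ "translate_tile (G a) t"]) (auto simp: mem_translate support_translate_tile)
    next
      fix t u assume tu: "t \<in> T" "u \<in> T" "t \<noteq> u"
      \<comment> \<open>A common point has the form \<open>G a\<close> because \<open>G\<close> is
        onto; both tiles then belong to the same tiling, the translate of \<open>p a\<close> by
        \<open>G a\<close>.\<close>
      have common: "interior (support t) \<inter> interior (support u) = {} \<and> meet_face_to_face t u"
        if "y \<in> support t \<inter> support u" for y
      proof -
        obtain a where a: "y = G a" using surj by blast
        let ?t = "translate_tile (- G a) t" and ?u = "translate_tile (- G a) u"
        have tu': "?t \<in> p a" "?u \<in> p a" "?t \<noteq> ?u"
          using T_at tu that a by (simp_all add: translate_tile_inj)
        have S: "support t = (+) (G a) ` support ?t" "support u = (+) (G a) ` support ?u"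
          by (simp_all flip: support_translate_tile)
        have "interior (support t) \<inter> interior (support u) = {}"
          unfolding S interior_translation translation_Int[symmetric] tilings_interiors[OF p tu'] by simp
        moreover have "meet_face_to_face t u"
          using meet_face_to_face_translate[OF tilings_meet[OF p tu'], of "G a"] by simp
        ultimately show ?thesis ..
      qed
      show "interior (support t) \<inter> interior (support u) = {}"
      proof (rule ccontr)
        assume *: "interior (support t) \<inter> interior (support u) \<noteq> {}"
        then obtain y where "y \<in> support t \<inter> support u" using interior_subset by blast
        then show False using common * by blast
      qed
      show "meet_face_to_face t u"
      proof (cases "support t \<inter> support u = {}")
        case True
        have "{} \<in> cells t" "{} \<in> cells u"
          using source.tile_empty_cell T_tile tu by auto
        then have "{C \<in> cells t. C \<subseteq> {}} = {C \<in> cells u. C \<subseteq> {}}" by auto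
        then show ?thesis
          unfolding meet_face_to_face_def True by (intro conjI exI[of _ "{}"]) auto
      next
        case False
        then show ?thesis using common by blast
      qed
    qed
    \<comment> \<open>The difference of the two sides has local Lipschitz constant 0 and is
      therefore constant. The bound \<open>s/2\<close> on the step keeps the increment of
      \<open>G\<close> below 1, within the part of \<open>T\<close> known from
      \<open>p a\<close>.\<close>
    have fG: "f T (G a) = a" for a
    proof -
      define h where "h a = f T (G a) - a" for a
      have "norm (h a - h 0) \<le> 0 * norm (a - 0)"
      proof (rule lipschitz_from_local)
        show "min m (s/2) > 0" using m s by simp
        fix a b :: 'a assume ab: "norm (a - b) \<le> min m (s/2)"
        then have g: "G b - G a = g (p a) (b - a)"
          using G[of a b] by (simp add: \<gamma>_def)
        have "norm (G b - G a) \<le> 2/s * (s/2)"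
          using g_bound[OF p, of a "b - a"] ab s unfolding g
          by (intro order_trans[OF g_bound[OF p]] mult_left_mono) (auto simp: norm_minus_commute)
        then have "norm (G b - G a) + \<rho> \<le> r" using s r(3) by simp
        then have "f (translate (- G a) T) (G b - G a) = f (p a) (G b - G a)"
          by (intro f_local[OF _ _ T_agree] tilings_translate T p)
        then have "f T (G b) - f T (G a) = b - a"
          unfolding g by (simp add: f_translate T f_g p) (simp add: g[symmetric])
        then show "norm (h a - h b) \<le> 0 * norm (a - b)" by (simp add: h_def algebra_simps)
      qed
      then show ?thesis by (simp add: h_def G0 f_0 T)
    qed
    have "\<Psi> T = Z"
    proof (rule eq_of_agree_0)
      fix a
      have "agree 0 (\<Psi> (translate (- G a) T)) (\<Psi> (p a))"
        by (intro R1 tilings_translate T p agree_mono[OF T_agree r(2)])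
      also have "agree 0 (\<Psi> (p a)) (translate (- a) Z)"
        by (rule agree_mono[OF pZ K(2)])
      finally show "agree 0 (translate (- a) (\<Psi> T)) (translate (- a) Z)"
        by (simp add: \<Psi>_translate T fG)
    next
      fix t assume "t \<in> \<Psi> T \<union> Z"
      then show "support t \<noteq> {}"
        using tilings_tiles[OF \<Psi>_tilings[OF T]] tilings_tiles[OF Z] target.tile_nonempty by blast
    qed
    moreover have "\<exists>p\<in>Q. agree R p (translate (- x) T)" for x
    proof -
      obtain a where "x = G a" using surj by blast
      then show ?thesis
        using pQ[of a] agree_sym[OF agree_mono[OF T_agree[of a] r(1)]] by blast
    qed
    ultimately show ?thesis using T by blast
  qed
  then show ?thesis by (intro exI[of _ K]) auto
qed

section \<open>The image of a tiling space\<close>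

context
  fixes P assumes P: "tiling_space Pr P"
begin

lemma P_tilings: "T \<in> P \<Longrightarrow> T \<in> tilings Pr"
  using tiling_space_subset[OF P] by (rule subsetD)

lemma P_translate: "T \<in> P \<Longrightarrow> translate v T \<in> P"
  using P by (simp add: tiling_space_def)

lemma image_\<Psi>_translate: "Z \<in> \<Psi> ` P \<Longrightarrow> translate v Z \<in> \<Psi> ` P"
proof (erule imageE)
  fix T assume T: "T \<in> P" "Z = \<Psi> T"
  then show "translate v Z \<in> \<Psi> ` P"
    using \<Psi>_translate_g[OF P_tilings[OF T(1)], of "- v"] P_translate[OF T(1), of "- g T (- v)"]
    by (metis image_eqI minus_minus)
qed

lemma image_\<Psi>_tilings: "\<Psi> ` P \<subseteq> tilings Pr'"
  using \<Psi>_tilings P_tilings by blast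

text \<open>A limit \<open>Z\<close> of images looks like an image on every ball, so gluing presents
  it as an image of a tiling that is locally close to \<open>P\<close>; that tiling lies in
  \<open>P\<close> since \<open>P\<close> is closed.\<close>

lemma closedin_image_\<Psi>: "closedin (tiling_topology Pr') (\<Psi> ` P)"
proof (rule closedin_tilingsI[OF image_\<Psi>_tilings])
  fix Z assume Z: "Z \<in> tilings Pr'" and near: "\<And>\<epsilon>. \<epsilon> > 0 \<Longrightarrow> \<exists>S\<in>\<Psi> ` P. tilings_within \<epsilon> Z S"
  have close: "\<exists>p\<in>P. agree K (\<Psi> p) (translate (- a) Z)" for K a
  proof -
    \<comment> \<open>The summand 1 absorbs the translation by \<open>u\<close>, whose norm is at
      most \<open>1/M\<close>.\<close>
    define M where "M = max 1 (K + norm a + 1)"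
    have M: "M \<ge> 1" "K + norm a + 1 \<le> M" by (auto simp: M_def)
    obtain p where p: "p \<in> P" "tilings_within (1/M) Z (\<Psi> p)"
      using near[of "1/M"] M(1) by auto
    then obtain u u' where u: "norm u \<le> 1/M" "agree M (translate u Z) (translate u' (\<Psi> p))"
      using M(1) unfolding tilings_within_agree by auto
    have "1/M \<le> 1" using M(1) by (simp add: divide_simps)
    then have "norm (- a - u) + K \<le> M"
      using u(1) M(2) norm_triangle_ineq4[of "- a" u] by simp
    then have "agree K (translate (- a - u) (translate u Z)) (translate (- a - u) (translate u' (\<Psi> p)))"
      by (rule agree_translate[OF u(2)])
    then have "agree K (translate (- a - u) (translate u' (\<Psi> p))) (translate (- a) Z)"
      by (simp add: translate_add agree_sym)
    moreover have "translate (- a - u) (translate u' (\<Psi> p)) \<in> \<Psi> ` P"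
      using p(1) by (intro image_\<Psi>_translate imageI)
    ultimately show ?thesis by fastforce
  qed
  have "\<exists>T\<in>tilings Pr. \<Psi> T = Z \<and> (\<exists>p\<in>P. agree R p T)" for R
  proof -
    obtain K where K: "\<forall>Z\<in>tilings Pr'. \<forall>Q\<subseteq>tilings Pr. (\<forall>a. \<exists>p\<in>Q. agree K (\<Psi> p) (translate (- a) Z)) \<longrightarrow>
        (\<exists>T\<in>tilings Pr. \<Psi> T = Z \<and> (\<forall>x. \<exists>p\<in>Q. agree R p (translate (- x) T)))"
      using \<Psi>_glue ..
    have "\<exists>T\<in>tilings Pr. \<Psi> T = Z \<and> (\<forall>x. \<exists>p\<in>P. agree R p (translate (- x) T))"
      using K[rule_format, OF Z tiling_space_subset[OF P] close] .
    then show ?thesis by (metis minus_zero translate_0)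
  qed
  \<comment> \<open>Gluing is carried out separately for every \<open>R\<close>; injectivity of
    \<Psi> shows that the preimage is always the same.\<close>
  then obtain T where T: "T \<in> tilings Pr" "\<Psi> T = Z" and agree: "\<And>R. \<exists>p\<in>P. agree R p T"
    using \<Psi>_inj by metis
  have "T \<in> P"
  proof (rule ccontr)
    assume "T \<notin> P"
    moreover have "closedin (tiling_topology Pr) P" using P by (simp add: tiling_space_def)
    ultimately obtain \<epsilon> where e: "\<epsilon> > 0" "\<forall>T'\<in>P. \<not> tilings_within \<epsilon> T T'"
      using closedin_tilingsD T(1) by blast
    obtain p where "p \<in> P" "agree (1/\<epsilon>) p T" using agree by blast
    then show False using e agree_imp_within[OF agree_sym] by blast
  qed
  then show "Z \<in> \<Psi> ` P" using T(2) by blast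
qed

lemma tiling_space_image_\<Psi>: "tiling_space Pr' (\<Psi> ` P)"
  unfolding tiling_space_def
  using target.finite_Pr closedin_image_\<Psi> P image_\<Psi>_translate by (auto simp: tiling_space_def)

lemma homeomorphic_image_\<Psi>:
  "subtopology (tiling_topology Pr) P homeomorphic_space subtopology (tiling_topology Pr') (\<Psi> ` P)"
proof -
  have inj: "inj_on \<Psi> P"
    by (rule inj_onI) (rule \<Psi>_inj[OF P_tilings P_tilings])
  have "continuous_map (subtopology (tiling_topology Pr) P) (subtopology (tiling_topology Pr') (\<Psi> ` P)) \<Psi>"
  proof (rule continuous_map_between_tilings)
    show "closedin (tiling_topology Pr) P" using P by (simp add: tiling_space_def)
    fix T and \<epsilon> :: real assume T: "T \<in> P" and e: "\<epsilon> > 0"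
    obtain R where R: "\<And>T T'. T \<in> tilings Pr \<Longrightarrow> T' \<in> tilings Pr \<Longrightarrow> agree R T T' \<Longrightarrow> agree (1/\<epsilon>) (\<Psi> T) (\<Psi> T')"
      using \<Psi>_local[of "1/\<epsilon>"] by meson
    \<comment> \<open>The first bound controls the translation \<open>f T (- u)\<close> into which a
      translation by \<open>u\<close> is converted, the second gives
      \<open>1/\<delta> \<ge> R\<close>. The inner \<open>max 1 R\<close> covers nonpositive
      \<open>R\<close>.\<close>
    define \<delta> where "\<delta> = min (\<epsilon> / (2 * s)) (1 / max 1 R)"
    have d: "\<delta> > 0" "2 * s * \<delta> \<le> \<epsilon>" "R \<le> 1/\<delta>"
    proof -
      show d0: "\<delta> > 0" using e s by (simp add: \<delta>_def)
      have "\<delta> \<le> \<epsilon> / (2 * s)" by (simp add: \<delta>_def)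
      then show "2 * s * \<delta> \<le> \<epsilon>" using s by (simp add: field_simps)
      have "M \<le> 1/\<delta>" if "\<delta> \<le> 1/M" "M \<ge> 1" for M
        using that d0 by (simp add: field_simps)
      from this[of "max 1 R"] show "R \<le> 1/\<delta>" by (simp add: \<delta>_def)
    qed
    have small: "norm (f T (- u)) \<le> \<epsilon>" if "T \<in> P" "norm u \<le> \<delta>" for T u
    proof -
      have "2 * s * norm (- u) \<le> 2 * s * \<delta>" using that(2) s by simp
      then show ?thesis using f_bound[OF P_tilings[OF that(1)], of "- u"] d(2) by linarith
    qed
    have "tilings_within \<epsilon> (\<Psi> T) (\<Psi> T')" if T': "T' \<in> P" and w: "tilings_within \<delta> T T'" for T'
    proof -
      obtain u u' where u: "norm u \<le> \<delta>" "norm u' \<le> \<delta>" "agree (1/\<delta>) (translate u T) (translate u' T')"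
        using w unfolding tilings_within_agree by blast
      have "agree (1/\<epsilon>) (\<Psi> (translate u T)) (\<Psi> (translate u' T'))"
        by (intro R tilings_translate P_tilings T T' agree_mono[OF u(3) d(3)])
      then have "agree (1/\<epsilon>) (translate (- f T (- u)) (\<Psi> T)) (translate (- f T' (- u')) (\<Psi> T'))"
        using \<Psi>_translate[OF P_tilings[OF T], of "- u"] \<Psi>_translate[OF P_tilings[OF T'], of "- u'"] by simp
      then show ?thesis
        unfolding tilings_within_agree using small[OF T u(1)] small[OF T' u(2)]
        by (metis norm_minus_cancel)
    qed
    then show "\<exists>\<delta>>0. \<forall>T'\<in>P. tilings_within \<delta> T T' \<longrightarrow> tilings_within \<epsilon> (\<Psi> T) (\<Psi> T')"
      using d(1) by blast
  qed (use image_\<Psi>_tilings in auto)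
  moreover have "continuous_map (subtopology (tiling_topology Pr') (\<Psi> ` P)) (subtopology (tiling_topology Pr) P) (inv_into P \<Psi>)"
  proof (rule continuous_map_between_tilings[OF closedin_image_\<Psi>])
    fix Z and \<epsilon> :: real assume Z: "Z \<in> \<Psi> ` P" and e: "\<epsilon> > 0"
    obtain K where K: "\<And>T T'. T \<in> tilings Pr \<Longrightarrow> T' \<in> tilings Pr \<Longrightarrow> agree K (\<Psi> T) (\<Psi> T') \<Longrightarrow> agree (1/\<epsilon>) T T'"
      using \<Psi>_recover_all[of "1/\<epsilon>"] by meson
    define \<delta> where "\<delta> = min (s * \<epsilon> / 2) (1 / max 1 K)"
    have d: "\<delta> > 0" "2/s * \<delta> \<le> \<epsilon>" "K \<le> 1/\<delta>"
    proof -
      show d0: "\<delta> > 0" using e s by (simp add: \<delta>_def)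
      have "\<delta> \<le> s * \<epsilon> / 2" by (simp add: \<delta>_def)
      then show "2/s * \<delta> \<le> \<epsilon>" using s by (simp add: field_simps)
      have "M \<le> 1/\<delta>" if "\<delta> \<le> 1/M" "M \<ge> 1" for M
        using that d0 by (simp add: field_simps)
      from this[of "max 1 K"] show "K \<le> 1/\<delta>" by (simp add: \<delta>_def)
    qed
    have small: "norm (g T (- u)) \<le> \<epsilon>" if "T \<in> P" "norm u \<le> \<delta>" for T u
    proof -
      have "2/s * norm (- u) \<le> 2/s * \<delta>" using that(2) s by (intro mult_left_mono) auto
      then show ?thesis using g_bound[OF P_tilings[OF that(1)], of "- u"] d(2) by linarith
    qed
    have "tilings_within \<epsilon> T T'" if T: "T \<in> P" "T' \<in> P" and w: "tilings_within \<delta> (\<Psi> T) (\<Psi> T')" for T T'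
    proof -
      obtain u u' where u: "norm u \<le> \<delta>" "norm u' \<le> \<delta>" "agree (1/\<delta>) (translate u (\<Psi> T)) (translate u' (\<Psi> T'))"
        using w unfolding tilings_within_agree by blast
      have "agree K (\<Psi> (translate (- g T (- u)) T)) (\<Psi> (translate (- g T' (- u')) T'))"
        using agree_mono[OF u(3) d(3)] by (simp add: \<Psi>_translate_g P_tilings T)
      then have "agree (1/\<epsilon>) (translate (- g T (- u)) T) (translate (- g T' (- u')) T')"
        by (intro K tilings_translate P_tilings T)
      then show ?thesis
        unfolding tilings_within_agree using small[OF T(1) u(1)] small[OF T(2) u(2)]
        by (metis norm_minus_cancel)
    qed
    then have "tilings_within \<epsilon> (inv_into P \<Psi> Z) (inv_into P \<Psi> Z')" if "Z' \<in> \<Psi> ` P" "tilings_within \<delta> Z Z'" for Z'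
      using that Z by (simp add: inv_into_into f_inv_into_f)
    then show "\<exists>\<delta>>0. \<forall>Z'\<in>\<Psi> ` P. tilings_within \<delta> Z Z' \<longrightarrow> tilings_within \<epsilon> (inv_into P \<Psi> Z) (inv_into P \<Psi> Z')"
      using d(1) by blast
  qed (use tiling_space_subset[OF P] inj in auto)
  moreover have "topspace (subtopology (tiling_topology Pr) P) = P"
    "topspace (subtopology (tiling_topology Pr') (\<Psi> ` P)) = \<Psi> ` P"
    using tiling_space_subset[OF P] image_\<Psi>_tilings by (auto simp: topspace_tiling_topology)
  ultimately have "homeomorphic_maps (subtopology (tiling_topology Pr) P)
      (subtopology (tiling_topology Pr') (\<Psi> ` P)) \<Psi> (inv_into P \<Psi>)"
    unfolding homeomorphic_maps_def using inj by (simp add: f_inv_into_f)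
  then show ?thesis unfolding homeomorphic_space_def by blast
qed

text \<open>One direction only uses that \<Psi> is local. In the other, \<open>Z\<close> is an
  arbitrary tiling by cubes, and gluing both provides a preimage and makes it locally look like
  \<open>P\<close>.\<close>

lemma locally_determined_image_\<Psi>:
  "locally_determined Pr' (\<Psi> ` P) \<longleftrightarrow> locally_determined Pr P"
proof
  assume "locally_determined Pr' (\<Psi> ` P)"
  then obtain \<sigma> where det: "\<And>Z. Z \<in> tilings Pr' \<Longrightarrow> (\<And>x. \<exists>S\<in>\<Psi> ` P. agree \<sigma> (translate (- x) Z) S) \<Longrightarrow> Z \<in> \<Psi> ` P"
    unfolding locally_determined_def by metis
  obtain R where R: "\<And>T T'. T \<in> tilings Pr \<Longrightarrow> T' \<in> tilings Pr \<Longrightarrow> agree R T T' \<Longrightarrow> agree \<sigma> (\<Psi> T) (\<Psi> T')"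
    using \<Psi>_local[of \<sigma>] by meson
  have "T \<in> P" if T: "T \<in> tilings Pr" and loc: "\<And>x. \<exists>p\<in>P. agree (max 1 R) (translate (- x) T) p" for T
  proof -
    have "\<exists>S\<in>\<Psi> ` P. agree \<sigma> (translate (- w) (\<Psi> T)) S" for w
    proof -
      obtain p where p: "p \<in> P" "agree (max 1 R) (translate (- g T w) T) p" using loc by blast
      have "agree \<sigma> (\<Psi> (translate (- g T w) T)) (\<Psi> p)"
        by (intro R tilings_translate T P_tilings p(1) agree_mono[OF p(2)]) simp
      then show ?thesis using p(1) by (auto simp: \<Psi>_translate_g T)
    qed
    then have "\<Psi> T \<in> \<Psi> ` P" using det \<Psi>_tilings[OF T] by blast
    then show "T \<in> P" using \<Psi>_inj T P_tilings by blast
  qed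
  then show "locally_determined Pr P"
    unfolding locally_determined_def by (intro exI[of _ "max 1 R"]) auto
next
  assume "locally_determined Pr P"
  then obtain \<sigma> where det: "\<And>T. T \<in> tilings Pr \<Longrightarrow> (\<And>x. \<exists>p\<in>P. agree \<sigma> (translate (- x) T) p) \<Longrightarrow> T \<in> P"
    unfolding locally_determined_def by metis
  obtain K where K: "\<forall>Z\<in>tilings Pr'. \<forall>Q\<subseteq>tilings Pr. (\<forall>a. \<exists>p\<in>Q. agree K (\<Psi> p) (translate (- a) Z)) \<longrightarrow>
      (\<exists>T\<in>tilings Pr. \<Psi> T = Z \<and> (\<forall>x. \<exists>p\<in>Q. agree \<sigma> p (translate (- x) T)))"
    using \<Psi>_glue ..
  have "Z \<in> \<Psi> ` P" if Z: "Z \<in> tilings Pr'" and loc: "\<And>x. \<exists>S\<in>\<Psi> ` P. agree (max 1 K) (translate (- x) Z) S" for Z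
  proof -
    have "\<exists>p\<in>P. agree K (\<Psi> p) (translate (- a) Z)" for a
    proof -
      obtain p where "p \<in> P" "agree (max 1 K) (translate (- a) Z) (\<Psi> p)" using loc by blast
      then show ?thesis using agree_sym[OF agree_mono[of "max 1 K" _ _ K]] by auto
    qed
    then obtain T where T: "T \<in> tilings Pr" "\<Psi> T = Z" "\<And>x. \<exists>p\<in>P. agree \<sigma> p (translate (- x) T)"
      using K[rule_format, OF Z tiling_space_subset[OF P]] by metis
    have "T \<in> P" using det[OF T(1)] T(3) agree_sym by metis
    then show ?thesis using T(2) by blast
  qed
  then show "locally_determined Pr' (\<Psi> ` P)"
    unfolding locally_determined_def by (intro exI[of _ "max 1 K"]) auto
qed

lemma local_matching_rules_image_\<Psi>:
  "local_matching_rules Pr' (\<Psi> ` P) \<longleftrightarrow> local_matching_rules Pr P"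
proof -
  have "local_matching_rules Pr' (\<Psi> ` P) \<longleftrightarrow> locally_determined Pr' (\<Psi> ` P)"
    by (rule target.local_matching_rules_iff[OF image_\<Psi>_tilings image_\<Psi>_translate])
  moreover have "local_matching_rules Pr P \<longleftrightarrow> locally_determined Pr P"
    by (rule source.local_matching_rules_iff[OF tiling_space_subset[OF P] P_translate])
  ultimately show ?thesis by (simp add: locally_determined_image_\<Psi>)
qed

end

end

section \<open>Lattice cubings\<close>

lemma sum_Basis_nth [simp]: "(\<Sum>b\<in>(Basis :: (real ^ 'n) set). b $ i) = 1"
proof -
  have "(\<Sum>b\<in>(Basis :: (real ^ 'n) set). b $ i) = (\<Sum>b\<in>(Basis :: (real ^ 'n) set). if b = axis i 1 then 1 else 0)"
    by (intro sum.cong refl) (simp add: cart_eq_inner_axis inner_Basis)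
  also have "\<dots> = 1" by (simp add: sum.delta)
  finally show ?thesis .
qed

lemma mem_cube:
  "y \<in> cbox u (u + One) \<longleftrightarrow> (\<forall>i. u $ i \<le> y $ i \<and> y $ i \<le> u $ i + 1)" for y :: "real ^ 'n"
  by (simp add: mem_box_cart)

definition real_vec :: "int ^ 'n \<Rightarrow> real ^ 'n" where
  "real_vec n = (\<chi> i. real_of_int (n $ i))"

lemma real_vec_nth [simp]: "real_vec n $ i = real_of_int (n $ i)"
  by (simp add: real_vec_def)

lemma real_vec_simps [simp]:
  "real_vec 0 = 0" "real_vec (m + n) = real_vec m + real_vec n"
  "real_vec (m - n) = real_vec m - real_vec n" "real_vec (- n) = - real_vec n"
  "real_vec m = real_vec n \<longleftrightarrow> m = n"
  by (simp_all add: vec_eq_iff)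

lemma finite_bounded_real_vec: "finite {n :: int ^ 'n. norm (real_vec n) \<le> M}"
proof (rule finite_subset)
  show "{n :: int ^ 'n. norm (real_vec n) \<le> M} \<subseteq> (\<lambda>f. \<chi> i. f i) ` (\<Pi>\<^sub>E i\<in>UNIV. {- \<lfloor>M\<rfloor>..\<lfloor>M\<rfloor>})"
  proof
    fix n :: "int ^ 'n" assume "n \<in> {n. norm (real_vec n) \<le> M}"
    then have "\<bar>real_of_int (n $ i)\<bar> \<le> M" for i
      using component_le_norm_cart[of "real_vec n" i] by simp
    then have "n $ i \<le> \<lfloor>M\<rfloor>" "- (n $ i) \<le> \<lfloor>M\<rfloor>" for i
      unfolding le_floor_iff by (simp_all add: abs_le_iff)
    then have "n $ i \<in> {- \<lfloor>M\<rfloor>..\<lfloor>M\<rfloor>}" for i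
      by (simp add: minus_le_iff)
    then show "n \<in> (\<lambda>f. \<chi> i. f i) ` (\<Pi>\<^sub>E i\<in>UNIV. {- \<lfloor>M\<rfloor>..\<lfloor>M\<rfloor>})"
      by (intro image_eqI[of _ _ "\<lambda>i. n $ i"]) auto
  qed
  show "finite ((\<lambda>f. \<chi> i. f i) ` (\<Pi>\<^sub>E i\<in>(UNIV :: 'n set). {- \<lfloor>M\<rfloor>..\<lfloor>M\<rfloor>}))"
    by (intro finite_imageI finite_PiE) auto
qed

lemma support_cube_tile: "support (cube_tile a) = cbox 0 One"
  unfolding support_def cube_tile_def fst_conv
  using face_of_refl[OF convex_box(1)] face_of_imp_subset by blast

lemma support_cube:
  "support (translate_tile u (cube_tile a)) = cbox u (u + One)"
  by (simp add: support_translate_tile support_cube_tile cbox_translation[symmetric] del: cbox_translation)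

lemma cells_cube: "cells (translate_tile u (cube_tile a)) = {F. F face_of cbox u (u + One)}"
proof -
  have c: "cbox u (u + One) = (+) u ` cbox 0 One"
    using support_cube[of u a] by (simp add: support_translate_tile support_cube_tile)
  have "F \<in> (`) ((+) u) ` {F. F face_of cbox 0 One}" if "F face_of (+) u ` cbox 0 One" for F
  proof
    have "F = (+) u ` ((+) (- u) ` F)" by (simp add: image_image)
    then show "F = (+) u ` ((+) (- u) ` F)" "(+) (- u) ` F \<in> {F. F face_of cbox 0 One}"
      using that by (metis face_of_translation_eq mem_Collect_eq)+
  qed
  then show ?thesis
    unfolding c translate_tile_def cube_tile_def fst_conv by auto
qed

lemma cube_eq_iff:
  fixes u w :: "real ^ 'n"
  shows "translate_tile u (cube_tile a) = translate_tile w (cube_tile b) \<longleftrightarrow> u = w \<and> a = b"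
proof
  assume eq: "translate_tile u (cube_tile a) = translate_tile w (cube_tile b)"
  then have "cbox u (u + One) = cbox w (w + One)" by (metis support_cube)
  moreover have "u \<in> cbox u (u + One)" "w \<in> cbox w (w + One)" by (simp_all add: mem_cube)
  ultimately have "u \<in> cbox w (w + One)" "w \<in> cbox u (u + One)" by blast+
  then have "u = w" by (simp add: mem_cube vec_eq_iff antisym)
  moreover have "a = b" using eq by (simp add: translate_tile_def cube_tile_def)
  ultimately show "u = w \<and> a = b" ..
qed simp

lemma protoset_cubes:
  assumes "finite A"
  shows "protoset (cube_tile ` A :: (real ^ 'n, 'm) tile set)"
proof
  have C: "cells (cube_tile a :: (real ^ 'n, 'm) tile) = {F. F face_of cbox 0 One}" for a
    by (simp add: cube_tile_def)
  fix t :: "(real ^ 'n, 'm) tile" assume "t \<in> cube_tile ` A"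
  then obtain a where t: "t = cube_tile a" by blast
  show "finite (cells t)" unfolding t C by (rule finite_polytope_faces) (rule polytope_interval)
  show "{} \<in> cells t" unfolding t C by simp
  show "compact D" if "D \<in> cells t" for D
    using that unfolding t C by (blast intro: face_of_imp_compact[OF convex_box(1) compact_cbox])
  have "(\<chi> i. 1/2) \<in> box (0 :: real ^ 'n) One" by (simp add: mem_box_cart)
  then show "interior (support t) \<noteq> {}"
    unfolding t support_cube_tile interior_cbox by blast
qed (use assms in simp)

text \<open>The sign of \<open>v\<close> is that of the suspension: \<open>(shift n x, v)\<close>
  and \<open>(x, v + real_vec n)\<close> give the same cubing.\<close>

definition cubing :: "(int ^ 'n \<Rightarrow> 'm) \<Rightarrow> real ^ 'n \<Rightarrow> (real ^ 'n, 'm) tile set" where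
  "cubing x v = range (\<lambda>n. translate_tile (real_vec n - v) (cube_tile (x n)))"

lemma translate_cubing: "translate w (cubing x v) = cubing x (v - w)"
  by (simp add: cubing_def translate_def image_image translate_tile_add algebra_simps)

lemma cubing_shift: "cubing (shift n x) v = cubing x (v + real_vec n)"
proof -
  define F where "F m = translate_tile (real_vec m - (v + real_vec n)) (cube_tile (x m))" for m
  have "cubing (shift n x) v = F ` range (\<lambda>m. m + n)"
    unfolding cubing_def shift_def F_def image_image by simp
  also have "range (\<lambda>m. m + n) = UNIV" by simp
  finally show ?thesis by (simp add: cubing_def F_def)
qed

lemma mem_cubing:
  "translate_tile (real_vec m - v) (cube_tile a) \<in> cubing x v \<longleftrightarrow> a = x m"
  by (auto simp: cubing_def cube_eq_iff)

text \<open>The second cube is the intersection of its coordinate slabs. As the cubes differ by an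
  integral vector, each slab meets the first cube in the whole cube, a facet or the empty set, and
  intersections of faces are faces.\<close>

lemma cbox_Int_face_of:
  fixes m n :: "int ^ 'n" and v :: "real ^ 'n"
  defines "B \<equiv> \<lambda>k. cbox (real_vec k - v) (real_vec k - v + One)"
  shows "B n \<inter> B m face_of B n"
proof -
  define S where "S i = {x :: real ^ 'n. real_vec m $ i - v $ i \<le> x $ i \<and> x $ i \<le> real_vec m $ i - v $ i + 1}" for i
  have conv: "convex (B n)" by (simp add: B_def)
  have "B n \<inter> S i face_of B n" for i
  proof -
    consider "m $ i = n $ i" | "m $ i = n $ i + 1" | "m $ i = n $ i - 1" | "m $ i > n $ i + 1" | "m $ i < n $ i - 1"
      by linarith
    then show ?thesis
    proof cases
      case 1
      then have "B n \<inter> S i = B n" by (auto simp: B_def S_def mem_cube)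
      then show ?thesis using conv by (simp add: face_of_refl)
    next
      case 2
      then have "B n \<inter> S i = B n \<inter> {x. axis i 1 \<bullet> x = real_vec n $ i - v $ i + 1}"
        by (auto simp: B_def S_def mem_cube inner_axis' intro: antisym) 
      moreover have "\<dots> face_of B n"
        by (rule face_of_Int_supporting_hyperplane_le[OF conv]) (auto simp: B_def mem_cube inner_axis')
      ultimately show ?thesis by simp
    next
      case 3
      then have "B n \<inter> S i = B n \<inter> {x. axis i 1 \<bullet> x = real_vec n $ i - v $ i}"
        by (auto simp: B_def S_def mem_cube inner_axis' intro: antisym)
      moreover have "\<dots> face_of B n"
        by (rule face_of_Int_supporting_hyperplane_ge[OF conv]) (auto simp: B_def mem_cube inner_axis')
      ultimately show ?thesis by simp
    next
      case 4
      then have "real_of_int (m $ i) > real_of_int (n $ i) + 1" by linarith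
      moreover have False if "y \<in> B n \<inter> S i" for y
      proof -
        have "real_of_int (n $ i) - v $ i \<le> y $ i" "y $ i \<le> real_of_int (n $ i) - v $ i + 1"
          "real_of_int (m $ i) - v $ i \<le> y $ i" "y $ i \<le> real_of_int (m $ i) - v $ i + 1"
          using that by (auto simp: B_def S_def mem_cube)
        then show False using calculation by linarith
      qed
      then have "B n \<inter> S i = {}" by blast
      then show ?thesis by simp
    next
      case 5
      then have "real_of_int (m $ i) < real_of_int (n $ i) - 1" by linarith
      moreover have False if "y \<in> B n \<inter> S i" for y
      proof -
        have "real_of_int (n $ i) - v $ i \<le> y $ i" "y $ i \<le> real_of_int (n $ i) - v $ i + 1"
          "real_of_int (m $ i) - v $ i \<le> y $ i" "y $ i \<le> real_of_int (m $ i) - v $ i + 1"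
          using that by (auto simp: B_def S_def mem_cube)
        then show False using calculation by linarith
      qed
      then have "B n \<inter> S i = {}" by blast
      then show ?thesis by simp
    qed
  qed
  then have "(\<Inter>i. B n \<inter> S i) face_of B n"
    by (intro face_of_Inter) auto
  moreover have "(\<Inter>i. B n \<inter> S i) = B n \<inter> B m"
    by (auto simp: B_def S_def mem_cube)
  ultimately show ?thesis by simp
qed

lemma cubing_tilings:
  fixes x :: "int ^ 'n \<Rightarrow> 'm"
  assumes "range x \<subseteq> A"
  shows "cubing x v \<in> tilings (cube_tile ` A)"
proof (rule tilingsI)
  fix t assume "t \<in> cubing x v"
  then obtain n where "t = translate_tile (real_vec n - v) (cube_tile (x n))"
    by (auto simp: cubing_def)
  then show "t \<in> tiles_of (cube_tile ` A)"
    using assms unfolding tiles_of_def by blast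
next
  fix y :: "real ^ 'n"
  define n :: "int ^ 'n" where "n = (\<chi> i. \<lfloor>y $ i + v $ i\<rfloor>)"
  have "real_of_int (n $ i) \<le> y $ i + v $ i \<and> y $ i + v $ i \<le> real_of_int (n $ i) + 1" for i
    by (simp add: n_def)
  then have "y \<in> support (translate_tile (real_vec n - v) (cube_tile (x n)))"
    unfolding support_cube mem_cube by (simp add: algebra_simps)
  then show "\<exists>t\<in>cubing x v. y \<in> support t" by (auto simp: cubing_def)
next
  fix s t assume st: "s \<in> cubing x v" "t \<in> cubing x v" "s \<noteq> t"
  then obtain n m where nm: "s = translate_tile (real_vec n - v) (cube_tile (x n))"
    "t = translate_tile (real_vec m - v) (cube_tile (x m))" "n \<noteq> m"
    by (auto simp: cubing_def)
  show "interior (support s) \<inter> interior (support t) = {}"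
  proof (rule ccontr)
    assume "interior (support s) \<inter> interior (support t) \<noteq> {}"
    then obtain y where "y \<in> box (real_vec n - v) (real_vec n - v + One)" "y \<in> box (real_vec m - v) (real_vec m - v + One)"
      by (auto simp: nm support_cube)
    then have "real_of_int (n $ i) - v $ i < y $ i" "y $ i < real_of_int (n $ i) - v $ i + 1"
      "real_of_int (m $ i) - v $ i < y $ i" "y $ i < real_of_int (m $ i) - v $ i + 1" for i
      by (auto simp: mem_box_cart)
    then have "n $ i = m $ i" for i by (smt (verit, best) of_int_less_iff of_int_1 of_int_add)
    then show False using nm(3) by (simp add: vec_eq_iff)
  qed
  let ?S = "cbox (real_vec n - v) (real_vec n - v + One)" and ?T = "cbox (real_vec m - v) (real_vec m - v + One)"
  have f: "?S \<inter> ?T face_of ?S" "?S \<inter> ?T face_of ?T"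
    using cbox_Int_face_of[of n v m] cbox_Int_face_of[of m v n] by (simp_all add: Int_commute)
  \<comment> \<open>The intersection is itself a cell of both cubes, and the cells inside it are its
    own faces, whichever cube they are taken from.\<close>
  show "meet_face_to_face s t"
    unfolding meet_face_to_face_def nm(1,2) support_cube cells_cube
    using f face_of_face[OF f(1)] face_of_face[OF f(2)]
    by (intro conjI exI[of _ "{?S \<inter> ?T}"]) auto
qed

lemma cubing_tilingsD:
  assumes "cubing x v \<in> tilings (cube_tile ` A)"
  shows "range x \<subseteq> A"
proof -
  have "x n \<in> A" for n
  proof -
    have "translate_tile (real_vec n - v) (cube_tile (x n)) \<in> tiles_of (cube_tile ` A)"
      by (rule tilings_tiles[OF assms]) (simp add: mem_cubing)
    then show ?thesis
      unfolding tiles_of_def by (auto simp: translate_tile_def cube_tile_def)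
  qed
  then show ?thesis by blast
qed

lemma agree_cubing:
  fixes x x' :: "int ^ 'n \<Rightarrow> 'm"
  assumes "\<And>m. norm (real_vec m) \<le> R + norm v + norm (One :: real ^ 'n) \<Longrightarrow> x m = x' m"
  shows "agree R (cubing x v) (cubing x' v)"
proof -
  have "tiles_meeting (cubing x v) (cball 0 R) \<subseteq> tiles_meeting (cubing x' v) (cball 0 R)"
    if eq: "\<And>m. norm (real_vec m) \<le> R + norm v + norm (One :: real ^ 'n) \<Longrightarrow> x m = x' m" for x x' :: "int ^ 'n \<Rightarrow> 'm"
  proof
    fix t assume t: "t \<in> tiles_meeting (cubing x v) (cball 0 R)"
    then obtain y where y: "t \<in> cubing x v" "y \<in> support t" "norm y \<le> R"
      unfolding tiles_meeting_def by auto
    then obtain m where m: "t = translate_tile (real_vec m - v) (cube_tile (x m))" "y \<in> support t" "norm y \<le> R"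
      by (auto simp: cubing_def)
    have "norm (y - (real_vec m - v)) \<le> norm (One :: real ^ 'n)"
    proof (rule norm_le_componentwise_cart)
      fix i show "norm ((y - (real_vec m - v)) $ i) \<le> norm ((One :: real ^ 'n) $ i)"
        using m(2) by (simp add: m(1) support_cube mem_cube) (smt (verit))
    qed
    then have "norm (real_vec m) \<le> R + norm v + norm (One :: real ^ 'n)"
      using m(3) norm_triangle_ineq4[of "y + v" "y - (real_vec m - v)"] norm_triangle_ineq[of y v] by simp
    then have "t \<in> cubing x' v" using eq by (simp add: m(1) mem_cubing)
    then show "t \<in> tiles_meeting (cubing x' v) (cball 0 R)"
      using t by (simp add: tiles_meeting_def)
  qed
  from this[of x x'] this[of x' x] show ?thesis
    unfolding agree_def using assms by (metis subset_antisym)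
qed

text \<open>The cube over the origin belongs to both cubings, so their offsets differ by an integral
  vector \<open>n\<close>. The marks agree wherever the lower corner of a cube lies in the
  ball.\<close>

lemma cubing_of_agree:
  fixes x x' :: "int ^ 'n \<Rightarrow> 'm"
  assumes ag: "agree R (cubing x v) (cubing x' v')" and "R \<ge> 0"
  obtains n where "v' = v + real_vec n"
    "\<And>m. norm (real_vec m - v) \<le> R \<Longrightarrow> shift n x' m = x m"
proof -
  have *: "translate_tile (real_vec m - v) (cube_tile (x m)) \<in> cubing x' v'"
    if "y \<in> support (translate_tile (real_vec m - v) (cube_tile (x m)))" "norm y \<le> R" for m y
    using agree_mem[OF ag that] by (simp add: mem_cubing)
  obtain t where "t \<in> cubing x v" "0 \<in> support t"
    using tilings_cover[OF cubing_tilings[OF order_refl]] by blast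
  then obtain m0 where "0 \<in> support (translate_tile (real_vec m0 - v) (cube_tile (x m0)))"
    by (auto simp: cubing_def)
  from *[OF this] assms(2) obtain k where "real_vec m0 - v = real_vec k - v'"
    by (auto simp: cubing_def cube_eq_iff)
  then have v': "v' = v + real_vec (k - m0)" by (simp add: algebra_simps)
  show thesis
  proof (rule that[OF v'])
    fix m assume m: "norm (real_vec m - v) \<le> R"
    have "real_vec m - v \<in> support (translate_tile (real_vec m - v) (cube_tile (x m)))"
      by (simp add: support_cube mem_cube)
    from *[OF this m] have "translate_tile (real_vec m - v) (cube_tile (x m)) \<in> cubing (shift (k - m0) x') v"
      by (simp only: cubing_shift v')
    then show "shift (k - m0) x' m = x m" by (simp add: mem_cubing)
  qed
qed

section \<open>Cubings and suspensions\<close>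

text \<open>Basic neighbourhoods in the product of discrete spaces fix finitely many
  coordinates.\<close>

lemma openin_config_iff:
  "openin (config_topology A) U \<longleftrightarrow> U \<subseteq> {x. range x \<subseteq> A} \<and>
    (\<forall>x\<in>U. \<exists>F. finite F \<and> (\<forall>x'. range x' \<subseteq> A \<longrightarrow> (\<forall>m\<in>F. x' m = x m) \<longrightarrow> x' \<in> U))"
proof
  assume U: "openin (config_topology A) U"
  show "U \<subseteq> {x. range x \<subseteq> A} \<and>
    (\<forall>x\<in>U. \<exists>F. finite F \<and> (\<forall>x'. range x' \<subseteq> A \<longrightarrow> (\<forall>m\<in>F. x' m = x m) \<longrightarrow> x' \<in> U))"
  proof (intro conjI ballI)
    show "U \<subseteq> {x. range x \<subseteq> A}"
      using openin_subset[OF U] by (auto simp: config_topology_def PiE_iff)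
    fix x assume "x \<in> U"
    then obtain V where V: "finite {i. V i \<noteq> A}" "\<And>i. V i \<subseteq> A" "\<And>i. x i \<in> V i" "Pi\<^sub>E UNIV V \<subseteq> U"
      using U unfolding config_topology_def openin_product_topology_alt by (auto simp: PiE_iff)
    have "x' \<in> U" if x': "range x' \<subseteq> A" "\<forall>m\<in>{i. V i \<noteq> A}. x' m = x m" for x'
    proof -
      have "x' i \<in> V i" for i
        using x' V(3)[of i] by (cases "V i = A") auto
      then show ?thesis using V(4) by auto
    qed
    then show "\<exists>F. finite F \<and> (\<forall>x'. range x' \<subseteq> A \<longrightarrow> (\<forall>m\<in>F. x' m = x m) \<longrightarrow> x' \<in> U)"
      using V(1) by blast
  qed
next
  assume *: "U \<subseteq> {x. range x \<subseteq> A} \<and>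
    (\<forall>x\<in>U. \<exists>F. finite F \<and> (\<forall>x'. range x' \<subseteq> A \<longrightarrow> (\<forall>m\<in>F. x' m = x m) \<longrightarrow> x' \<in> U))"
  show "openin (config_topology A) U"
    unfolding config_topology_def openin_product_topology_alt
  proof
    fix x assume x: "x \<in> U"
    then obtain F where F: "finite F" "\<And>x'. range x' \<subseteq> A \<Longrightarrow> (\<And>m. m \<in> F \<Longrightarrow> x' m = x m) \<Longrightarrow> x' \<in> U"
      using * by metis
    define V where "V i = (if i \<in> F then {x i} else A)" for i
    have xA: "x i \<in> A" for i using x * by auto
    show "\<exists>V. finite {i \<in> UNIV. V i \<noteq> topspace (discrete_topology A)} \<and>
        (\<forall>i\<in>UNIV. openin (discrete_topology A) (V i)) \<and> x \<in> Pi\<^sub>E UNIV V \<and> Pi\<^sub>E UNIV V \<subseteq> U"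
    proof (intro exI[of _ V] conjI ballI)
      have "{i \<in> UNIV. V i \<noteq> topspace (discrete_topology A)} \<subseteq> F"
        by (auto simp: V_def)
      then show "finite {i \<in> UNIV. V i \<noteq> topspace (discrete_topology A)}"
        using F(1) by (rule finite_subset)
      show "openin (discrete_topology A) (V i)" for i using xA by (simp add: V_def)
      show "x \<in> Pi\<^sub>E UNIV V" using xA by (auto simp: PiE_iff V_def)
      show "Pi\<^sub>E UNIV V \<subseteq> U"
      proof
        fix x' assume "x' \<in> Pi\<^sub>E UNIV V"
        then have x': "x' i \<in> V i" for i by auto
        show "x' \<in> U"
        proof (rule F(2))
          show "range x' \<subseteq> A" using x' xA by (force simp: V_def split: if_splits)
          show "x' m = x m" if "m \<in> F" for m using x'[of m] that by (simp add: V_def)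
        qed
      qed
    qed
  qed
qed

lemma ex_real_vec_bound: "finite F \<Longrightarrow> \<exists>M. \<forall>m\<in>F. norm (real_vec m) \<le> M"
proof (intro exI ballI)
  fix m assume "finite F" "m \<in> F"
  then show "norm (real_vec m) \<le> (\<Sum>m\<in>F. norm (real_vec m))"
    by (intro member_le_sum) auto
qed

text \<open>One parameter \<open>M\<close> measures closeness in both factors, like the single
  \<epsilon> of the tiling topology.\<close>

lemma openin_config_times_iff:
  fixes X :: "(int ^ 'n \<Rightarrow> 'm) set"
  assumes X: "X \<subseteq> {x. range x \<subseteq> A}"
  shows "openin (prod_topology (subtopology (config_topology A) X) euclidean) W \<longleftrightarrow> W \<subseteq> X \<times> UNIV \<and>
    (\<forall>x v. (x, v) \<in> W \<longrightarrow> (\<exists>M>0. \<forall>x'\<in>X. \<forall>v' :: real ^ 'n.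
      (\<forall>m. norm (real_vec m) \<le> M \<longrightarrow> x' m = x m) \<longrightarrow> norm (v' - v) < 1/M \<longrightarrow> (x', v') \<in> W))"
    (is "?open \<longleftrightarrow> W \<subseteq> X \<times> UNIV \<and> ?near")
proof
  assume W: ?open
  have "W \<subseteq> X \<times> UNIV"
    using openin_subset[OF W] by auto
  moreover have ?near
  proof (intro allI impI)
    fix x v assume "(x, v) \<in> W"
    then obtain U V where UV: "openin (subtopology (config_topology A) X) U" "open V" "x \<in> U" "v \<in> V" "U \<times> V \<subseteq> W"
      using W unfolding openin_prod_topology_alt by (metis open_openin)
    then obtain U0 where U0: "openin (config_topology A) U0" "U = U0 \<inter> X"
      unfolding openin_subtopology by blast
    then have "x \<in> U0" using UV(3) by blast
    then obtain F where F: "finite F" "\<And>x'. range x' \<subseteq> A \<Longrightarrow> (\<And>m. m \<in> F \<Longrightarrow> x' m = x m) \<Longrightarrow> x' \<in> U0"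
      using U0(1) unfolding openin_config_iff by metis
    obtain M0 where M0: "\<And>m. m \<in> F \<Longrightarrow> norm (real_vec m) \<le> M0" using ex_real_vec_bound[OF F(1)] by blast
    obtain e where e: "e > 0" "\<And>v'. dist v' v < e \<Longrightarrow> v' \<in> V" using UV(2,4) unfolding open_dist by blast
    define M where "M = max (max 1 M0) (1/e)"
    have M: "M > 0" "M0 \<le> M" "1/M \<le> e"
    proof -
      show M0: "M > 0" "M0 \<le> M" by (auto simp: M_def)
      have "1/e \<le> M" by (simp add: M_def)
      then show "1/M \<le> e" using M0(1) e(1) by (simp add: field_simps)
    qed
    show "\<exists>M>0. \<forall>x'\<in>X. \<forall>v'. (\<forall>m. norm (real_vec m) \<le> M \<longrightarrow> x' m = x m) \<longrightarrow> norm (v' - v) < 1/M \<longrightarrow> (x', v') \<in> W"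
    proof (intro exI[of _ M] conjI ballI allI impI)
      fix x' v' assume x': "x' \<in> X" and eq: "\<forall>m. norm (real_vec m) \<le> M \<longrightarrow> x' m = x m" and v': "norm (v' - v) < 1/M"
      have "x' m = x m" if "m \<in> F" for m using eq M0[OF that] M(2) by simp
      then have "x' \<in> U0" using x' X by (intro F(2)) auto
      moreover have "v' \<in> V" using v' M(3) by (intro e(2)) (simp add: dist_norm)
      ultimately show "(x', v') \<in> W" using UV(5) U0(2) x' by blast
    qed (rule M(1))
  qed
  ultimately show "W \<subseteq> X \<times> UNIV \<and> ?near" ..
next
  assume "W \<subseteq> X \<times> UNIV \<and> ?near"
  then have sub: "W \<subseteq> X \<times> UNIV" and near: ?near by blast+
  show ?open
    unfolding openin_prod_topology_alt
  proof (intro allI impI)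
    fix x v assume xv: "(x, v) \<in> W"
    then obtain M where M: "M > 0" "\<And>x' v'. x' \<in> X \<Longrightarrow> (\<And>m. norm (real_vec m) \<le> M \<Longrightarrow> x' m = x m) \<Longrightarrow>
        norm (v' - v) < 1/M \<Longrightarrow> (x', v') \<in> W"
      using near by metis
    let ?U0 = "{x'. range x' \<subseteq> A \<and> (\<forall>m. norm (real_vec m) \<le> M \<longrightarrow> x' m = x m)}"
    have "openin (config_topology A) ?U0"
      unfolding openin_config_iff
      using finite_bounded_real_vec[of M, where 'n = 'n]
      by (intro conjI ballI exI[of _ "{m. norm (real_vec m) \<le> M}"]) auto
    then have "openin (subtopology (config_topology A) X) (?U0 \<inter> X)"
      unfolding openin_subtopology by blast
    moreover have "openin euclidean (ball v (1/M))" by simp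
    moreover have "x \<in> ?U0 \<inter> X" using xv sub X by auto
    moreover have "v \<in> ball v (1/M)" using M(1) by simp
    moreover have "(?U0 \<inter> X) \<times> ball v (1/M) \<subseteq> W"
      using M(2) by (auto simp: dist_norm norm_minus_commute)
    ultimately show "\<exists>U V. openin (subtopology (config_topology A) X) U \<and> openin euclidean V \<and> x \<in> U \<and> v \<in> V \<and> U \<times> V \<subseteq> W"
      by blast
  qed
qed

locale cube_tiling_space =
  fixes A :: "'m set" and S :: "(real ^ 'n, 'm) tile set set"
  assumes finite_A: "finite A"
    and S: "tiling_space (cube_tile ` A) S"
    and S_cubing: "T \<in> S \<Longrightarrow> \<exists>x v. T = cubing x v"
begin

lemma S_tilings: "S \<subseteq> tilings (cube_tile ` A)"
  by (rule tiling_space_subset[OF S])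

lemma S_closed: "closedin (tiling_topology (cube_tile ` A)) S"
  using S by (simp add: tiling_space_def)

definition X :: "(int ^ 'n \<Rightarrow> 'm) set" where
  "X = {x. cubing x 0 \<in> S}"

lemma cubing_S_iff: "cubing x v \<in> S \<longleftrightarrow> x \<in> X"
proof -
  have "translate w T \<in> S" if "T \<in> S" for w T
    using S that by (simp add: tiling_space_def)
  from this[of "cubing x v" v] this[of "cubing x 0" "- v"] show ?thesis
    by (auto simp: X_def translate_cubing)
qed

lemma X_range: "X \<subseteq> {x. range x \<subseteq> A}"
  unfolding X_def using cubing_tilingsD S_tilings by blast

lemma shift_X: "x \<in> X \<Longrightarrow> shift n x \<in> X"
  by (metis cubing_S_iff cubing_shift)

lemma subshift_X: "subshift A X"
  unfolding subshift_def
proof (intro conjI ballI allI)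
  show "finite A" by (rule finite_A)
  obtain T where "T \<in> S" using S by (auto simp: tiling_space_def)
  then show "X \<noteq> {}" using S_cubing cubing_S_iff by blast
  show "shift n x \<in> X" if "x \<in> X" for n x using that by (rule shift_X)
  have top: "topspace (config_topology A) = {x :: int ^ 'n \<Rightarrow> 'm. range x \<subseteq> A}"
    by (auto simp: config_topology_def PiE_iff)
  have "openin (config_topology A) ({x. range x \<subseteq> A} - X)"
    unfolding openin_config_iff
  proof (intro conjI ballI)
    fix x assume x: "x \<in> {x. range x \<subseteq> A} - X"
    then have "cubing x 0 \<in> tilings (cube_tile ` A)" "cubing x 0 \<notin> S"
      by (auto simp: cubing_S_iff intro: cubing_tilings)
    then obtain e where e: "e > 0" "\<And>T. T \<in> S \<Longrightarrow> \<not> tilings_within e (cubing x 0) T"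
      using closedin_tilingsD[OF S_closed] by blast
    let ?F = "{m :: int ^ 'n. norm (real_vec m) \<le> 1/e + norm (0 :: real ^ 'n) + norm (One :: real ^ 'n)}"
    show "\<exists>F. finite F \<and> (\<forall>x'. range x' \<subseteq> A \<longrightarrow> (\<forall>m\<in>F. x' m = x m) \<longrightarrow> x' \<in> {x. range x \<subseteq> A} - X)"
    proof (intro exI[of _ ?F] conjI allI impI)
      fix x' assume x': "range x' \<subseteq> A" "\<forall>m\<in>?F. x' m = x m"
      have "agree (1/e) (cubing x 0) (cubing x' 0)"
        by (rule agree_cubing) (use x'(2) in simp)
      then have "cubing x' 0 \<notin> S" using agree_imp_within e by blast
      then show "x' \<in> {x. range x \<subseteq> A} - X" using x'(1) by (simp add: cubing_S_iff)
    qed (rule finite_bounded_real_vec)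
  qed auto
  then show "closedin (config_topology A) X"
    unfolding closedin_def top using X_range by blast
qed

lemma class_eq:
  assumes "x \<in> X"
  shows "suspension_rel X `` {(x, v)} = {(x', v'). x' \<in> X \<and> cubing x' v' = cubing x v}"
proof -
  have "((x, v), (x', v')) \<in> suspension_rel X \<longleftrightarrow> x' \<in> X \<and> cubing x' v' = cubing x v" for x' v'
  proof
    assume "((x, v), (x', v')) \<in> suspension_rel X"
    then obtain n where "x' \<in> X" "x = shift n x'" "v' = v + real_vec n"
      by (auto simp: suspension_rel_def real_vec_def)
    then show "x' \<in> X \<and> cubing x' v' = cubing x v" by (simp add: cubing_shift)
  next
    assume *: "x' \<in> X \<and> cubing x' v' = cubing x v"
    have ag: "agree 0 (cubing x v) (cubing x' v')" by (simp add: *)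
    obtain n where n: "v' = v + real_vec n" using cubing_of_agree[OF ag] by auto
    have "cubing (shift n x') v = cubing x v" using * by (simp add: cubing_shift n)
    then have "x m = shift n x' m" for m using mem_cubing by metis
    then have "x = shift n x'" by blast
    then show "((x, v), (x', v')) \<in> suspension_rel X"
      using * n by (auto simp: suspension_rel_def real_vec_def)
  qed
  then show ?thesis by auto
qed

text \<open>The classes of the suspension are exactly the sets of all presentations of one cubing,
  so this map identifies \<open>S\<close> with the quotient.\<close>

definition fiber :: "(real ^ 'n, 'm) tile set \<Rightarrow> ((int ^ 'n \<Rightarrow> 'm) \<times> (real ^ 'n)) set" where
  "fiber T = {(x, v). x \<in> X \<and> cubing x v = T}"

lemma quotient_eq: "(X \<times> UNIV) // suspension_rel X = fiber ` S"
proof -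
  have "C \<in> fiber ` S" if "C \<in> (X \<times> UNIV) // suspension_rel X" for C
  proof -
    obtain x v where "x \<in> X" "C = suspension_rel X `` {(x, v)}"
      using \<open>C \<in> _\<close> by (auto elim!: quotientE)
    then have "C = fiber (cubing x v)" "cubing x v \<in> S"
      by (auto simp: fiber_def class_eq cubing_S_iff)
    then show ?thesis by blast
  qed
  moreover have "fiber T \<in> (X \<times> UNIV) // suspension_rel X" if TS: "T \<in> S" for T
  proof -
    obtain x v where T: "T = cubing x v" using S_cubing[OF TS] by blast
    then have x: "x \<in> X" using TS by (simp add: cubing_S_iff)
    then have "fiber T = suspension_rel X `` {(x, v)}"
      by (simp add: fiber_def class_eq T)
    then show ?thesis using x by (simp add: quotientI)
  qed
  ultimately show ?thesis by blast
qed

lemma Union_fiber: "W \<subseteq> S \<Longrightarrow> \<Union>(fiber ` W) = {(x, v). cubing x v \<in> W}"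
  by (auto simp: fiber_def) (metis cubing_S_iff subsetD)

lemma inj_fiber: "inj_on fiber S"
proof (rule inj_onI)
  fix T T' assume T: "T \<in> S" "T' \<in> S" "fiber T = fiber T'"
  obtain x v where xv: "T = cubing x v" using S_cubing[OF T(1)] by blast
  then have "(x, v) \<in> fiber T" using T(1) by (simp add: fiber_def cubing_S_iff)
  then have "(x, v) \<in> fiber T'" by (simp only: T(3))
  then show "T = T'" using xv by (simp add: fiber_def)
qed

lemma openin_suspension_iff: "openin (suspension A X) U \<longleftrightarrow> (\<exists>W\<subseteq>S. U = fiber ` W \<and>
    openin (prod_topology (subtopology (config_topology A) X) euclidean) {(x, v). cubing x v \<in> W})"
  unfolding openin_suspension[OF subshift_X] suspension_open_def quotient_eq subset_image_iff
  by (metis Union_fiber)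

lemma topspace_suspension: "topspace (suspension A X) = fiber ` S"
proof (rule subset_antisym)
  show "topspace (suspension A X) \<subseteq> fiber ` S"
    using openin_topspace[of "suspension A X"] unfolding openin_suspension_iff by blast
  have "{(x, v). cubing x v \<in> S} = X \<times> UNIV" by (auto simp: cubing_S_iff)
  then have "openin (suspension A X) (fiber ` S)"
    unfolding openin_suspension_iff using X_range
    by (intro exI[of _ S]) (simp, subst openin_config_times_iff, auto intro!: exI[of _ 1])
  then show "fiber ` S \<subseteq> topspace (suspension A X)" by (rule openin_subset)
qed

text \<open>The presentation \<open>(x', v')\<close> of a nearby cubing can be far from
  \<open>(x, v)\<close>; an integral shift within its class brings it close.\<close>

lemma within_cubing:
  assumes x: "x \<in> X" and "x' \<in> X" and e: "e > 0" and w: "tilings_within e (cubing x v) (cubing x' v')"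
  obtains x'' v'' where "x'' \<in> X" "cubing x' v' = cubing x'' v''" "norm (v'' - v) \<le> 2 * e"
    "\<And>m. norm (real_vec m) + norm v + e \<le> 1/e \<Longrightarrow> x'' m = x m"
proof -
  obtain u u' where u: "norm u \<le> e" "norm u' \<le> e"
    and ag: "agree (1/e) (cubing x (v - u)) (cubing x' (v' - u'))"
    using w by (auto simp: tilings_within_agree translate_cubing)
  obtain n where n: "v' - u' = v - u + real_vec n"
    "\<And>m. norm (real_vec m - (v - u)) \<le> 1/e \<Longrightarrow> shift n x' m = x m"
    using cubing_of_agree[OF ag] e by auto
  show thesis
  proof (rule that)
    show "shift n x' \<in> X" using assms(2) by (rule shift_X)
    have "v' = v + (u' - u) + real_vec n" using n(1) by (simp add: algebra_simps)
    then show "cubing x' v' = cubing (shift n x') (v + (u' - u))" by (simp add: cubing_shift)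
    show "norm (v + (u' - u) - v) \<le> 2 * e"
      using u norm_triangle_ineq4[of u' u] by simp
    fix m :: "int ^ 'n" assume "norm (real_vec m) + norm v + e \<le> 1/e"
    then show "shift n x' m = x m"
      using u(1) norm_triangle_ineq4[of "real_vec m" "v - u"] norm_triangle_ineq4[of v u]
      by (intro n(2)) linarith
  qed
qed

lemma homeomorphic_suspension:
  "subtopology (tiling_topology (cube_tile ` A)) S homeomorphic_space suspension A X"
proof -
  let ?S = "subtopology (tiling_topology (cube_tile ` A)) S"
  have topS: "topspace ?S = S" using S_tilings by (auto simp: topspace_tiling_topology)
  have "homeomorphic_map ?S (suspension A X) fiber"
  proof (rule bijective_open_imp_homeomorphic_map)
    show "continuous_map ?S (suspension A X) fiber"
    proof (rule continuous_map_tilings[OF S_closed])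
      show "fiber ` S \<subseteq> topspace (suspension A X)" by (simp add: topspace_suspension)
      fix T U assume T: "T \<in> S" and U: "openin (suspension A X) U" "fiber T \<in> U"
      obtain x v where xv: "T = cubing x v" using S_cubing[OF T] by blast
      have x: "x \<in> X" using T by (simp add: xv cubing_S_iff)
      obtain W where W: "W \<subseteq> S" "U = fiber ` W"
        "openin (prod_topology (subtopology (config_topology A) X) euclidean) {(x, v). cubing x v \<in> W}"
        using U(1) unfolding openin_suspension_iff by blast
      have "T \<in> W" using U(2) T W(1,2) inj_fiber by (metis inj_on_image_mem_iff)
      then obtain M where M: "M > 0" "\<And>x' v'. x' \<in> X \<Longrightarrow> (\<And>m. norm (real_vec m) \<le> M \<Longrightarrow> x' m = x m) \<Longrightarrow>
          norm (v' - v) < 1/M \<Longrightarrow> cubing x' v' \<in> W"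
        using W(3) unfolding openin_config_times_iff[OF X_range] xv by (auto dest!: spec[of _ x] spec[of _ v])
      \<comment> \<open>\<open>3 * M\<close> makes the displacement bound \<open>2/L\<close> smaller
        than \<open>1/M\<close>; the other term keeps all marks of norm at most \<open>M\<close>
        inside the ball of agreement.\<close>
      define L where "L = max (3 * M) (M + norm v + 1)"
      have L: "3 * M \<le> L" "M + norm v + 1 \<le> L" by (simp_all only: L_def max.cobounded1 max.cobounded2)
      then have L': "L > 0" "L \<ge> 1" using M(1) norm_ge_zero[of v] by linarith+
      have "fiber T' \<in> U" if T': "T' \<in> S" "tilings_within (1/L) T T'" for T'
      proof -
        obtain x' v' where xv': "T' = cubing x' v'" using S_cubing[OF T'(1)] by blast
        have x': "x' \<in> X" using T'(1) by (simp add: xv' cubing_S_iff)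
        have w: "tilings_within (1/L) (cubing x v) (cubing x' v')" using T'(2) by (simp add: xv xv')
        have L1: "1/L > 0" "1/L \<le> 1" using L' by (simp_all add: divide_simps)
        obtain x'' v'' where 2: "x'' \<in> X" "cubing x' v' = cubing x'' v''" "norm (v'' - v) \<le> 2 * (1/L)"
          "\<And>m. norm (real_vec m) + norm v + 1/L \<le> 1/(1/L) \<Longrightarrow> x'' m = x m"
          using within_cubing[OF x x' L1(1) w] by metis
        have "cubing x'' v'' \<in> W"
        proof (rule M(2)[OF 2(1)])
          show "x'' m = x m" if "norm (real_vec m) \<le> M" for m
            using that L(2) L1(2) by (intro 2(4)) simp
          have "2 * (1/L) < 1/M" using L(1) L'(1) M(1) by (simp add: field_simps)
          then show "norm (v'' - v) < 1/M" using 2(3) by simp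
        qed
        then show ?thesis using W(2) 2(2) xv' by simp
      qed
      then show "\<exists>e>0. \<forall>T'\<in>S. tilings_within e T T' \<longrightarrow> fiber T' \<in> U"
        using L'(1) by (intro exI[of _ "1/L"]) simp
    qed
    show "open_map ?S (suspension A X) fiber"
      unfolding open_map_def
    proof (intro allI impI)
      fix W assume W: "openin ?S W"
      then obtain W0 where W0: "tiling_open (cube_tile ` A) W0" "W = W0 \<inter> S"
        unfolding openin_subtopology openin_tiling_topology by blast
      have "openin (prod_topology (subtopology (config_topology A) X) euclidean) {(x, v). cubing x v \<in> W}"
        unfolding openin_config_times_iff[OF X_range]
      proof (intro conjI allI impI)
        show "{(x, v). cubing x v \<in> W} \<subseteq> X \<times> UNIV"
          using W0(2) by (auto simp: cubing_S_iff)
        fix x v assume "(x, v) \<in> {(x, v). cubing x v \<in> W}"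
        then have "cubing x v \<in> W0" using W0(2) by simp
        then obtain e where e: "e > 0" "\<And>T'. T' \<in> tilings (cube_tile ` A) \<Longrightarrow> tilings_within e (cubing x v) T' \<Longrightarrow> T' \<in> W0"
          using W0(1) unfolding tiling_open_def by metis
        \<comment> \<open>Marks fixed up to \<open>M\<close> make the cubings with offset
          \<open>v\<close> agree on the ball of radius \<open>1/e\<close>; the change from
          \<open>v\<close> to \<open>v'\<close> is then one admissible small translation.\<close>
        define M where "M = 1/e + norm v + norm (One :: real ^ 'n)"
        have M: "M > 0" "1/M \<le> e"
        proof -
          have "1/e \<le> M" "1/e > 0" using e(1) by (simp_all add: M_def)
          then show "M > 0" by linarith
          then show "1/M \<le> e" using e(1) \<open>1/e \<le> M\<close> by (simp add: field_simps)
        qed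
        have "(x', v') \<in> {(x, v). cubing x v \<in> W}"
          if x': "x' \<in> X" "\<forall>m. norm (real_vec m) \<le> M \<longrightarrow> x' m = x m" "norm (v' - v) < 1/M" for x' v'
        proof -
          have "agree (1/e) (cubing x v) (cubing x' v)"
            by (rule agree_cubing) (use x'(2) in \<open>simp add: M_def\<close>)
          then have "tilings_within e (cubing x v) (cubing x' v')"
            unfolding tilings_within_agree using x'(3) M(2) e(1)
            by (intro exI[of _ 0] exI[of _ "v' - v"]) (simp add: translate_cubing)
          moreover have "cubing x' v' \<in> S" using x'(1) by (simp add: cubing_S_iff)
          ultimately show ?thesis using e(2) S_tilings W0(2) by blast
        qed
        then show "\<exists>M>0. \<forall>x'\<in>X. \<forall>v'. (\<forall>m. norm (real_vec m) \<le> M \<longrightarrow> x' m = x m) \<longrightarrow>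
            norm (v' - v) < 1/M \<longrightarrow> (x', v') \<in> {(x, v). cubing x v \<in> W}"
          using M(1) by blast
      qed
      then show "openin (suspension A X) (fiber ` W)"
        unfolding openin_suspension_iff using W0(2) by blast
    qed
  qed (simp_all only: topS topspace_suspension inj_fiber)
  then show ?thesis by (rule homeomorphic_map_imp_homeomorphic_space)
qed

end

section \<open>Additive maps that are integral on given vectors\<close>

text \<open>A rational basis of the span of \<open>E\<close> is moved to nearby rational numbers.\<close>

lemma ex_additive_rational:
  fixes E :: "real set"
  assumes E: "finite E" and e: "\<epsilon> > 0"
  obtains \<psi> :: "real \<Rightarrow> real" where "\<And>x y. \<psi> (x + y) = \<psi> x + \<psi> y"
    "\<And>x. x \<in> E \<Longrightarrow> \<psi> x \<in> \<rat>" "\<And>x. x \<in> E \<Longrightarrow> \<bar>\<psi> x - x\<bar> \<le> \<epsilon>"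
proof -
  \<comment> \<open>The reals as a vector space over the rationals.\<close>
  define sc where "sc = (\<lambda>(q :: rat) (x :: real). of_rat q * x)"
  interpret Q: vector_space sc
    by unfold_locales (auto simp: sc_def algebra_simps of_rat_add of_rat_mult)
  interpret QQ: vector_space_pair sc sc ..
  obtain B where B: "B \<subseteq> E" "Q.independent B" "E \<subseteq> Q.span B"
    using Q.maximal_independent_subset by blast
  have finB: "finite B" using B(1) E by (rule finite_subset)
  have "\<exists>q. x = (\<Sum>b\<in>B. sc (q b) b)" if "x \<in> E" for x
    using subsetD[OF B(3) that] unfolding Q.span_finite[OF finB] by auto
  then obtain q where q: "\<And>x. x \<in> E \<Longrightarrow> x = (\<Sum>b\<in>B. sc (q x b) b)" by metis
  \<comment> \<open>Bounds the absolute sum of rational coordinates of every element of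
    \<open>E\<close>, so that an error \<open>\<epsilon> / C\<close> on each basis vector adds up to
    at most \<epsilon>.\<close>
  define C where "C = 1 + (\<Sum>x\<in>E. \<Sum>b\<in>B. \<bar>real_of_rat (q x b)\<bar>)"
  have nonneg: "0 \<le> (\<Sum>b\<in>B. \<bar>real_of_rat (q x b)\<bar>)" for x by (intro sum_nonneg) auto
  have C: "C > 0" "x \<in> E \<Longrightarrow> (\<Sum>b\<in>B. \<bar>real_of_rat (q x b)\<bar>) \<le> C" for x
  proof -
    have "0 \<le> (\<Sum>x\<in>E. \<Sum>b\<in>B. \<bar>real_of_rat (q x b)\<bar>)" by (intro sum_nonneg nonneg)
    then show "C > 0" by (simp add: C_def)
    assume "x \<in> E"
    then have "(\<Sum>b\<in>B. \<bar>real_of_rat (q x b)\<bar>) \<le> (\<Sum>x\<in>E. \<Sum>b\<in>B. \<bar>real_of_rat (q x b)\<bar>)"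
      using E nonneg by (intro member_le_sum) auto
    then show "(\<Sum>b\<in>B. \<bar>real_of_rat (q x b)\<bar>) \<le> C" by (simp add: C_def)
  qed
  have "\<exists>r\<in>\<rat>. \<bar>r - b\<bar> \<le> \<epsilon> / C" for b
  proof -
    have "b < b + \<epsilon> / C" using e C(1) by simp
    from Rats_dense_in_real[OF this] obtain r where "r \<in> \<rat>" "b < r" "r < b + \<epsilon> / C" by blast
    then show ?thesis by (intro bexI[of _ r]) auto
  qed
  then obtain r where r: "\<And>b. r b \<in> \<rat>" "\<And>b. \<bar>r b - b\<bar> \<le> \<epsilon> / C" by metis
  define \<psi> where "\<psi> = QQ.construct B r"
  interpret \<psi>: Vector_Spaces.linear sc sc \<psi>
    unfolding \<psi>_def by (rule QQ.linear_construct[OF B(2)])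
  have on_E: "\<psi> x = (\<Sum>b\<in>B. of_rat (q x b) * r b)" if "x \<in> E" for x
  proof -
    have "\<psi> x = \<psi> (\<Sum>b\<in>B. sc (q x b) b)" using q[OF that] by simp
    also have "\<dots> = (\<Sum>b\<in>B. sc (q x b) (\<psi> b))" by (simp add: \<psi>.sum \<psi>.scale)
    also have "\<dots> = (\<Sum>b\<in>B. of_rat (q x b) * r b)"
    proof (intro sum.cong refl)
      fix b assume "b \<in> B"
      then have "\<psi> b = r b" unfolding \<psi>_def by (rule QQ.construct_basis[OF B(2)])
      then show "sc (q x b) (\<psi> b) = of_rat (q x b) * r b" by (simp add: sc_def)
    qed
    finally show ?thesis .
  qed
  show thesis
  proof (rule that)
    show "\<psi> (x + y) = \<psi> x + \<psi> y" for x y by (rule \<psi>.add)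
    show "\<psi> x \<in> \<rat>" if "x \<in> E" for x
      unfolding on_E[OF that] by (intro Rats_sum Rats_mult r(1)) simp
    show "\<bar>\<psi> x - x\<bar> \<le> \<epsilon>" if x: "x \<in> E" for x
    proof -
      have "\<psi> x - x = (\<Sum>b\<in>B. of_rat (q x b) * (r b - b))"
        using on_E[OF x] q[OF x] by (simp add: sc_def sum_subtractf right_diff_distrib)
      also have "\<bar>\<dots>\<bar> \<le> (\<Sum>b\<in>B. \<bar>of_rat (q x b)\<bar> * (\<epsilon> / C))"
        unfolding abs_mult[symmetric] using r(2)
        by (intro order_trans[OF sum_abs] sum_mono) (unfold abs_mult, rule mult_left_mono, auto)
      also have "\<dots> = (\<Sum>b\<in>B. \<bar>of_rat (q x b)\<bar>) * (\<epsilon> / C)" by (rule sum_distrib_right[symmetric])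
      also have "\<dots> \<le> C * (\<epsilon> / C)" using C(2)[OF x] e C(1) by (intro mult_right_mono) auto
      finally show ?thesis using C(1) by simp
    qed
  qed
qed

lemma ex_common_denominator:
  assumes "finite E" "E \<subseteq> \<rat>"
  shows "\<exists>n::nat. n > 0 \<and> (\<forall>x\<in>E. real n * x \<in> \<int>)"
  using assms
proof (induction E rule: finite_induct)
  case (insert x E)
  then obtain n where n: "n > 0" "\<And>y. y \<in> E \<Longrightarrow> real n * y \<in> \<int>" by auto
  obtain a b where ab: "b > 0" "x = real_of_int a / real b"
    using insert.prems unfolding Rats_eq_int_div_nat by auto
  have "real (n * b) * y \<in> \<int>" if "y \<in> insert x E" for y
  proof (cases "y = x")
    case True
    have "real b * x = real_of_int a" using ab by simp
    then have "real (n * b) * y = real n * real_of_int a" by (simp add: True mult.assoc)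
    then show ?thesis by (simp only: Ints_mult Ints_of_nat Ints_of_int)
  next
    case False
    then have "real n * y \<in> \<int>" using n(2) that by blast
    then have "real b * (real n * y) \<in> \<int>" by (simp only: Ints_mult Ints_of_nat)
    then show ?thesis by (simp add: ac_simps)
  qed
  then show ?case using n(1) ab(1) by (intro exI[of _ "n * b"]) auto
qed (auto intro: exI[of _ 1])

text \<open>A rational perturbation is applied to each coordinate and multiplied by a common
  denominator, which becomes \<open>N\<close>. The relative error \<epsilon> is fixed before
  \<open>N\<close>, whose size is beyond control.\<close>

lemma ex_additive_integral:
  fixes D :: "(real ^ 'n) set"
  assumes D: "finite D" and e: "\<epsilon> > 0"
  obtains \<phi> :: "real ^ 'n \<Rightarrow> real ^ 'n" and N :: real where
    "N > 0" "\<And>x y. \<phi> (x + y) = \<phi> x + \<phi> y"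
    "\<And>d. d \<in> D \<Longrightarrow> \<phi> d \<in> range real_vec" "\<And>d. d \<in> D \<Longrightarrow> norm (\<phi> d - N *\<^sub>R d) \<le> N * \<epsilon>"
proof -
  define E where "E = (\<lambda>(d, i). d $ i) ` (D \<times> (UNIV :: 'n set))"
  have E: "finite E" "\<And>d i. d \<in> D \<Longrightarrow> d $ i \<in> E" using D by (auto simp: E_def)
  \<comment> \<open>The Euclidean norm is estimated by the sum of the coordinate errors.\<close>
  have e': "\<epsilon> / CARD('n) > 0" using e by simp
  obtain \<psi> where \<psi>: "\<And>x y. \<psi> (x + y) = \<psi> x + \<psi> y" "\<And>x. x \<in> E \<Longrightarrow> \<psi> x \<in> \<rat>"
    "\<And>x. x \<in> E \<Longrightarrow> \<bar>\<psi> x - x\<bar> \<le> \<epsilon> / CARD('n)"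
    using ex_additive_rational[OF E(1) e'] by metis
  obtain n :: nat where n: "n > 0" "\<And>x. x \<in> E \<Longrightarrow> real n * \<psi> x \<in> \<int>"
    using ex_common_denominator[of "\<psi> ` E"] E(1) \<psi>(2) by blast
  define \<phi> where "\<phi> x = (\<chi> i. real n * \<psi> (x $ i))" for x :: "real ^ 'n"
  show thesis
  proof (rule that[of "real n" \<phi>])
    show "real n > 0" using n(1) by simp
    show "\<phi> (x + y) = \<phi> x + \<phi> y" for x y by (simp add: \<phi>_def vec_eq_iff \<psi>(1) distrib_left)
    show "\<phi> d \<in> range real_vec" if "d \<in> D" for d
    proof -
      have "\<forall>i. \<exists>k. real n * \<psi> (d $ i) = real_of_int k"
        using n(2)[OF E(2)[OF that]] by (meson Ints_cases)
      then obtain k where "\<And>i. real n * \<psi> (d $ i) = real_of_int (k i)" by metis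
      then have "\<phi> d = real_vec (\<chi> i. k i)" by (simp add: \<phi>_def vec_eq_iff)
      then show ?thesis by blast
    qed
    show "norm (\<phi> d - real n *\<^sub>R d) \<le> real n * \<epsilon>" if "d \<in> D" for d
    proof -
      have "norm (\<phi> d - real n *\<^sub>R d) \<le> (\<Sum>i\<in>UNIV. \<bar>(\<phi> d - real n *\<^sub>R d) $ i\<bar>)"
        by (rule norm_le_l1_cart)
      also have "\<dots> \<le> (\<Sum>i\<in>(UNIV :: 'n set). real n * (\<epsilon> / CARD('n)))"
      proof (rule sum_mono)
        fix i
        have "\<bar>(\<phi> d - real n *\<^sub>R d) $ i\<bar> = real n * \<bar>\<psi> (d $ i) - d $ i\<bar>"
          by (simp add: \<phi>_def abs_mult flip: right_diff_distrib)
        then show "\<bar>(\<phi> d - real n *\<^sub>R d) $ i\<bar> \<le> real n * (\<epsilon> / CARD('n))"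
          using \<psi>(3)[OF E(2)[OF that], of i] by (simp only: mult_left_mono of_nat_0_le_iff)
      qed
      finally show ?thesis by simp
    qed
  qed
qed

section \<open>Weighted averages\<close>

definition average :: "'i set \<Rightarrow> ('i \<Rightarrow> real) \<Rightarrow> ('i \<Rightarrow> 'a::real_normed_vector) \<Rightarrow> 'a" where
  "average I p a = (1 / sum p I) *\<^sub>R (\<Sum>i\<in>I. p i *\<^sub>R a i)"

lemma average_add_const:
  assumes "sum p I \<noteq> 0"
  shows "average I p (\<lambda>i. a i + c) = average I p a + c"
  using assms by (simp add: average_def scaleR_add_right sum.distrib flip: scaleR_sum_left)

lemma average_bound:
  assumes p: "\<And>i. i \<in> I \<Longrightarrow> p i \<ge> 0" "sum p I > 0" and a: "\<And>i. i \<in> I \<Longrightarrow> p i > 0 \<Longrightarrow> norm (a i) \<le> \<eta>"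
  shows "norm (average I p a) \<le> \<eta>"
proof -
  have "norm (\<Sum>i\<in>I. p i *\<^sub>R a i) \<le> (\<Sum>i\<in>I. p i * \<eta>)"
  proof (rule sum_norm_le)
    fix i assume i: "i \<in> I"
    show "norm (p i *\<^sub>R a i) \<le> p i * \<eta>"
      using p(1)[OF i] a[OF i] by (cases "p i = 0") (auto intro: mult_left_mono)
  qed
  also have "\<dots> = sum p I * \<eta>" by (simp add: sum_distrib_right)
  finally show ?thesis using p(2) by (simp add: average_def field_simps)
qed

text \<open>With weight sums \<open>P\<close> and \<open>Q\<close>, \<open>P\<close> times the
  difference equals the sum of the \<open>(p i - q i) *\<^sub>R a i\<close> minus
  \<open>P - Q\<close> times the second average. Each part is at most \<open>M * \<eta> * d\<close>,
  and \<open>P \<ge> 1\<close>.\<close>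

lemma average_lipschitz:
  assumes I: "real (card I) \<le> M" and d: "d \<ge> 0" and \<eta>: "\<eta> \<ge> 0"
    and p: "\<And>i. i \<in> I \<Longrightarrow> p i \<ge> 0" "sum p I \<ge> 1"
    and q: "\<And>i. i \<in> I \<Longrightarrow> q i \<ge> 0" "sum q I \<ge> 1"
    and pq: "\<And>i. i \<in> I \<Longrightarrow> \<bar>p i - q i\<bar> \<le> d"
    and a: "\<And>i. i \<in> I \<Longrightarrow> norm (a i) \<le> \<eta>"
  shows "norm (average I p a - average I q a) \<le> 2 * M * \<eta> * d"
proof -
  define P Q u where "P = sum p I" and "Q = sum q I" and "u = (\<Sum>i\<in>I. q i *\<^sub>R a i)"
  have PQ: "P \<ge> 1" "Q \<ge> 1" using p(2) q(2) by (simp_all add: P_def Q_def)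
  have Md: "real (card I) * d \<le> M * d" using I d by (rule mult_right_mono)
  have "norm ((\<Sum>i\<in>I. p i *\<^sub>R a i) - u) \<le> (\<Sum>i\<in>I. d * \<eta>)"
    unfolding u_def sum_subtractf[symmetric] scaleR_diff_left[symmetric]
  proof (rule sum_norm_le)
    fix i assume "i \<in> I"
    then show "norm ((p i - q i) *\<^sub>R a i) \<le> d * \<eta>"
      using pq a d by (auto intro!: mult_mono)
  qed
  also have "\<dots> = real (card I) * d * \<eta>" by simp
  also have "\<dots> \<le> M * d * \<eta>" using Md \<eta> by (rule mult_right_mono)
  finally have 1: "norm ((\<Sum>i\<in>I. p i *\<^sub>R a i) - u) \<le> M * \<eta> * d" by (simp add: ac_simps)
  have "\<bar>P - Q\<bar> \<le> (\<Sum>i\<in>I. d)"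
    unfolding P_def Q_def sum_subtractf[symmetric] using pq
    by (intro order_trans[OF sum_abs] sum_mono) auto
  then have 2: "\<bar>P - Q\<bar> \<le> M * d" using Md by simp
  have 3: "norm (average I q a) \<le> \<eta>"
    using q a by (intro average_bound) (auto simp: Q_def)
  have "average I p a - average I q a = (1/P) *\<^sub>R (((\<Sum>i\<in>I. p i *\<^sub>R a i) - u) - (P - Q) *\<^sub>R average I q a)"
  proof -
    have "u = Q *\<^sub>R average I q a" using PQ by (simp add: average_def Q_def u_def)
    then show ?thesis using PQ by (simp add: average_def[of I p] P_def[symmetric] algebra_simps)
  qed
  then have "norm (average I p a - average I q a) \<le> norm (((\<Sum>i\<in>I. p i *\<^sub>R a i) - u) - (P - Q) *\<^sub>R average I q a)"
    using PQ(1) norm_ge_zero[of "((\<Sum>i\<in>I. p i *\<^sub>R a i) - u) - (P - Q) *\<^sub>R average I q a"]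
    by (simp add: divide_le_eq mult_left_mono[of 1 P, simplified] mult_le_cancel_left1)
  also have "\<dots> \<le> norm ((\<Sum>i\<in>I. p i *\<^sub>R a i) - u) + norm ((P - Q) *\<^sub>R average I q a)"
    by (rule norm_triangle_ineq4)
  also have "norm ((P - Q) *\<^sub>R average I q a) \<le> M * d * \<eta>"
    unfolding norm_scaleR using 2 3 by (intro mult_mono order_trans[OF abs_ge_zero 2]) auto
  finally show ?thesis using 1 by (simp add: algebra_simps)
qed

lemma average_mono_neutral:
  assumes "finite J" "I \<subseteq> J" "\<And>i. i \<in> J - I \<Longrightarrow> p i = 0"
  shows "average I p a = average J p a"
proof -
  have "sum p I = sum p J" "(\<Sum>i\<in>I. p i *\<^sub>R a i) = (\<Sum>i\<in>J. p i *\<^sub>R a i)"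
    using assms by (auto intro!: sum.mono_neutral_left)
  then show ?thesis by (simp add: average_def)
qed

section \<open>The tiling by marked cubes derived from a tiling\<close>

lemma finite_image_factor:
  assumes "finite (k ` X)" "\<And>x y. x \<in> X \<Longrightarrow> y \<in> X \<Longrightarrow> k x = k y \<Longrightarrow> h x = h y"
  shows "finite (h ` X)"
proof -
  have "h ` X \<subseteq> (\<lambda>z. h (SOME x. x \<in> X \<and> k x = z)) ` (k ` X)"
  proof
    fix w assume "w \<in> h ` X"
    then obtain x where x: "x \<in> X" "w = h x" by blast
    let ?y = "SOME y. y \<in> X \<and> k y = k x"
    have "?y \<in> X \<and> k ?y = k x" by (rule someI[of _ x]) (simp add: x(1))
    then have "h ?y = w" using assms(2) x by blast
    then show "w \<in> (\<lambda>z. h (SOME x. x \<in> X \<and> k x = z)) ` (k ` X)" using x(1) by blast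
  qed
  then show ?thesis using assms(1) finite_surj by blast
qed

lemma range_real_vec_add: "a \<in> range real_vec \<Longrightarrow> b \<in> range real_vec \<Longrightarrow> a + b \<in> range real_vec"
  by (elim rangeE) (simp flip: real_vec_simps(2))

text \<open>Tiles that contribute to the average at a point within 1 of \<open>x\<close> lie within
  \<open>radius + 2\<close> of \<open>x\<close>; their distance from a tile that covers
  \<open>x\<close> stays below \<open>2 * radius + 4\<close>. The product
  \<open>2 * M * \<eta>\<close> is the constant of \<open>average_lipschitz\<close>.\<close>

locale lattice_approximation = protoset Pr
  for Pr :: "(real ^ 'n, 'm) tile set" +
  fixes \<phi> :: "real ^ 'n \<Rightarrow> real ^ 'n" and N \<eta> M :: real
  assumes N: "N > 0" and \<phi>_add: "\<phi> (x + y) = \<phi> x + \<phi> y"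
    and \<phi>_steps: "d \<in> steps \<Longrightarrow> \<phi> d \<in> range real_vec"
    and card_near: "T \<in> tilings Pr \<Longrightarrow> real (card {t \<in> T. norm (pos t - x) \<le> radius + 2}) \<le> M"
    and \<phi>_near: "T \<in> tilings Pr \<Longrightarrow> s \<in> T \<Longrightarrow> t \<in> T \<Longrightarrow> norm (pos t - pos s) \<le> 2 * radius + 4 \<Longrightarrow>
      norm (\<phi> (pos t - pos s) - N *\<^sub>R (pos t - pos s)) \<le> \<eta>"
    and \<eta>: "\<eta> \<ge> 0" "2 * M * \<eta> \<le> N / 3"
begin

text \<open>The deviation of \<phi> from the scaling. It is still additive, and adding
  \<open>N *\<^sub>R x\<close> to its average is the same as averaging
  \<open>\<phi> (pos t) + N *\<^sub>R (x - pos t)\<close>.\<close>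

definition \<psi> :: "real ^ 'n \<Rightarrow> real ^ 'n" where
  "\<psi> x = \<phi> x - N *\<^sub>R x"

text \<open>A tent with Lipschitz constant 1. Its value is at least 1 for every tile that contains
  \<open>x\<close>, which keeps the sum of the weights away from 0.\<close>

definition hat :: "real ^ 'n \<Rightarrow> (real ^ 'n, 'm) tile \<Rightarrow> real" where
  "hat x t = max 0 (radius + 1 - norm (pos t - x))"

definition near :: "(real ^ 'n, 'm) tile set \<Rightarrow> real ^ 'n \<Rightarrow> (real ^ 'n, 'm) tile set" where
  "near T x = {t \<in> T. hat x t > 0}"

definition F :: "(real ^ 'n, 'm) tile set \<Rightarrow> real ^ 'n \<Rightarrow> real ^ 'n" where
  "F T x = N *\<^sub>R x + average (near T x) (hat x) (\<lambda>t. \<psi> (pos t))"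

definition f :: "(real ^ 'n, 'm) tile set \<Rightarrow> real ^ 'n \<Rightarrow> real ^ 'n" where
  "f T x = F T x - F T 0"

text \<open>By \<open>\<phi>_integral\<close> the choice of \<open>t\<close> is immaterial; see
  \<open>V_iff\<close>.\<close>

definition V :: "(real ^ 'n, 'm) tile set \<Rightarrow> (real ^ 'n) set" where
  "V T = {x. \<exists>t\<in>T. F T x - \<phi> (pos t) \<in> range real_vec}"

lemma \<phi>_diff: "\<phi> (x - y) = \<phi> x - \<phi> y"
  using \<phi>_add[of "x - y" y] by (simp add: algebra_simps)

lemma \<phi>_0: "\<phi> 0 = 0"
  using \<phi>_diff[of 0 0] by simp

lemma \<psi>_diff: "\<psi> (x - y) = \<psi> x - \<psi> y"
  by (simp add: \<psi>_def \<phi>_diff algebra_simps)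

text \<open>Any two tiles are joined by a chain of steps, \<phi> is integral on each step, and
  additivity does the rest.\<close>

lemma \<phi>_integral:
  assumes T: "T \<in> tilings Pr" and st: "s \<in> T" "t \<in> T"
  shows "\<phi> (pos t) - \<phi> (pos s) \<in> range real_vec"
proof -
  have int: "\<phi> d \<in> range real_vec" if "d \<in> sums_of steps n" for d n
    using that
  proof (induction n arbitrary: d)
    case 0
    have "real_vec 0 = \<phi> 0" by (simp add: \<phi>_0)
    then show ?case using 0 by (metis rangeI singletonD sums_of.simps(1))
  next
    case (Suc n)
    then obtain a b where "a \<in> sums_of steps n" "b \<in> steps" "d = a + b" by auto
    then show ?case using range_real_vec_add[OF Suc.IH \<phi>_steps] by (simp add: \<phi>_add)
  qed
  obtain n where "pos t - pos s \<in> sums_of steps n"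
    using ex_chain_bound[of "norm (pos t - pos s)"] T st by blast
  from int[OF this] show ?thesis by (simp add: \<phi>_diff)
qed

lemma finite_near_ball: "T \<in> tilings Pr \<Longrightarrow> finite {t \<in> T. norm (pos t - x) \<le> R}"
  using packing[of R] by blast

lemma hat_nonneg: "hat x t \<ge> 0"
  by (simp add: hat_def)

lemma hat_pos_iff: "hat x t > 0 \<longleftrightarrow> norm (pos t - x) < radius + 1"
  by (auto simp: hat_def)

lemma hat_lipschitz: "\<bar>hat x t - hat y t\<bar> \<le> norm (x - y)"
  using norm_triangle_ineq3[of "pos t - x" "pos t - y"] by (simp add: hat_def norm_minus_commute)

lemma hat_ge_1: "T \<in> tilings Pr \<Longrightarrow> t \<in> T \<Longrightarrow> x \<in> support t \<Longrightarrow> hat x t \<ge> 1"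
  using radius(2)[OF tilings_tiles, of T t x] by (simp add: hat_def norm_minus_commute)

lemma sum_hat_ge_1:
  assumes T: "T \<in> tilings Pr" and A: "finite A" "near T x \<subseteq> A"
  shows "sum (hat x) A \<ge> 1"
proof -
  obtain t where t: "t \<in> T" "x \<in> support t" using tilings_cover[OF T] by blast
  have h: "hat x t \<ge> 1" by (rule hat_ge_1[OF T t])
  then have "t \<in> A" using t(1) A(2) by (auto simp: near_def)
  then have "hat x t \<le> sum (hat x) A" using A(1) hat_nonneg by (intro member_le_sum) auto
  then show ?thesis using h by simp
qed

lemma near_subset: "near T x \<subseteq> {t \<in> T. norm (pos t - x) \<le> radius + 1}"
  by (auto simp: near_def hat_pos_iff)

lemma finite_near: "T \<in> tilings Pr \<Longrightarrow> finite (near T x)"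
  by (rule finite_subset[OF near_subset finite_near_ball])

lemma F_average:
  assumes T: "T \<in> tilings Pr" and A: "finite A" "near T x \<subseteq> A" "A \<subseteq> T"
  shows "F T x = N *\<^sub>R x + c + average A (hat x) (\<lambda>t. \<psi> (pos t) - c)"
proof -
  have "F T x = N *\<^sub>R x + average A (hat x) (\<lambda>t. \<psi> (pos t))"
    unfolding F_def
  proof (subst average_mono_neutral[OF A(1,2)])
    show "hat x t = 0" if "t \<in> A - near T x" for t
      using that A(3) hat_nonneg[of x t] by (auto simp: near_def)
  qed simp
  moreover have "sum (hat x) A \<noteq> 0" using sum_hat_ge_1[OF T A(1,2)] by simp
  from average_add_const[OF this, of "\<lambda>t. \<psi> (pos t) - c" c]
  have "average A (hat x) (\<lambda>t. \<psi> (pos t)) = average A (hat x) (\<lambda>t. \<psi> (pos t) - c) + c" by simp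
  ultimately show ?thesis by simp
qed

text \<open>For points within distance 1 both averages can be taken over one set of tiles, where
  \<open>average_lipschitz\<close> applies; the local bound is then global.\<close>

lemma F_scaling:
  assumes T: "T \<in> tilings Pr"
  shows "norm (F T x - F T y - N *\<^sub>R (x - y)) \<le> N/3 * norm (x - y)"
proof -
  have "norm ((F T x - N *\<^sub>R x) - (F T y - N *\<^sub>R y)) \<le> N/3 * norm (x - y)"
  proof (rule lipschitz_from_local[where r = 1])
    fix x y :: "real ^ 'n" assume xy: "norm (x - y) \<le> 1"
    let ?A = "{t \<in> T. norm (pos t - x) \<le> radius + 2}"
    have fin: "finite ?A" by (rule finite_near_ball[OF T])
    have nx: "near T x \<subseteq> ?A" using near_subset[of T x] by auto
    have ny: "near T y \<subseteq> ?A"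
    proof
      fix t assume "t \<in> near T y"
      then have "t \<in> T" "norm (pos t - y) \<le> radius + 1" using near_subset by auto
      then show "t \<in> ?A"
        using xy norm_triangle_ineq4[of "pos t - y" "x - y"] by simp
    qed
    \<comment> \<open>The values of \<psi> at positions are not bounded. Subtracting the value at a
      tile over \<open>x\<close> leaves the difference of the averages unchanged and makes all terms
      at most \<eta>.\<close>
    obtain t0 where t0: "t0 \<in> T" "x \<in> support t0" using tilings_cover[OF T] by blast
    have "norm (pos t0 - x) \<le> radius"
      using radius(2)[OF tilings_tiles[OF T t0(1)] t0(2)] by (simp add: norm_minus_commute)
    then have a: "norm (\<psi> (pos t) - \<psi> (pos t0)) \<le> \<eta>" if "t \<in> ?A" for t
      using that \<phi>_near[OF T t0(1), of t] norm_triangle_ineq4[of "pos t - x" "pos t0 - x"] radius(1)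
      by (simp add: \<psi>_def[of "pos t - pos t0", symmetric] \<psi>_diff)
    have "(F T x - N *\<^sub>R x) - (F T y - N *\<^sub>R y) =
        average ?A (hat x) (\<lambda>t. \<psi> (pos t) - \<psi> (pos t0)) - average ?A (hat y) (\<lambda>t. \<psi> (pos t) - \<psi> (pos t0))"
      using F_average[OF T fin nx, of "\<psi> (pos t0)"] F_average[OF T fin ny, of "\<psi> (pos t0)"]
      by (simp add: algebra_simps)
    also have "norm \<dots> \<le> 2 * M * \<eta> * norm (x - y)"
      using sum_hat_ge_1[OF T fin nx] sum_hat_ge_1[OF T fin ny] hat_nonneg hat_lipschitz a \<eta>(1) card_near[OF T]
      by (intro average_lipschitz) auto
    also have "\<dots> \<le> N/3 * norm (x - y)" using \<eta>(2) by (intro mult_right_mono) auto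
    finally show "norm ((F T x - N *\<^sub>R x) - (F T y - N *\<^sub>R y)) \<le> N/3 * norm (x - y)" .
  qed simp
  then show ?thesis by (simp add: algebra_simps)
qed

lemma f_scaling: "T \<in> tilings Pr \<Longrightarrow> near_scaling (N/3) N (f T)"
  using F_scaling by (simp add: near_scaling_def f_def)

lemma f_bij: "T \<in> tilings Pr \<Longrightarrow> bij (f T)"
  using near_scaling_bij[OF f_scaling] N by simp

lemma F_inj: "T \<in> tilings Pr \<Longrightarrow> F T x = F T y \<Longrightarrow> x = y"
  using f_bij[of T] by (metis bij_pointE f_def)

lemma norm_le_f: "T \<in> tilings Pr \<Longrightarrow> norm x \<le> 2/N * norm (f T x)"
proof -
  assume T: "T \<in> tilings Pr"
  have "(N - N/3) * norm x \<le> norm (f T x)"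
    using near_scaling_lower[OF f_scaling[OF T], of x 0] N by (simp add: f_def)
  moreover have "N/2 * norm x \<le> (N - N/3) * norm x" using N by (intro mult_right_mono) auto
  ultimately have "N/2 * norm x \<le> norm (f T x)" by linarith
  then show ?thesis using N by (simp add: field_simps)
qed

lemma F_tile:
  assumes T: "T \<in> tilings Pr" and t: "t \<in> T" "norm (x - pos t) \<le> radius"
  shows "norm (F T x - \<phi> (pos t)) \<le> N * radius + \<eta>"
proof -
  have a: "norm (\<psi> (pos u) - \<psi> (pos t)) \<le> \<eta>" if "u \<in> near T x" for u
  proof -
    have u: "u \<in> T" "norm (pos u - x) \<le> radius + 1" using that near_subset by auto
    then have "norm (pos u - pos t) \<le> 2 * radius + 4"
      using t(2) norm_triangle_ineq[of "pos u - x" "x - pos t"] by simp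
    from \<phi>_near[OF T t(1) u(1) this] show ?thesis
      by (simp add: \<psi>_def[of "pos u - pos t", symmetric] \<psi>_diff)
  qed
  have "sum (hat x) (near T x) > 0"
    by (rule less_le_trans[OF zero_less_one sum_hat_ge_1[OF T finite_near[OF T] order_refl]])
  then have "norm (average (near T x) (hat x) (\<lambda>u. \<psi> (pos u) - \<psi> (pos t))) \<le> \<eta>"
    using a hat_nonneg by (intro average_bound) auto
  moreover have "norm (N *\<^sub>R (x - pos t)) \<le> N * radius" using t(2) N by simp
  moreover have "near T x \<subseteq> T" by (auto simp: near_def)
  then have "F T x = N *\<^sub>R x + \<psi> (pos t) + average (near T x) (hat x) (\<lambda>u. \<psi> (pos u) - \<psi> (pos t))"
    by (intro F_average[OF T finite_near[OF T]]) auto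
  then have "F T x - \<phi> (pos t) = N *\<^sub>R (x - pos t) + average (near T x) (hat x) (\<lambda>u. \<psi> (pos u) - \<psi> (pos t))"
    by (simp add: \<psi>_def[of "pos t"] algebra_simps)
  ultimately show ?thesis
    by (simp only:) (rule norm_triangle_le, rule add_mono)
qed

lemma pos_translate_tile: "T \<in> tilings Pr \<Longrightarrow> t \<in> T \<Longrightarrow> pos (translate_tile v t) = v + pos t"
  using pos_translate tilings_tiles by blast

text \<open>Additivity of \<psi> lets the shift of the positions leave the average as
  \<open>- \<psi> x\<close>, and \<open>- N *\<^sub>R x\<close> completes it to
  \<open>- \<phi> x\<close>.\<close>

lemma F_translate:
  assumes T: "T \<in> tilings Pr"
  shows "F (translate (- x) T) y = F T (x + y) - \<phi> x"
proof -
  have hat: "hat y (translate_tile (- x) t) = hat (x + y) t" if "t \<in> T" for t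
    by (simp add: hat_def pos_translate_tile[OF T that] algebra_simps)
  have near: "near (translate (- x) T) y = translate_tile (- x) ` near T (x + y)"
    using hat by (auto simp: near_def translate_def)
  have inj: "inj_on (translate_tile (- x)) (near T (x + y))"
    by (rule inj_onI) (simp add: translate_tile_inj)
  have sub: "near T (x + y) \<subseteq> T" by (auto simp: near_def)
  have "average (near (translate (- x) T) y) (hat y) (\<lambda>t. \<psi> (pos t)) =
      average (near T (x + y)) (hat (x + y)) (\<lambda>t. \<psi> (pos t) - \<psi> x)"
  proof -
    have "sum (hat y) (near (translate (- x) T) y) = sum (hat (x + y)) (near T (x + y))"
      unfolding near sum.reindex[OF inj] using hat sub by (intro sum.cong) auto
    moreover have "(\<Sum>t\<in>near (translate (- x) T) y. hat y t *\<^sub>R \<psi> (pos t)) =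
        (\<Sum>t\<in>near T (x + y). hat (x + y) t *\<^sub>R (\<psi> (pos t) - \<psi> x))"
      unfolding near sum.reindex[OF inj]
    proof (intro sum.cong refl)
      fix t assume "t \<in> near T (x + y)"
      then have "t \<in> T" using sub by blast
      then have "pos (translate_tile (- x) t) = pos t - x" using pos_translate_tile[OF T] by simp
      then show "((\<lambda>t. hat y t *\<^sub>R \<psi> (pos t)) \<circ> translate_tile (- x)) t = hat (x + y) t *\<^sub>R (\<psi> (pos t) - \<psi> x)"
        using hat[OF \<open>t \<in> T\<close>] by (simp only: o_def \<psi>_diff)
    qed
    ultimately show ?thesis by (simp only: average_def)
  qed
  then show ?thesis
    using F_average[OF T finite_near[OF T] order_refl sub, of "\<psi> x"]
    by (simp add: F_def[of "translate (- x) T"] \<psi>_def[of x] algebra_simps)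
qed

lemma f_translate: "T \<in> tilings Pr \<Longrightarrow> f (translate (- x) T) y = f T (x + y) - f T x"
  by (simp add: f_def F_translate)

text \<open>Tiles with positive weight at \<open>x\<close> have positions within
  \<open>radius + 1\<close> and hence lie within \<open>2 * radius + 1\<close> of
  \<open>x\<close>.\<close>

definition \<rho> :: real where
  "\<rho> = 2 * radius + 1"

lemma F_local:
  assumes T: "T \<in> tilings Pr" "T' \<in> tilings Pr" and ag: "agree R T T'" and x: "norm x + \<rho> \<le> R"
  shows "F T x = F T' x"
proof -
  have "t \<in> T'" if T: "T \<in> tilings Pr" and ag: "agree R T T'" and t: "t \<in> near T x" for T T' t
  proof -
    have tT: "t \<in> T" and tx: "norm (pos t - x) \<le> radius + 1" using t near_subset by auto
    obtain y where y: "y \<in> support t" using tile_nonempty[OF tilings_tiles[OF T tT]] by blast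
    have "norm (y - pos t) \<le> radius" by (rule radius(2)[OF tilings_tiles[OF T tT] y])
    then have "norm y \<le> R"
      using tx x norm_triangle_ineq[of "y - pos t" "pos t - x"] norm_triangle_ineq[of "y - x" x]
      by (simp add: \<rho>_def)
    then show ?thesis using agree_mem[OF ag y] tT by simp
  qed
  from this[OF T(1) ag] this[OF T(2) agree_sym[OF ag]] have "near T x = near T' x"
    by (auto simp: near_def)
  then show ?thesis by (simp add: F_def)
qed

lemma \<rho>_pos: "\<rho> \<ge> 1"
  using radius(1) by (simp add: \<rho>_def)

lemma f_local:
  assumes "T \<in> tilings Pr" "T' \<in> tilings Pr" "agree R T T'" "norm x + \<rho> \<le> R"
  shows "f T x = f T' x"
proof -
  have "norm (0 :: real ^ 'n) + \<rho> \<le> R" using assms(4) norm_ge_zero[of x] by (simp del: norm_ge_zero)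
  then show ?thesis
    using F_local[OF assms] F_local[OF assms(1-3)] by (simp add: f_def)
qed

section \<open>Vertices and their patches\<close>

lemma V_iff:
  assumes T: "T \<in> tilings Pr" and t: "t \<in> T"
  shows "x \<in> V T \<longleftrightarrow> F T x - \<phi> (pos t) \<in> range real_vec"
proof
  assume "x \<in> V T"
  then obtain s where s: "s \<in> T" "F T x - \<phi> (pos s) \<in> range real_vec" by (auto simp: V_def)
  have "F T x - \<phi> (pos t) = (F T x - \<phi> (pos s)) + (\<phi> (pos s) - \<phi> (pos t))" by simp
  then show "F T x - \<phi> (pos t) \<in> range real_vec"
    using range_real_vec_add[OF s(2) \<phi>_integral[OF T t s(1)]] by simp
qed (use t in \<open>auto simp: V_def\<close>)

lemma V_translate:
  assumes T: "T \<in> tilings Pr"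
  shows "y \<in> V (translate (- x) T) \<longleftrightarrow> x + y \<in> V T"
proof -
  obtain t where t: "t \<in> T" using tilings_cover[OF T] by blast
  then have "translate_tile (- x) t \<in> translate (- x) T" by (simp add: translate_def)
  from V_iff[OF tilings_translate[OF T] this, of y] V_iff[OF T t, of "x + y"] show ?thesis
    using pos_translate_tile[OF T t, of "- x"] by (simp add: F_translate[OF T] \<phi>_diff)
qed

lemma V_local:
  assumes T: "T \<in> tilings Pr" "T' \<in> tilings Pr" and ag: "agree R T T'" and x: "norm x + \<rho> \<le> R"
  shows "x \<in> V T \<longleftrightarrow> x \<in> V T'"
proof -
  obtain t where t: "t \<in> T" "x \<in> support t" using tilings_cover[OF T(1)] by blast
  have "norm x \<le> R" using x \<rho>_pos by simp
  then have "t \<in> T'" using agree_mem[OF ag t(2)] t(1) by simp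
  then show ?thesis
    using V_iff[OF T(1) t(1)] V_iff[OF T(2)] F_local[OF assms] by simp
qed

text \<open>The vertex whose cube covers the origin has norm at most \<open>2/N * norm One\<close>,
  so its patch of this radius contains the ball of radius \<open>\<rho> + 1\<close> about the
  origin.\<close>

definition reach :: real where
  "reach = 2/N * norm (One :: real ^ 'n) + \<rho> + 1"

definition patch :: "(real ^ 'n, 'm) tile set \<Rightarrow> real ^ 'n \<Rightarrow> (real ^ 'n, 'm) tile set" where
  "patch T v = tiles_meeting (translate (- v) T) (cball 0 reach)"

text \<open>A vertex \<open>v\<close> lying in the tile \<open>t\<close> is determined by the integral vector
  \<open>F T v - \<phi> (pos t)\<close> and the patch of \<open>T\<close> around \<open>t\<close>.\<close>

lemma finite_vertex_patches: "finite {patch T v | T v. T \<in> tilings Pr \<and> v \<in> V T}"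
proof -
  \<comment> \<open>A vertex is within \<open>radius\<close> of the position of its tile; from there
    \<open>reach\<close> is needed for its patch and \<rho> for the value of
    \<open>F\<close>.\<close>
  define R where "R = radius + reach + \<rho>"
  have reach: "reach \<ge> 0" using N \<rho>_pos by (simp add: reach_def)
  define X where "X = {(T, v, t). T \<in> tilings Pr \<and> v \<in> V T \<and> t \<in> T \<and> v \<in> support t}"
  define k where "k = (\<lambda>(T, v, t :: (real ^ 'n, 'm) tile). (translate (- pos t) (tiles_meeting T (cball (pos t) R)), F T v - \<phi> (pos t)))"
  let ?Q = "{translate (- pos t) (tiles_meeting T (cball x R)) | T t x.
     T \<in> tilings Pr \<and> t \<in> T \<and> norm (x - pos t) \<le> 0}"
  let ?I = "real_vec ` {n. norm (real_vec n :: real ^ 'n) \<le> N * radius + \<eta>}"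
  have "k q \<in> ?Q \<times> ?I" if "q \<in> X" for q
  proof -
    obtain T v t where q: "q = (T, v, t)" "T \<in> tilings Pr" "v \<in> V T" "t \<in> T" "v \<in> support t"
      using \<open>q \<in> X\<close> unfolding X_def by blast
    have "norm (v - pos t) \<le> radius" by (rule radius(2)[OF tilings_tiles[OF q(2,4)] q(5)])
    then have "norm (F T v - \<phi> (pos t)) \<le> N * radius + \<eta>" by (rule F_tile[OF q(2,4)])
    moreover have "F T v - \<phi> (pos t) \<in> range real_vec" using q(3) V_iff[OF q(2,4)] by simp
    ultimately have "F T v - \<phi> (pos t) \<in> ?I" by auto
    moreover have "translate (- pos t) (tiles_meeting T (cball (pos t) R)) \<in> ?Q"
      using q(2,4) by (intro CollectI exI[of _ T] exI[of _ t] exI[of _ "pos t"]) simp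
    ultimately show ?thesis by (simp add: k_def q(1))
  qed
  then have "k ` X \<subseteq> ?Q \<times> ?I" by blast
  moreover have "finite (?Q \<times> ?I)"
    by (intro finite_cartesian_product finite_imageI finite_bounded_real_vec finite_patches)
  ultimately have "finite (k ` X)" by (rule finite_subset)
  then have "finite ((\<lambda>(T, v, t). patch T v) ` X)"
  proof (rule finite_image_factor)
    fix q q' assume q: "q \<in> X" "q' \<in> X" "k q = k q'"
    obtain T v t where T: "q = (T, v, t)" "T \<in> tilings Pr" "t \<in> T" "v \<in> support t"
      using q(1) unfolding X_def by blast
    obtain T' v' t' where T': "q' = (T', v', t')" "T' \<in> tilings Pr" "t' \<in> T'" "v' \<in> support t'"
      using q(2) unfolding X_def by blast
    define U U' w w' where "U = translate (- pos t) T" and "U' = translate (- pos t') T'"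
      and "w = v - pos t" and "w' = v' - pos t'"
    have U: "U \<in> tilings Pr" "U' \<in> tilings Pr" using T(2) T'(2) by (simp_all add: U_def U'_def tilings_translate)
    have "translate (- pos t) (tiles_meeting T (cball (pos t) R)) = tiles_meeting U (cball 0 R)"
      "translate (- pos t') (tiles_meeting T' (cball (pos t') R)) = tiles_meeting U' (cball 0 R)"
      by (simp_all add: U_def U'_def tiles_meeting_translate)
    then have ag: "agree R U U'" using q(3) by (simp add: agree_def k_def T(1) T'(1))
    have w: "norm w \<le> radius" unfolding w_def by (rule radius(2)[OF tilings_tiles[OF T(2,3)] T(4)])
    have "F U w = F T v - \<phi> (pos t)" "F U' w' = F T' v' - \<phi> (pos t')"
      by (simp_all add: U_def U'_def w_def w'_def F_translate T(2) T'(2))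
    \<comment> \<open>Equal integral vectors mean equal values of \<open>F\<close>; as
      \<open>F U\<close> and \<open>F U'\<close> coincide at \<open>w\<close>, injectivity forces
      \<open>w = w'\<close>.\<close>
    then have "F U w = F U' w'" using q(3) by (simp add: k_def T(1) T'(1))
    moreover have "F U w = F U' w" using w reach by (intro F_local[OF U ag]) (simp add: R_def)
    ultimately have "w = w'" using F_inj[OF U(2)] by simp
    moreover have "agree reach (translate (- w) U) (translate (- w) U')"
      by (rule agree_translate[OF ag]) (use w \<rho>_pos in \<open>simp add: R_def\<close>)
    moreover have "translate (- w) U = translate (- v) T" "translate (- w') U' = translate (- v') T'"
      by (simp_all add: U_def U'_def w_def w'_def translate_add)
    ultimately have "patch T v = patch T' v'" by (simp add: patch_def agree_def)
    then show "(case q of (T, v, t) \<Rightarrow> patch T v) = (case q' of (T, v, t) \<Rightarrow> patch T v)"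
      by (simp add: T(1) T'(1))
  qed
  moreover have "{patch T v | T v. T \<in> tilings Pr \<and> v \<in> V T} \<subseteq> (\<lambda>(T, v, t). patch T v) ` X"
  proof (clarify)
    fix T v assume T: "T \<in> tilings Pr" "v \<in> V T"
    obtain t where "t \<in> T" "v \<in> support t" using tilings_cover[OF T(1)] by blast
    then show "patch T v \<in> (\<lambda>(T, v, t). patch T v) ` X"
      using T by (intro image_eqI[of _ _ "(T, v, t)"]) (simp_all add: X_def)
  qed
  ultimately show ?thesis by (rule finite_subset[rotated])
qed

section \<open>The marked cubing\<close>

definition marks :: "(real ^ 'n, 'm) tile set set" where
  "marks = {patch T v | T v. T \<in> tilings Pr \<and> v \<in> V T}"

lemma ex_code: "\<exists>code :: (real ^ 'n, 'm) tile set \<Rightarrow> nat. inj_on code marks"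
  using finite_imp_inj_to_nat_seg[OF finite_vertex_patches] unfolding marks_def by blast

text \<open>Numbers serve as marks; any injection of the finite set of patches will do.\<close>

definition code :: "(real ^ 'n, 'm) tile set \<Rightarrow> nat" where
  "code = (SOME c. inj_on c marks)"

lemma inj_code: "inj_on code marks"
  unfolding code_def by (rule someI_ex[OF ex_code])

definition A :: "nat set" where
  "A = code ` marks"

lemma finite_A: "finite A"
  using finite_vertex_patches by (simp add: A_def marks_def)

lemma patch_in_marks: "T \<in> tilings Pr \<Longrightarrow> v \<in> V T \<Longrightarrow> patch T v \<in> marks"
  unfolding marks_def by blast

definition \<Psi> :: "(real ^ 'n, 'm) tile set \<Rightarrow> (real ^ 'n, nat) tile set" where
  "\<Psi> T = (\<lambda>v. translate_tile (f T v) (cube_tile (code (patch T v)))) ` V T"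

text \<open>\<open>f T\<close> is a bijection that carries \<open>V T\<close> onto a coset of the
  integer lattice; indexing the vertices by that lattice displays a cubing.\<close>

lemma \<Psi>_cubing:
  assumes T: "T \<in> tilings Pr"
  shows "\<exists>x v. range x \<subseteq> A \<and> \<Psi> T = cubing x v"
proof -
  obtain t where t: "t \<in> T" using tilings_cover[OF T] by blast
  define a where "a = \<phi> (pos t) - F T 0"
  define h where "h n = inv (f T) (real_vec n + a)" for n
  have fh: "f T (h n) = real_vec n + a" for n
    by (simp add: h_def f_bij[OF T] bij_is_surj surj_f_inv_f)
  have V: "v \<in> V T \<longleftrightarrow> (\<exists>n. v = h n)" for v
  proof -
    have "v \<in> V T \<longleftrightarrow> f T v - a \<in> range real_vec"
      unfolding V_iff[OF T t] by (simp add: f_def a_def)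
    also have "\<dots> \<longleftrightarrow> (\<exists>n. f T v = real_vec n + a)"
      by (auto simp: image_iff algebra_simps)
    also have "\<dots> \<longleftrightarrow> (\<exists>n. v = h n)"
      unfolding fh[symmetric] using bij_is_inj[OF f_bij[OF T]] by (simp add: inj_eq)
    finally show ?thesis .
  qed
  then have "V T = range h" by auto
  then have "\<Psi> T = cubing (\<lambda>n. code (patch T (h n))) (- a)"
    by (simp add: \<Psi>_def cubing_def image_image fh)
  moreover have "range (\<lambda>n. code (patch T (h n))) \<subseteq> A"
    using V patch_in_marks[OF T] by (auto simp: A_def)
  ultimately show ?thesis by blast
qed

lemma \<Psi>_translate:
  assumes T: "T \<in> tilings Pr"
  shows "\<Psi> (translate (- x) T) = translate (- f T x) (\<Psi> T)"
proof -
  have V: "V (translate (- x) T) = (\<lambda>v. v - x) ` V T"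
    using V_translate[OF T] by (force simp: image_iff)
  have patch: "patch (translate (- x) T) (v - x) = patch T v" for v
    by (simp add: patch_def translate_add)
  have "\<Psi> (translate (- x) T) = (\<lambda>v. translate_tile (f T v - f T x) (cube_tile (code (patch T v)))) ` V T"
    unfolding \<Psi>_def V image_image patch f_translate[OF T] by simp
  then show ?thesis
    by (simp add: \<Psi>_def translate_def image_image translate_tile_add)
qed

lemma vertex_in_cube:
  assumes T: "T \<in> tilings Pr" and y: "y \<in> support (translate_tile (f T v) (cube_tile c))"
  shows "norm v \<le> 2/N * (norm y + norm (One :: real ^ 'n))"
proof -
  have "norm (y - f T v) \<le> norm (One :: real ^ 'n)"
  proof (rule norm_le_componentwise_cart)
    fix i
    have "f T v $ i \<le> y $ i" "y $ i \<le> f T v $ i + 1"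
      using y unfolding support_cube mem_cube by auto
    then show "norm ((y - f T v) $ i) \<le> norm ((One :: real ^ 'n) $ i)" by simp
  qed
  then have "norm (f T v) \<le> norm y + norm (One :: real ^ 'n)"
    using norm_triangle_ineq4[of y "y - f T v"] by simp
  then have "2/N * norm (f T v) \<le> 2/N * (norm y + norm (One :: real ^ 'n))"
    using N by (intro mult_left_mono) auto
  then show ?thesis using norm_le_f[OF T, of v] by linarith
qed

lemma patch_local:
  assumes "agree R T T'" "norm v + reach \<le> R"
  shows "patch T v = patch T' v"
  using agree_translate[OF assms(1), of "- v" reach] assms(2) by (simp add: patch_def agree_def)

lemma \<Psi>_local: "\<exists>R'. \<forall>T\<in>tilings Pr. \<forall>T'\<in>tilings Pr. agree R' T T' \<longrightarrow> agree R (\<Psi> T) (\<Psi> T')"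
proof -
  define R' where "R' = 2/N * (R + norm (One :: real ^ 'n)) + reach"
  have sub: "tiles_meeting (\<Psi> T) (cball 0 R) \<subseteq> tiles_meeting (\<Psi> T') (cball 0 R)"
    if T: "T \<in> tilings Pr" "T' \<in> tilings Pr" and ag: "agree R' T T'" for T T'
  proof
    fix c assume c: "c \<in> tiles_meeting (\<Psi> T) (cball 0 R)"
    then obtain y where y: "c \<in> \<Psi> T" "y \<in> support c" "norm y \<le> R"
      by (auto simp: tiles_meeting_def)
    then obtain v where v: "v \<in> V T" "c = translate_tile (f T v) (cube_tile (code (patch T v)))"
      by (auto simp: \<Psi>_def)
    have "norm v \<le> 2/N * (norm y + norm (One :: real ^ 'n))"
      using vertex_in_cube[OF T(1), of y v] y(2) v(2) by simp
    also have "\<dots> \<le> 2/N * (R + norm (One :: real ^ 'n))"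
      using y(3) N by (intro mult_left_mono) auto
    finally have nv: "norm v + reach \<le> R'" by (simp add: R'_def)
    moreover have "\<rho> \<le> reach" using N by (simp add: reach_def)
    ultimately have nv': "norm v + \<rho> \<le> R'" by simp
    have "v \<in> V T'" using V_local[OF T ag nv'] v(1) by simp
    moreover have "f T v = f T' v" by (rule f_local[OF T ag nv'])
    moreover have "patch T v = patch T' v" by (rule patch_local[OF ag nv])
    ultimately have "c \<in> \<Psi> T'" by (simp add: \<Psi>_def v(2))
    then show "c \<in> tiles_meeting (\<Psi> T') (cball 0 R)"
      using c by (simp add: tiles_meeting_def)
  qed
  have "agree R (\<Psi> T) (\<Psi> T')" if "T \<in> tilings Pr" "T' \<in> tilings Pr" "agree R' T T'" for T T'
    unfolding agree_def using sub[OF that] sub[OF that(2,1) agree_sym[OF that(3)]] by (rule subset_antisym)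
  then show ?thesis by blast
qed

text \<open>The mark of the one cube over the origin gives the patch around its vertex, but not
  where the vertex lies. The position of the cube supplies this, because the patch determines
  \<open>f\<close> as seen from the vertex.\<close>

lemma \<Psi>_recover:
  assumes T: "T \<in> tilings Pr" "T' \<in> tilings Pr" and ag: "agree 0 (\<Psi> T) (\<Psi> T')"
  shows "agree (\<rho> + 1) T T'"
proof -
  have "\<Psi> T \<in> tilings (cube_tile ` A)"
    using \<Psi>_cubing[OF T(1)] cubing_tilings by metis
  then obtain c where c: "c \<in> \<Psi> T" "0 \<in> support c" using tilings_cover by blast
  then have c': "c \<in> \<Psi> T'" using agree_mem[OF ag c(2)] by simp
  obtain v where v: "v \<in> V T" "c = translate_tile (f T v) (cube_tile (code (patch T v)))"
    using c(1) by (auto simp: \<Psi>_def)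
  obtain v' where v': "v' \<in> V T'" "c = translate_tile (f T' v') (cube_tile (code (patch T' v')))"
    using c' by (auto simp: \<Psi>_def)
  have eq: "f T v = f T' v'" "code (patch T v) = code (patch T' v')"
    using v(2) v'(2) by (simp_all add: cube_eq_iff)
  have "patch T v = patch T' v'"
    using inj_code eq(2) patch_in_marks[OF T(1) v(1)] patch_in_marks[OF T(2) v'(1)] by (simp add: inj_on_eq_iff)
  then have near: "agree reach (translate (- v) T) (translate (- v') T')"
    by (simp add: patch_def agree_def)
  have nv: "norm (- v) + (\<rho> + 1) \<le> reach"
    using vertex_in_cube[OF T(1), of 0 v] c(2) v(2) by (simp add: reach_def)
  have U: "translate (- v) T \<in> tilings Pr" "translate (- v') T' \<in> tilings Pr"
    using T by (simp_all add: tilings_translate)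
  have "f (translate (- v) T) (- v) = f (translate (- v') T') (- v)"
    by (rule f_local[OF U near]) (use nv in simp)
  \<comment> \<open>Both sides are the negated position of the common cube, by the cocycle
    identity.\<close>
  moreover have "f (translate (- v) T) (- v) = f (translate (- v') T') (- v')"
    using eq(1) by (simp add: f_translate T) (simp add: f_def)
  ultimately have "f (translate (- v') T') (- v) = f (translate (- v') T') (- v')" by simp
  then have "v = v'" using bij_is_inj[OF f_bij[OF U(2)]] by (simp add: inj_eq)
  moreover have "agree (\<rho> + 1) (translate v (translate (- v) T)) (translate v (translate (- v') T'))"
    by (rule agree_translate[OF near]) (use nv in simp)
  ultimately show ?thesis by simp
qed

lemma local_equivalence: "local_equivalence Pr (cube_tile ` A) f \<Psi> N \<rho>"
proof -
  interpret cubes: protoset "cube_tile ` A :: (real ^ 'n, nat) tile set"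
    by (rule protoset_cubes[OF finite_A])
  show ?thesis
  proof
    show "\<Psi> T \<in> tilings (cube_tile ` A)" if "T \<in> tilings Pr" for T
      using \<Psi>_cubing[OF that] cubing_tilings by metis
    show "\<exists>K. \<forall>T\<in>tilings Pr. \<forall>T'\<in>tilings Pr. agree K (\<Psi> T) (\<Psi> T') \<longrightarrow> agree (\<rho> + 1) T T'"
      using \<Psi>_recover by blast
    show "\<rho> \<ge> 0" using \<rho>_pos by simp
  qed (fact N f_translate f_scaling f_local \<Psi>_translate \<Psi>_local)+
qed

end

lemma ex_lattice_approximation:
  fixes Pr :: "(real ^ 'n, 'm) tile set"
  assumes "protoset Pr"
  shows "\<exists>\<phi> N \<eta> M. lattice_approximation Pr \<phi> N \<eta> M"
proof -
  interpret protoset Pr by fact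
  obtain m where m: "\<And>T x. T \<in> tilings Pr \<Longrightarrow> card {t \<in> T. norm (pos t - x) \<le> radius + 2} \<le> m"
    using packing[of "radius + 2"] by meson
  obtain D where D: "finite D" "\<And>T s t. T \<in> tilings Pr \<Longrightarrow> s \<in> T \<Longrightarrow> t \<in> T \<Longrightarrow>
      norm (pos t - pos s) \<le> 2 * radius + 4 \<Longrightarrow> pos t - pos s \<in> D"
    using finite_local_complexity[of "2 * radius + 4"] by meson
  \<comment> \<open>With \<open>\<eta> = N * \<epsilon>\<close> this yields
    \<open>2 * m * \<eta> \<le> N / 3\<close> whatever \<open>N\<close> is; \<open>m\<close> and
    \<open>D\<close> are available before \<phi> is chosen.\<close>
  define \<epsilon> where "\<epsilon> = 1 / (6 * (real m + 1))"
  have e: "\<epsilon> > 0" by (simp add: \<epsilon>_def)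
  have fin: "finite (D \<union> steps)" using D(1) finite_steps by simp
  obtain \<phi> :: "real ^ 'n \<Rightarrow> real ^ 'n" and N where \<phi>: "N > 0" "\<And>x y. \<phi> (x + y) = \<phi> x + \<phi> y"
    "\<And>d. d \<in> D \<union> steps \<Longrightarrow> \<phi> d \<in> range real_vec"
    "\<And>d. d \<in> D \<union> steps \<Longrightarrow> norm (\<phi> d - N *\<^sub>R d) \<le> N * \<epsilon>"
    using ex_additive_integral[OF fin e] by metis
  have "lattice_approximation Pr \<phi> N (N * \<epsilon>) (real m)"
  proof
    show "2 * real m * (N * \<epsilon>) \<le> N / 3"
      using \<phi>(1) by (simp add: \<epsilon>_def field_simps)
    show "real (card {t \<in> T. norm (pos t - x) \<le> radius + 2}) \<le> real m" if "T \<in> tilings Pr" for T x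
      using m[OF that] by simp
  qed (use \<phi> D(2) e in auto)
  then show ?thesis by blast
qed

section \<open>Polyhedral prototiles\<close>

text \<open>By invariance of domain the image of the open ball is open.\<close>

lemma interior_homeomorphic_cball:
  fixes S :: "'a::euclidean_space set"
  assumes "S homeomorphic cball (0 :: 'a) 1"
  shows "interior S \<noteq> {}"
proof -
  obtain h k where "homeomorphism (cball (0 :: 'a) 1) S h k"
    using assms homeomorphic_sym unfolding homeomorphic_def by blast
  then have h: "continuous_on (cball 0 1) h" "inj_on h (cball 0 1)" "h ` cball 0 1 = S"
    unfolding homeomorphism_def by (auto intro: inj_on_inverseI)
  have sub: "ball (0 :: 'a) 1 \<subseteq> cball 0 1" by (rule ball_subset_cball)
  have "open (h ` ball 0 1)"
    using h sub by (intro invariance_of_domain) (auto intro: continuous_on_subset inj_on_subset)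
  then have "h ` ball 0 1 \<subseteq> interior S"
    using h(3) sub by (intro interior_maximal) auto
  then show ?thesis by auto
qed

lemma protoset_polyhedral:
  fixes Pr :: "('a::euclidean_space, 'm) tile set"
  assumes "finite Pr" "\<forall>t\<in>Pr. polyhedral_tile t"
  shows "protoset Pr"
proof
  show "finite Pr" by fact
  fix t assume t: "t \<in> Pr"
  then have c: "simplicial_complex (cells t)" and h: "support t homeomorphic cball (0 :: 'a) 1"
    using assms(2) by (auto simp: polyhedral_tile_def)
  show int: "interior (support t) \<noteq> {}"
    by (rule interior_homeomorphic_cball[OF h])
  show "finite (cells t)" using c by (simp add: simplicial_complex_def)
  show "compact C" if "C \<in> cells t" for C
    using c that unfolding simplicial_complex_def by (blast intro: compact_simplex)
  \<comment> \<open>The empty set is a face of every simplex and a simplicial complex contains all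
    faces, so one cell is enough.\<close>
  have "cells t \<noteq> {}" using int by (auto simp: support_def)
  then show "{} \<in> cells t" using c unfolding simplicial_complex_def by (metis empty_face_of ex_in_conv)
qed

theorem theorem2:
  fixes Pr :: "(real ^ 'n, 'm) tile set"
    and P :: "(real ^ 'n, 'm) tile set set"
  assumes "\<forall>t\<in>Pr. polyhedral_tile t"
    and "tiling_space Pr P"
  shows "\<exists>(A :: nat set) (S :: (real ^ 'n, nat) tile set set) (X :: (int ^ 'n \<Rightarrow> nat) set).
           finite A \<and>
           tiling_space (cube_tile ` A) S \<and>
           subshift A X \<and>
           subtopology (tiling_topology (cube_tile ` A)) S homeomorphic_space suspension A X \<and>
           subtopology (tiling_topology Pr) P homeomorphic_space
             subtopology (tiling_topology (cube_tile ` A)) S \<and>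
           (local_matching_rules (cube_tile ` A) S \<longleftrightarrow> local_matching_rules Pr P)"
proof -
  have "protoset Pr"
    using assms by (intro protoset_polyhedral) (simp_all add: tiling_space_def)
  then obtain \<phi> N \<eta> M where "lattice_approximation Pr \<phi> N \<eta> M"
    using ex_lattice_approximation by blast
  then interpret L: lattice_approximation Pr \<phi> N \<eta> M .
  interpret E: local_equivalence Pr "cube_tile ` L.A" L.f L.\<Psi> N L.\<rho>
    by (rule L.local_equivalence)
  interpret S: cube_tiling_space L.A "L.\<Psi> ` P"
  proof
    show "finite L.A" by (rule L.finite_A)
    show "tiling_space (cube_tile ` L.A) (L.\<Psi> ` P)"
      by (rule E.tiling_space_image_\<Psi>[OF assms(2)])
    show "\<exists>x v. Z = cubing x v" if "Z \<in> L.\<Psi> ` P" for Z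
      using that L.\<Psi>_cubing tiling_space_subset[OF assms(2)] by blast
  qed
  show ?thesis
    using S.finite_A S.S S.subshift_X S.homeomorphic_suspension
      E.homeomorphic_image_\<Psi>[OF assms(2)] E.local_matching_rules_image_\<Psi>[OF assms(2)]
    by blast
qed

end
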